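(* Let $F\in\mathbf F$ satisfy condition $\mathbf{H\mathcal A}$ and the integrability condition (I). Then $\mathcal D(F)\neq\emptyset$ implies $\mathbf{NA^w}$. If moreover $\mathbf{HN^0}$ and $\mathbf{KP}$ hold, then $\mathbf{NA^w}$ implies $\mathcal D(F)\neq\emptyset$.
   Context: Fix $T\in\mathbb N$, $\mathbb T=\{0,\dots,T\}$, $d\ge1$, a complete probability space $(\Omega,\mathcal F,\mathbb P)$ and a filtration $\mathbb H=(\mathcal H_t)_{t\in\mathbb T}$ with $\mathcal H_T\subset\mathcal F$ (no other relation between $\mathbb H$ and the other processes is assumed). Equalities and inequalities between random variables are understood $\mathbb P$-a.s. $\mathbb M^d$ denotes the real $d\times d$ matrices, $\mathbb M^d_+$ those with nonnegative entries, and $e_{ij}$ the matrix whose $(i,j)$ entry is $1$ and all other entries $0$. For $E\subset\mathbb M^d$ (or $E\subset\mathbb R^d$) and a $\sigma$-algebra $\mathcal G\subset\mathcal F$, $L^0(E;\mathcal G)$ is the set of $E$-valued $\mathcal G$-measurable random variables; $L^1(\mathbb R^d;\mathcal F)$ and $L^\infty(\mathbb R^d;\mathcal F)$ are the integrable, resp. bounded, elements of $L^0(\mathbb R^d;\mathcal F)$. A closed convex cone $\mathcal A\subset\mathbb M^d$ is fixed; $\mathbb L^0(\mathcal A;\mathbb H)$ denotes the set of $\mathcal A$-valued $\mathbb H$-adapted processes $(\eta_t)_{t\in\mathbb T}$. $\mathbb F$ is the set of continuous maps $f:\mathbb M^d\to\mathbb R^d$ such that (HF1) $f(\lambda a)=\lambda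 f(a)$ for all $\lambda\ge0$, $a\in\mathbb M^d$; (HF2) $f(\lambda a+\beta a')-(\lambda f(a)+\beta f(a'))\in\mathbb R^d_+$ for all $\lambda,\beta\ge0$, $a,a'\in\mathcal A$. $\mathbf F$ is the set of sequences $F=(F_t)_{t\in\mathbb T}$ of $\mathcal F$-measurable random maps $F_t:\Omega\times\mathbb M^d\to\mathbb R^d$ with $F_t(\omega,\cdot)\in\mathbb F$ for a.e. $\omega$ (no adaptedness to $\mathbb H$ is assumed); for a random matrix $\eta$, $F_t(\eta)(\omega)=F_t(\omega,\eta(\omega))$. $N_t(F)=\{F_t(\eta):\eta\in L^0(\mathcal A;\mathcal H_t)\}$, $N^0_t(F)=N_t(F)\cap(-N_t(F))$. For a process $\xi=(\xi_t)_{t\in\mathbb T}$, "$\xi\in N(F)$" means $\xi_t\in N_t(F)$ for all $t$, and "$\xi\in N^0(F)$" means $\xi_t\in N^0_t(F)$ for all $t$. $V_t(\xi)=\sum_{s=0}^t\xi_s$ and $A_t(F)=\{V_t(\xi)-r:\ \xi\in N(F),\ r\in L^0(\mathbb R^d_+;\mathcal F)\}$. Condition $\mathbf{KP}$: for all $\xi,\tilde\xi\in N(F)$, $V_T(\xi)+V_T(\tilde\xi)\in L^0(\mathbb R^d_+;\mathcal F)$ implies $\xi\in N^0(F)$ and $V_T(\xi)+V_T(\tilde\xi)=0$. Condition $\mathbf{HN^0}$: for all $t\in\mathbb T$ and $\eta\in L^0(\mathcal A;\mathcal H_t)$, $F_t(\eta)\in N^0_t(F)$ implies $F_t(-\eta)=-F_t(\eta)$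 and $-\eta\in L^0(\mathcal A;\mathcal H_t)$. Condition $\mathbf{H\mathcal A}$: for every $t\in\mathbb T$: (1) $F_t(\delta e_{ij})=0$ whenever $\delta e_{ij}\notin\mathcal A$, $\delta\in\{-1,1\}$, $i,j\le d$; (2) for every $\eta\in L^0(\mathbb M^d;\mathcal F)$, $F_t(\eta)=\sum_{i,j\le d}(\eta^{ij})^+F_t(e_{ij})+(\eta^{ij})^-F_t(-e_{ij})$. Condition (I): $F_t(e_{ij}),F_t(-e_{ij})\in L^1(\mathbb R^d;\mathcal F)$ for all $i,j\le d$, $t\in\mathbb T$. Condition $\mathbf{NA^w}$: $A_T(F)\cap L^0(\mathbb R^d_+;\mathcal F)=\{0\}$. For $Z\in L^\infty(\mathbb R^d;\mathcal F)$ and $\eta\in L^0(\mathcal A;\mathcal H_t)$, $\bar F_t(\eta;Z):=\mathbb E[Z\cdot F_t(\eta)\mid\mathcal H_t]$, which under $\mathbf{H\mathcal A}$ and (I) is understood as $\sum_{i,j}(\eta^{ij})^+\mathbb E[Z\cdot F_t(e_{ij})\mid\mathcal H_t]+(\eta^{ij})^-\mathbb E[Z\cdot F_t(-e_{ij})\mid\mathcal H_t]$ ($\cdot$ is the scalar product of $\mathbb R^d$). $\mathcal D(F)$ is the set of $Z\in L^\infty(\mathbb R^d;\mathcal F)$ with $Z^i>0$ a.s. for all $i\le d$ such that for all $\eta\in\mathbb L^0(\mathcal A;\mathbb H)$ and $t\in\mathbb T$: (D1) $\bar F_t(\eta_t;Z)\le0$; (D2) $F_t(\eta_t)\mathbf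 1_{\{\bar F_t(\eta_t;Z)=0\}}\in N^0_t(F)$. *)

theory Defs
  imports "HOL-Analysis.Analysis" "HOL-Probability.Probability"
begin

definition emat :: "'d::finite \<Rightarrow> 'd \<Rightarrow> real^'d^'d" where
  "emat i j = (\<chi> k l. if k = i \<and> l = j then 1 else 0)"

definition nonneg_vec :: "real^'d \<Rightarrow> bool" where
  "nonneg_vec v \<longleftrightarrow> (\<forall>i. 0 \<le> v $ i)"

definition is_filtration :: "'a measure \<Rightarrow> (nat \<Rightarrow> 'a measure) \<Rightarrow> nat \<Rightarrow> bool" where
  "is_filtration M H T \<longleftrightarrow> (\<forall>t\<le>T. subalgebra M (H t)) \<and>
     (\<forall>s t. s \<le> t \<and> t \<le> T \<longrightarrow> sets (H s) \<subseteq> sets (H t))"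

definition closed_convex_cone :: "(real^'d^'d) set \<Rightarrow> bool" where
  "closed_convex_cone A \<longleftrightarrow> closed A \<and> convex A \<and> cone A \<and> A \<noteq> {}"

definition frakF :: "(real^'d^'d) set \<Rightarrow> (real^'d^'d \<Rightarrow> real^'d) \<Rightarrow> bool" where
  "frakF A f \<longleftrightarrow> continuous_on UNIV f \<and>
     (\<forall>c::real. \<forall>a. c \<ge> 0 \<longrightarrow> f (c *\<^sub>R a) = c *\<^sub>R f a) \<and>
     (\<forall>c \<beta> :: real. \<forall>a\<in>A. \<forall>a'\<in>A. c \<ge> 0 \<longrightarrow> \<beta> \<ge> 0 \<longrightarrow>
        nonneg_vec (f (c *\<^sub>R a + \<beta> *\<^sub>R a') - (c *\<^sub>R f a + \<beta> *\<^sub>R f a')))"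

definition boldF :: "'a measure \<Rightarrow> (real^'d^'d) set \<Rightarrow> nat \<Rightarrow>
    (nat \<Rightarrow> 'a \<Rightarrow> real^'d^'d \<Rightarrow> real^'d) \<Rightarrow> bool" where
  "boldF M A T F \<longleftrightarrow> (\<forall>t\<le>T. (\<forall>a. (\<lambda>\<omega>. F t \<omega> a) \<in> borel_measurable M) \<and>
      (AE \<omega> in M. frakF A (F t \<omega>)))"

definition L0A :: "'a measure \<Rightarrow> (nat \<Rightarrow> 'a measure) \<Rightarrow> (real^'d^'d) set \<Rightarrow> nat \<Rightarrow>
    ('a \<Rightarrow> real^'d^'d) \<Rightarrow> bool" where
  "L0A M H A t \<eta> \<longleftrightarrow> \<eta> \<in> borel_measurable (H t) \<and> (AE \<omega> in M. \<eta> \<omega> \<in> A)"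

definition inN :: "'a measure \<Rightarrow> (nat \<Rightarrow> 'a measure) \<Rightarrow> (real^'d^'d) set \<Rightarrow>
    (nat \<Rightarrow> 'a \<Rightarrow> real^'d^'d \<Rightarrow> real^'d) \<Rightarrow> nat \<Rightarrow> ('a \<Rightarrow> real^'d) \<Rightarrow> bool" where
  "inN M H A F t X \<longleftrightarrow> (\<exists>\<eta>. L0A M H A t \<eta> \<and> (AE \<omega> in M. X \<omega> = F t \<omega> (\<eta> \<omega>)))"

definition inN0 :: "'a measure \<Rightarrow> (nat \<Rightarrow> 'a measure) \<Rightarrow> (real^'d^'d) set \<Rightarrow>
    (nat \<Rightarrow> 'a \<Rightarrow> real^'d^'d \<Rightarrow> real^'d) \<Rightarrow> nat \<Rightarrow> ('a \<Rightarrow> real^'d) \<Rightarrow> bool" where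
  "inN0 M H A F t X \<longleftrightarrow> inN M H A F t X \<and> inN M H A F t (\<lambda>\<omega>. - X \<omega>)"

definition procN :: "'a measure \<Rightarrow> (nat \<Rightarrow> 'a measure) \<Rightarrow> (real^'d^'d) set \<Rightarrow>
    (nat \<Rightarrow> 'a \<Rightarrow> real^'d^'d \<Rightarrow> real^'d) \<Rightarrow> nat \<Rightarrow> (nat \<Rightarrow> 'a \<Rightarrow> real^'d) \<Rightarrow> bool" where
  "procN M H A F T \<xi> \<longleftrightarrow> (\<forall>t\<le>T. inN M H A F t (\<xi> t))"

definition procN0 :: "'a measure \<Rightarrow> (nat \<Rightarrow> 'a measure) \<Rightarrow> (real^'d^'d) set \<Rightarrow>
    (nat \<Rightarrow> 'a \<Rightarrow> real^'d^'d \<Rightarrow> real^'d) \<Rightarrow> nat \<Rightarrow> (nat \<Rightarrow> 'a \<Rightarrow> real^'d) \<Rightarrow> bool" where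
  "procN0 M H A F T \<xi> \<longleftrightarrow> (\<forall>t\<le>T. inN0 M H A F t (\<xi> t))"

definition Vsum :: "(nat \<Rightarrow> 'a \<Rightarrow> real^'d) \<Rightarrow> nat \<Rightarrow> 'a \<Rightarrow> real^'d" where
  "Vsum \<xi> t \<omega> = (\<Sum>s\<le>t. \<xi> s \<omega>)"

definition inAT :: "'a measure \<Rightarrow> (nat \<Rightarrow> 'a measure) \<Rightarrow> (real^'d^'d) set \<Rightarrow>
    (nat \<Rightarrow> 'a \<Rightarrow> real^'d^'d \<Rightarrow> real^'d) \<Rightarrow> nat \<Rightarrow> ('a \<Rightarrow> real^'d) \<Rightarrow> bool" where
  "inAT M H A F T X \<longleftrightarrow> (\<exists>\<xi> r. procN M H A F T \<xi> \<and> r \<in> borel_measurable M \<and>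
      (AE \<omega> in M. nonneg_vec (r \<omega>)) \<and> (AE \<omega> in M. X \<omega> = Vsum \<xi> T \<omega> - r \<omega>))"

text \<open>\<open>NA^w\<close>: \<open>A_T(F) \<inter> L^0(\<real>^d_+;\<F>) = {0}\<close> (as sets of a.s.-classes).\<close>
definition NAw :: "'a measure \<Rightarrow> (nat \<Rightarrow> 'a measure) \<Rightarrow> (real^'d^'d) set \<Rightarrow>
    (nat \<Rightarrow> 'a \<Rightarrow> real^'d^'d \<Rightarrow> real^'d) \<Rightarrow> nat \<Rightarrow> bool" where
  "NAw M H A F T \<longleftrightarrow> (\<forall>X \<in> borel_measurable M.
      (inAT M H A F T X \<and> (AE \<omega> in M. nonneg_vec (X \<omega>))) \<longleftrightarrow> (AE \<omega> in M. X \<omega> = 0))"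

definition KP :: "'a measure \<Rightarrow> (nat \<Rightarrow> 'a measure) \<Rightarrow> (real^'d^'d) set \<Rightarrow>
    (nat \<Rightarrow> 'a \<Rightarrow> real^'d^'d \<Rightarrow> real^'d) \<Rightarrow> nat \<Rightarrow> bool" where
  "KP M H A F T \<longleftrightarrow> (\<forall>\<xi> \<xi>'. procN M H A F T \<xi> \<longrightarrow> procN M H A F T \<xi>' \<longrightarrow>
      (AE \<omega> in M. nonneg_vec (Vsum \<xi> T \<omega> + Vsum \<xi>' T \<omega>)) \<longrightarrow>
      procN0 M H A F T \<xi> \<and> (AE \<omega> in M. Vsum \<xi> T \<omega> + Vsum \<xi>' T \<omega> = 0))"

definition HN0 :: "'a measure \<Rightarrow> (nat \<Rightarrow> 'a measure) \<Rightarrow> (real^'d^'d) set \<Rightarrow>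
    (nat \<Rightarrow> 'a \<Rightarrow> real^'d^'d \<Rightarrow> real^'d) \<Rightarrow> nat \<Rightarrow> bool" where
  "HN0 M H A F T \<longleftrightarrow> (\<forall>t\<le>T. \<forall>\<eta>. L0A M H A t \<eta> \<longrightarrow>
      inN0 M H A F t (\<lambda>\<omega>. F t \<omega> (\<eta> \<omega>)) \<longrightarrow>
      (AE \<omega> in M. F t \<omega> (- \<eta> \<omega>) = - F t \<omega> (\<eta> \<omega>)) \<and> L0A M H A t (\<lambda>\<omega>. - \<eta> \<omega>))"

definition HcalA :: "'a measure \<Rightarrow> (real^'d^'d) set \<Rightarrow>
    (nat \<Rightarrow> 'a \<Rightarrow> real^'d^'d \<Rightarrow> real^'d) \<Rightarrow> nat \<Rightarrow> bool" where
  "HcalA M A F T \<longleftrightarrow> (\<forall>t\<le>T.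
     (\<forall>i j. \<forall>\<delta>::real. \<delta> \<in> {-1, 1} \<longrightarrow> \<delta> *\<^sub>R emat i j \<notin> A \<longrightarrow>
        (AE \<omega> in M. F t \<omega> (\<delta> *\<^sub>R emat i j) = 0)) \<and>
     (\<forall>\<eta> \<in> borel_measurable M. AE \<omega> in M.
        F t \<omega> (\<eta> \<omega>) = (\<Sum>i\<in>UNIV. \<Sum>j\<in>UNIV.
           max (\<eta> \<omega> $ i $ j) 0 *\<^sub>R F t \<omega> (emat i j) +
           max (- (\<eta> \<omega> $ i $ j)) 0 *\<^sub>R F t \<omega> (- emat i j))))"

definition condI :: "'a measure \<Rightarrow> (nat \<Rightarrow> 'a \<Rightarrow> real^'d^'d \<Rightarrow> real^'d) \<Rightarrow> nat \<Rightarrow> bool" where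
  "condI M F T \<longleftrightarrow> (\<forall>t\<le>T. \<forall>i j. integrable M (\<lambda>\<omega>. F t \<omega> (emat i j)) \<and>
      integrable M (\<lambda>\<omega>. F t \<omega> (- emat i j)))"

text \<open>\<open>\<bar>F_t(\<eta>;Z)\<close> in the form given under HA and (I).\<close>
definition barF :: "'a measure \<Rightarrow> (nat \<Rightarrow> 'a measure) \<Rightarrow>
    (nat \<Rightarrow> 'a \<Rightarrow> real^'d^'d \<Rightarrow> real^'d) \<Rightarrow> nat \<Rightarrow> ('a \<Rightarrow> real^'d^'d) \<Rightarrow>
    ('a \<Rightarrow> real^'d) \<Rightarrow> 'a \<Rightarrow> real" where
  "barF M H F t \<eta> Z \<omega> = (\<Sum>i\<in>UNIV. \<Sum>j\<in>UNIV.
      max (\<eta> \<omega> $ i $ j) 0 * real_cond_exp M (H t) (\<lambda>\<omega>'. Z \<omega>' \<bullet> F t \<omega>' (emat i j)) \<omega> +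
      max (- (\<eta> \<omega> $ i $ j)) 0 * real_cond_exp M (H t) (\<lambda>\<omega>'. Z \<omega>' \<bullet> F t \<omega>' (- emat i j)) \<omega>)"

definition inD :: "'a measure \<Rightarrow> (nat \<Rightarrow> 'a measure) \<Rightarrow> (real^'d^'d) set \<Rightarrow>
    (nat \<Rightarrow> 'a \<Rightarrow> real^'d^'d \<Rightarrow> real^'d) \<Rightarrow> nat \<Rightarrow> ('a \<Rightarrow> real^'d) \<Rightarrow> bool" where
  "inD M H A F T Z \<longleftrightarrow> Z \<in> borel_measurable M \<and> (\<exists>C. AE \<omega> in M. norm (Z \<omega>) \<le> C) \<and>
     (\<forall>i. AE \<omega> in M. Z \<omega> $ i > 0) \<and>
     (\<forall>\<eta>. (\<forall>t\<le>T. L0A M H A t (\<eta> t)) \<longrightarrow> (\<forall>t\<le>T.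
        (AE \<omega> in M. barF M H F t (\<eta> t) Z \<omega> \<le> 0) \<and>
        inN0 M H A F t (\<lambda>\<omega>. if barF M H F t (\<eta> t) Z \<omega> = 0 then F t \<omega> (\<eta> t \<omega>) else 0)))"

end

(*
  If Z satisfies (D1) and sum_t Z.F_t(eta_t) >= 0, one localises on {|eta_t| <= n}, which belongs to
  all later sigma-algebras, and takes conditional expectations backwards in time: the integrable
  minorants of the sum have nonpositive mean, so the sum vanishes.

  Conversely, KP and HN^0 make the set of attainable claims closed under almost sure convergence.
  By backward induction, one picks positions at time t that are minimal in norm among those leading
  to the given claim. If they explode along a subsequence, normalising produces a zero-cost direction
  g which can be traded in both directions by HN^0, and subtracting |eta| g contradicts minimality.
  Every integrable non-attainable claim is then separated from the attainable ones by a bounded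
  random variable, and an exhaustion argument yields one Z that is simultaneously extremal for all
  claims; KP turns extremality into (D2).
*)
theory Submission
  imports Defs
begin


text \<open>Since \<open>F\<close> need not be adapted, the value of a position is not observable at
  its date; only the position is. Minimisation and compactness therefore act on positions, and
  random factors and indices are \<open>H t\<close>-measurable, hence known at all later dates.
  Condition HA writes \<open>F t\<close> as a combination of 2 d^2 random vectors with coefficients
  that depend on the position alone, so conditioning is done coefficient by coefficient. The
  direction g costs nothing because -F_t(g) is attainable at later dates: completed to a full
  strategy, g has a nonnegative total. KP, with zero as the second process, then puts every value of
  this strategy in N^0, and HN^0 reverses the positions themselves. For (D2), suppose that the
  conditional functional of the extremal Z vanishes at a position. It then vanishes for every dual
  variable, so no dual variable separates the negative of the value of that position from the
  attainable claims, and this negative is attainable. Position and offsetting strategy have a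
  nonnegative total, and KP applies once more.\<close>

section \<open>Separation of closed cones by bounded random variables\<close>

text \<open>Quantitative strict convexity of \<open>N\<close>. The lifted vectors (1, u) and (1, v)
  are parallel only if u = v; by Lagrange's identity their Gram determinant is at least the squared
  distance of u and v. The deficit p + q - s controls this determinant because (p + q)^2 - s^2 = 2
  (p q - c).\<close>

lemma norm_one_deficit:
  fixes u v :: "'b::real_inner"
  defines "N \<equiv> \<lambda>x::'b. norm (1::real, x)"
  shows "(norm (u - v))\<^sup>2 \<le>
    (N u + N v - 2 * N ((1/2) *\<^sub>R (u + v))) * (2 * N u * N v * (N u + N v))"
proof -
  define a where "a = (1::real, u)"
  define b where "b = (1::real, v)"
  have half: "(1, (1/2) *\<^sub>R (u + v)) = (1/2) *\<^sub>R (a + b)"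
    by (simp add: a_def b_def)
  have N2: "2 * N ((1/2) *\<^sub>R (u + v)) = norm (a + b)"
    unfolding N_def half by simp
  have Na: "N u = norm a" and Nb: "N v = norm b"
    by (simp_all add: N_def a_def b_def)
  have a1: "norm a \<ge> 1" "norm b \<ge> 1"
    using norm_fst_le[of "1::real" u] norm_fst_le[of "1::real" v] by (simp_all add: a_def b_def)
  define p where "p = norm a"
  define q where "q = norm b"
  define s where "s = norm (a + b)"
  define c where "c = inner a b"
  have cs: "c \<le> p * q" unfolding c_def p_def q_def by (rule norm_cauchy_schwarz)
  have s2: "s\<^sup>2 = p\<^sup>2 + q\<^sup>2 + 2 * c"
    unfolding s_def p_def q_def c_def
    by (simp add: power2_norm_eq_inner inner_add_left inner_add_right inner_commute)
  have spq: "s \<le> p + q" unfolding s_def p_def q_def by (rule norm_triangle_ineq)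
  have s0: "s \<ge> 0" by (simp add: s_def)
  have p1: "p \<ge> 1" "q \<ge> 1" using a1 by (simp_all add: p_def q_def)
  have lag: "(norm (u - v))\<^sup>2 \<le> p\<^sup>2 * q\<^sup>2 - c\<^sup>2"
  proof -
    have "p\<^sup>2 = 1 + inner u u" "q\<^sup>2 = 1 + inner v v" "c = 1 + inner u v"
      by (simp_all add: p_def q_def c_def a_def b_def power2_norm_eq_inner)
    moreover have "(norm (u - v))\<^sup>2 = inner u u + inner v v - 2 * inner u v"
      by (simp add: power2_norm_eq_inner inner_diff_left inner_diff_right inner_commute)
    moreover have "(inner u v)\<^sup>2 \<le> inner u u * inner v v"
      using Cauchy_Schwarz_ineq[of u v] by simp
    ultimately show ?thesis by (simp add: algebra_simps power2_eq_square)
  qed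
  have l1: "p\<^sup>2 * q\<^sup>2 - c\<^sup>2 \<le> (p * q - c) * (2 * p * q)"
  proof -
    have "p\<^sup>2 * q\<^sup>2 - c\<^sup>2 = (p * q - c) * (p * q + c)"
      by (simp add: algebra_simps power2_eq_square)
    also have "\<dots> \<le> (p * q - c) * (2 * p * q)"
      using cs by (intro mult_left_mono) auto
    finally show ?thesis .
  qed
  have l2: "p * q - c \<le> (p + q - s) * (p + q)"
  proof -
    have "2 * (p * q - c) = (p + q - s) * (p + q + s)"
      using s2 by (simp add: algebra_simps power2_eq_square)
    also have "\<dots> \<le> (p + q - s) * (2 * (p + q))"
      using spq by (intro mult_left_mono) auto
    finally show ?thesis by (simp add: algebra_simps)
  qed
  have "(p * q - c) * (2 * p * q) \<le> ((p + q - s) * (p + q)) * (2 * p * q)"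
    using l2 p1 by (intro mult_right_mono) auto
  with lag l1 have "(norm (u - v))\<^sup>2 \<le> ((p + q - s) * (p + q)) * (2 * p * q)" by linarith
  then show ?thesis
    unfolding N2 Na Nb by (simp add: p_def q_def s_def algebra_simps)
qed

text \<open>The vector on the left is the gradient of x |-> norm (1, x) at v; Cauchy-Schwarz for the
  lifted vectors is the tangent inequality.\<close>

lemma norm_one_subgradient:
  fixes u v :: "'b::real_inner"
  shows "inner (v /\<^sub>R norm (1::real, v)) (u - v) \<le> norm (1::real, u) - norm (1::real, v)"
proof -
  define q where "q = norm (1::real, v)"
  have q1: "q \<ge> 1" using norm_fst_le[of "1::real" v] by (simp add: q_def)
  have "1 + inner u v \<le> norm (1::real, u) * q"
    using norm_cauchy_schwarz[of "(1::real, u)" "(1::real, v)"] by (simp add: q_def)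
  moreover have "q * q = 1 + inner v v"
    by (simp add: q_def norm_Pair power2_norm_eq_inner)
  ultimately have "inner v (u - v) \<le> (norm (1::real, u) - q) * q"
    by (simp add: algebra_simps inner_diff_right inner_commute)
  then have "inner v (u - v) / q \<le> norm (1::real, u) - q"
    using q1 by (simp add: divide_simps)
  then show ?thesis by (simp add: q_def divide_inverse mult.commute)
qed

lemma AE_summable_of_summable_integral:
  fixes f :: "nat \<Rightarrow> 'a \<Rightarrow> real"
  assumes int: "\<And>n. integrable M (f n)" and pos: "\<And>n x. 0 \<le> f n x"
    and sm: "summable (\<lambda>n. \<integral>x. f n x \<partial>M)"
  shows "AE x in M. summable (\<lambda>n. f n x)"
proof -
  have [measurable]: "f n \<in> borel_measurable M" for n using int by auto
  have "(\<integral>\<^sup>+x. (\<Sum>n. ennreal (f n x)) \<partial>M) = (\<Sum>n. \<integral>\<^sup>+x. ennreal (f n x) \<partial>M)"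
    by (intro nn_integral_suminf) auto
  also have "\<dots> = (\<Sum>n. ennreal (\<integral>x. f n x \<partial>M))"
    by (intro suminf_cong nn_integral_eq_integral int) (auto simp: pos)
  also have "\<dots> = ennreal (\<Sum>n. \<integral>x. f n x \<partial>M)"
    by (intro suminf_ennreal2 sm) (auto simp: pos)
  finally have "(\<integral>\<^sup>+x. (\<Sum>n. ennreal (f n x)) \<partial>M) \<noteq> \<infinity>" by simp
  then have "AE x in M. (\<Sum>n. ennreal (f n x)) \<noteq> \<infinity>"
    by (intro nn_integral_PInf_AE) auto
  then show ?thesis
    by eventually_elim (rule summable_suminf_not_top[OF pos], simp)
qed

lemma convergent_of_geometric_increments:
  fixes f :: "nat \<Rightarrow> 'b::banach"
  assumes "\<And>n. norm (f n - f (Suc n)) \<le> K * (1/2) ^ n"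
  shows "convergent f"
proof -
  have "summable (\<lambda>n. K * (1/2::real) ^ n)" by (intro summable_mult summable_geometric) auto
  then have "summable (\<lambda>n. f (Suc n) - f n)"
    by (rule summable_comparison_test'[where N = 0]) (use assms in \<open>simp add: norm_minus_commute\<close>)
  then have "convergent (\<lambda>n. \<Sum>i<n. f (Suc i) - f i)"
    by (simp add: summable_iff_convergent)
  then have "convergent (\<lambda>n. f n - f 0)" by (simp add: sum_lessThan_telescope)
  then have "convergent (\<lambda>n. (f n - f 0) + f 0)" by (intro convergent_add convergent_const)
  then show ?thesis by simp
qed

lemma summable_imp_bounded:
  fixes f :: "nat \<Rightarrow> real"
  assumes "summable f"
  obtains K where "K > 0" "\<And>n. f n \<le> K"
proof -
  have "Bseq f" using assms convergent_imp_Bseq summable_LIMSEQ_zero convergentI by blast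
  then obtain K where "K > 0" "\<And>n. norm (f n) \<le> K" by (auto elim: BseqE)
  then show thesis using that by (metis abs_le_D1 real_norm_def)
qed

text \<open>A minimising sequence is bounded only in mean, so pointwise its norms may grow like 2^n.
  The deficit bound then carries a cubic factor 8^n, which the rate 32^-n turns into 4^-n; roots
  leave geometric increments.\<close>

lemma convergent_of_deficits:
  fixes u :: "nat \<Rightarrow> 'b::euclidean_space"
  defines "N \<equiv> \<lambda>x::'b. norm (1::real, x)"
  assumes s1: "summable (\<lambda>n. (1/2)^n * N (u n))"
    and s2: "summable (\<lambda>n. 32^n * (N (u n) + N (u (Suc n)) - 2 * N ((1/2) *\<^sub>R (u n + u (Suc n)))))"
  shows "convergent u"
proof -
  obtain K where K: "K > 0" "\<And>n. (1/2)^n * N (u n) \<le> K"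
    using summable_imp_bounded[OF s1] by blast
  define e where "e n = N (u n) + N (u (Suc n)) - 2 * N ((1/2) *\<^sub>R (u n + u (Suc n)))" for n
  obtain L where L: "L > 0" "\<And>n. 32^n * e n \<le> L"
    using summable_imp_bounded[OF s2] unfolding e_def by blast
  have N0: "N x \<ge> 0" for x by (simp add: N_def)
  have NK: "N (u n) \<le> K * 2^n" for n
    using K(2)[of n] by (simp add: field_simps)
  have eL: "e n \<le> L / 32^n" for n using L(2)[of n] by (simp add: field_simps)
  have "norm (u n - u (Suc n)) \<le> sqrt (12 * L * K^3) * (1/2)^n" for n
  proof -
    define a where "a = N (u n)"
    define b where "b = N (u (Suc n))"
    have ab: "0 \<le> a" "0 \<le> b" "a \<le> K * 2^n" "b \<le> K * 2 * 2^n"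
      using N0 NK[of n] NK[of "Suc n"] by (auto simp: a_def b_def)
    have "2 * a * b * (a + b) \<le> 2 * (K * 2^n) * (K * 2 * 2^n) * (K * 2^n + K * 2 * 2^n)"
      using ab K(1) by (intro mult_mono add_mono) auto
    also have "\<dots> = 12 * K^3 * 8^n"
    proof -
      have "(8::real)^n = 2^n * 2^n * 2^n" by (simp flip: power_mult_distrib)
      then show ?thesis by (simp add: algebra_simps power3_eq_cube)
    qed
    finally have w: "2 * a * b * (a + b) \<le> 12 * K^3 * 8^n" .
    have "(norm (u n - u (Suc n)))\<^sup>2 \<le> e n * (2 * a * b * (a + b))"
      using norm_one_deficit[of "u n" "u (Suc n)"] by (simp add: e_def a_def b_def N_def)
    also have "\<dots> \<le> (L / 32^n) * (2 * a * b * (a + b))"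
      using eL ab by (intro mult_right_mono) auto
    also have "\<dots> \<le> (L / 32^n) * (12 * K^3 * 8^n)"
      using w L(1) by (intro mult_left_mono) auto
    also have "\<dots> = (12 * L * K^3) * ((1/2)^n)\<^sup>2"
    proof -
      have "(8::real)^n / 32^n = (1/4)^n" by (simp flip: power_divide)
      moreover have "((1/2::real)^n)\<^sup>2 = (1/4)^n"
        by (simp add: power2_eq_square flip: power_mult_distrib)
      ultimately show ?thesis by (simp add: field_simps)
    qed
    finally have "norm (u n - u (Suc n)) \<le> sqrt ((12 * L * K^3) * ((1/2)^n)\<^sup>2)"
      by (rule real_le_rsqrt)
    then show ?thesis by (simp add: real_sqrt_mult)
  qed
  then show ?thesis by (rule convergent_of_geometric_increments)
qed

text \<open>The separating functional is the gradient of the strictly convex functional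
  \<open>c \<mapsto> E (sqrt (1 + |X - c|\<^sup>2))\<close> at its minimiser over the cone: it is bounded because the integrand
  is Lipschitz, and strict convexity makes fast minimising sequences converge almost surely.\<close>
theorem (in prob_space) bounded_separation_of_closed_cone:
  fixes X :: "'a \<Rightarrow> 'b::euclidean_space" and C :: "('a \<Rightarrow> 'b) set"
  assumes int: "\<And>c. c \<in> C \<Longrightarrow> integrable M c"
    and zero: "(\<lambda>_. 0) \<in> C"
    and add: "\<And>c c'. c \<in> C \<Longrightarrow> c' \<in> C \<Longrightarrow> (\<lambda>\<omega>. c \<omega> + c' \<omega>) \<in> C"
    and scale: "\<And>c r. c \<in> C \<Longrightarrow> 0 \<le> r \<Longrightarrow> (\<lambda>\<omega>. r *\<^sub>R c \<omega>) \<in> C"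
    and closed: "\<And>cs c. (\<And>n::nat. cs n \<in> C) \<Longrightarrow> integrable M c \<Longrightarrow>
        (AE \<omega> in M. (\<lambda>n. cs n \<omega>) \<longlonglongrightarrow> c \<omega>) \<Longrightarrow> c \<in> C"
    and X: "integrable M X" "X \<notin> C"
  shows "\<exists>Z \<in> borel_measurable M. (\<forall>\<omega>. norm (Z \<omega>) \<le> 1) \<and>
      (\<forall>c\<in>C. (\<integral>\<omega>. Z \<omega> \<bullet> c \<omega> \<partial>M) \<le> 0) \<and> 0 < (\<integral>\<omega>. Z \<omega> \<bullet> X \<omega> \<partial>M)"
proof -
  define N where "N x = norm (1::real, x)" for x :: 'b
  have contN: "continuous_on UNIV N" unfolding N_def by (intro continuous_intros)
  have [measurable]: "N \<in> borel_measurable borel"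
    by (rule borel_measurable_continuous_onI[OF contN])
  have N1: "N x \<ge> 1" for x using norm_fst_le[of "1::real" x] by (simp add: N_def)
  have N0: "N x \<ge> 0" for x using N1[of x] by linarith
  have N_le: "N x \<le> 1 + norm x" for x
    using norm_Pair_le[of "1::real" x] by (simp add: N_def)
  have N_ge: "norm x \<le> N x" for x using norm_snd_le[of x "1::real"] by (simp add: N_def)
  have N_int: "integrable M (\<lambda>\<omega>. N (u \<omega>))" if "integrable M u" for u
  proof (rule Bochner_Integration.integrable_bound[where f = "\<lambda>\<omega>. 1 + norm (u \<omega>)"])
    show "integrable M (\<lambda>\<omega>. 1 + norm (u \<omega>))" using that by auto
    show "(\<lambda>\<omega>. N (u \<omega>)) \<in> borel_measurable M" using that by measurable
  qed (use N_le N0 in auto)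
  have uint: "integrable M (\<lambda>\<omega>. X \<omega> - c \<omega>)" if "c \<in> C" for c
    using int[OF that] X(1) by auto
  define J where "J c = (\<integral>\<omega>. N (X \<omega> - c \<omega>) \<partial>M)" for c
  define I where "I = (INF c\<in>C. J c)"
  have J0: "J c \<ge> 0" for c unfolding J_def by (intro integral_nonneg_AE) (simp add: N0)
  have bdd: "bdd_below (J ` C)" using J0 by (intro bdd_belowI[where m = 0]) auto
  have I_le: "I \<le> J c" if "c \<in> C" for c unfolding I_def using bdd that by (rule cINF_lower)
  \<comment> \<open>The rate 1/64 leaves 2^-n after multiplication by the 32^n that
    \<open>convergent_of_deficits\<close> asks for.\<close>
  have "\<exists>c\<in>C. J c < I + (1/64)^n" for n :: nat
  proof -
    have "(INF c\<in>C. J c) < I + (1/64)^n" by (simp add: I_def)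
    then show ?thesis using cINF_less_iff[OF _ bdd, of "I + (1/64)^n"] zero by blast
  qed
  then obtain cs where cs: "\<And>n. cs n \<in> C" "\<And>n. J (cs n) < I + (1/64)^n" by metis
  define u where "u n \<omega> = X \<omega> - cs n \<omega>" for n \<omega>
  have u_int: "integrable M (u n)" for n unfolding u_def using uint[OF cs(1)] .
  have [measurable]: "u n \<in> borel_measurable M" "X \<in> borel_measurable M"
    "cs n \<in> borel_measurable M" for n
    using u_int X(1) int[OF cs(1)] by auto
  define e where "e n \<omega> = N (u n \<omega>) + N (u (Suc n) \<omega>)
      - 2 * N ((1/2) *\<^sub>R (u n \<omega> + u (Suc n) \<omega>))" for n \<omega>
  have e0: "e n \<omega> \<ge> 0" for n \<omega>
  proof -
    have "2 * N ((1/2) *\<^sub>R (u n \<omega> + u (Suc n) \<omega>))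
        = norm ((1::real, u n \<omega>) + (1, u (Suc n) \<omega>))"
    proof -
      have "(1, (1/2) *\<^sub>R (u n \<omega> + u (Suc n) \<omega>))
          = (1/2::real) *\<^sub>R ((1::real, u n \<omega>) + (1, u (Suc n) \<omega>))" by simp
      then show ?thesis unfolding N_def by (simp only: norm_scaleR)
    qed
    then show ?thesis
      using norm_triangle_ineq[of "(1::real, u n \<omega>)" "(1, u (Suc n) \<omega>)"]
      by (simp add: e_def N_def)
  qed
  have mid_int: "integrable M (\<lambda>\<omega>. N ((1/2) *\<^sub>R (u n \<omega> + u (Suc n) \<omega>)))" for n
    by (intro N_int integrable_scaleR_right Bochner_Integration.integrable_add u_int)
  have e_int: "integrable M (e n)" for n
    unfolding e_def
    by (intro Bochner_Integration.integrable_add Bochner_Integration.integrable_diff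
        integrable_mult_right N_int u_int mid_int)
  have e_le: "(\<integral>\<omega>. e n \<omega> \<partial>M) \<le> 2 * (1/64)^n" for n
  proof -
    \<comment> \<open>The midpoint of two competitors is in the cone, so its value is at least
      \<open>I\<close>, and the mean deficit is bounded by the two excesses over
      \<open>I\<close>.\<close>
    have mid: "(\<lambda>\<omega>. (1/2) *\<^sub>R (cs n \<omega> + cs (Suc n) \<omega>)) \<in> C" by (intro scale add cs) auto
    have mid_eq: "X \<omega> - (1/2) *\<^sub>R (cs n \<omega> + cs (Suc n) \<omega>)
        = (1/2) *\<^sub>R (u n \<omega> + u (Suc n) \<omega>)" for \<omega>
    proof -
      have "X \<omega> = (1/2) *\<^sub>R (X \<omega> + X \<omega>)" by (simp flip: scaleR_2)
      then show ?thesis by (simp add: u_def algebra_simps)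
    qed
    have "(\<integral>\<omega>. e n \<omega> \<partial>M) = J (cs n) + J (cs (Suc n))
        - 2 * (\<integral>\<omega>. N ((1/2) *\<^sub>R (u n \<omega> + u (Suc n) \<omega>)) \<partial>M)"
      unfolding e_def J_def u_def[symmetric]
      by (simp add: N_int u_int mid_int)
    moreover have "(\<integral>\<omega>. N ((1/2) *\<^sub>R (u n \<omega> + u (Suc n) \<omega>)) \<partial>M) \<ge> I"
      using I_le[OF mid] unfolding J_def mid_eq .
    ultimately have "(\<integral>\<omega>. e n \<omega> \<partial>M) \<le> (1/64)^n + (1/64)^(Suc n)"
      using cs(2)[of n] cs(2)[of "Suc n"] by linarith
    also have "\<dots> \<le> 2 * (1/64)^n" by simp
    finally show ?thesis .
  qed
  have "AE \<omega> in M. summable (\<lambda>n. (1/2)^n * N (u n \<omega>))"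
  proof (rule AE_summable_of_summable_integral)
    show "integrable M (\<lambda>\<omega>. (1/2)^n * N (u n \<omega>))" for n by (intro integrable_mult_right N_int u_int)
    show "0 \<le> (1/2)^n * N (u n \<omega>)" for n \<omega> by (simp add: N0)
    show "summable (\<lambda>n. \<integral>\<omega>. (1/2)^n * N (u n \<omega>) \<partial>M)"
    proof (rule summable_comparison_test'[where N = 0 and g = "\<lambda>n. (I + 1) * (1/2)^n"])
      show "summable (\<lambda>n. (I + 1) * (1/2::real)^n)" by (intro summable_mult summable_geometric) auto
      have "J (cs n) \<le> I + 1" for n
        using cs(2)[of n] power_le_one[of "1/64::real" n] by (auto intro: order_trans[OF less_imp_le])
      then show "norm (\<integral>\<omega>. (1/2)^n * N (u n \<omega>) \<partial>M) \<le> (I + 1) * (1/2)^n" for n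
        using J0[of "cs n"] by (simp add: J_def u_def divide_right_mono)
    qed
  qed
  moreover have "AE \<omega> in M. summable (\<lambda>n. 32^n * e n \<omega>)"
  proof (rule AE_summable_of_summable_integral)
    show "integrable M (\<lambda>\<omega>. 32^n * e n \<omega>)" for n by (intro integrable_mult_right e_int)
    show "0 \<le> 32^n * e n \<omega>" for n \<omega> by (simp add: e0)
    show "summable (\<lambda>n. \<integral>\<omega>. 32^n * e n \<omega> \<partial>M)"
    proof (rule summable_comparison_test'[where N = 0 and g = "\<lambda>n. 2 * (1/2)^n"])
      show "summable (\<lambda>n. 2 * (1/2::real)^n)" by (intro summable_mult summable_geometric) auto
      show "norm (\<integral>\<omega>. 32^n * e n \<omega> \<partial>M) \<le> 2 * (1/2)^n" for n
      proof -
        have "(\<integral>\<omega>. e n \<omega> \<partial>M) \<ge> 0" by (intro integral_nonneg_AE) (simp add: e0)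
        moreover have "32^n * (\<integral>\<omega>. e n \<omega> \<partial>M) \<le> 2 * (1/2)^n"
        proof -
          have "32^n * (\<integral>\<omega>. e n \<omega> \<partial>M) \<le> 32^n * (2 * (1/64)^n)"
            by (intro mult_left_mono e_le) auto
          also have "\<dots> = 2 * ((32::real)^n * (1/64)^n)" by simp
          also have "(32::real)^n * (1/64)^n = (1/2)^n" by (simp flip: power_mult_distrib)
          finally show ?thesis .
        qed
        ultimately show ?thesis by simp
      qed
    qed
  qed
  ultimately have conv_u: "AE \<omega> in M. convergent (\<lambda>n. u n \<omega>)"
    by eventually_elim (rule convergent_of_deficits; simp add: N_def e_def)
  define U where "U \<omega> = lim (\<lambda>n. u n \<omega>)" for \<omega>
  have [measurable]: "U \<in> borel_measurable M" unfolding U_def by measurable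
  have lim_u: "AE \<omega> in M. (\<lambda>n. u n \<omega>) \<longlonglongrightarrow> U \<omega>"
    using conv_u by eventually_elim (simp add: U_def convergent_LIMSEQ_iff)
  \<comment> \<open>No dominating function is at hand; Fatou's lemma shows that the limit is
    integrable and attains the infimum.\<close>
  have NU: "(\<integral>\<^sup>+\<omega>. N (U \<omega>) \<partial>M) \<le> ennreal I"
  proof -
    have "(\<integral>\<^sup>+\<omega>. N (U \<omega>) \<partial>M) = (\<integral>\<^sup>+\<omega>. liminf (\<lambda>n. ennreal (N (u n \<omega>))) \<partial>M)"
    proof (rule nn_integral_cong_AE, use lim_u in eventually_elim)
      case (elim \<omega>)
      have "(\<lambda>n. N (u n \<omega>)) \<longlonglongrightarrow> N (U \<omega>)"
        using contN elim by (rule continuous_on_tendsto_compose) auto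
      then have "(\<lambda>n. ennreal (N (u n \<omega>))) \<longlonglongrightarrow> ennreal (N (U \<omega>))" by (rule tendsto_ennrealI)
      then show ?case by (simp add: lim_imp_Liminf)
    qed
    also have "\<dots> \<le> liminf (\<lambda>n. \<integral>\<^sup>+\<omega>. N (u n \<omega>) \<partial>M)" by (intro nn_integral_liminf) auto
    also have "\<dots> \<le> liminf (\<lambda>n. ennreal (I + (1/64)^n))"
    proof (intro Liminf_mono always_eventually allI)
      fix n
      have "(\<integral>\<^sup>+\<omega>. N (u n \<omega>) \<partial>M) = ennreal (J (cs n))"
        unfolding J_def u_def[symmetric] by (intro nn_integral_eq_integral N_int u_int) (simp add: N0)
      then show "(\<integral>\<^sup>+\<omega>. N (u n \<omega>) \<partial>M) \<le> ennreal (I + (1/64)^n)"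
        using cs(2)[of n] by (simp add: ennreal_leI)
    qed
    also have "\<dots> = ennreal I"
    proof (rule lim_imp_Liminf)
      have "(\<lambda>n. I + (1/64::real)^n) \<longlonglongrightarrow> I + 0"
        by (intro tendsto_add tendsto_const LIMSEQ_power_zero) auto
      then show "(\<lambda>n. ennreal (I + (1/64)^n)) \<longlonglongrightarrow> ennreal I" by (intro tendsto_ennrealI) simp
    qed simp
    finally show ?thesis .
  qed
  have U_int: "integrable M U"
  proof (rule integrableI_bounded)
    have "(\<integral>\<^sup>+\<omega>. ennreal (norm (U \<omega>)) \<partial>M) \<le> (\<integral>\<^sup>+\<omega>. N (U \<omega>) \<partial>M)"
      by (intro nn_integral_mono ennreal_leI N_ge)
    also have "\<dots> < \<infinity>" using NU by (rule le_less_trans) simp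
    finally show "(\<integral>\<^sup>+\<omega>. ennreal (norm (U \<omega>)) \<partial>M) < \<infinity>" .
  qed measurable
  have I0: "I \<ge> 0" unfolding I_def using zero J0 by (intro cINF_greatest) auto
  have JU: "(\<integral>\<omega>. N (U \<omega>) \<partial>M) \<le> I"
  proof -
    have "(\<integral>\<^sup>+\<omega>. N (U \<omega>) \<partial>M) = ennreal (\<integral>\<omega>. N (U \<omega>) \<partial>M)"
      by (intro nn_integral_eq_integral N_int U_int) (simp add: N0)
    with NU show ?thesis using I0 by (simp add: ennreal_le_iff)
  qed
  define c0 where "c0 \<omega> = X \<omega> - U \<omega>" for \<omega>
  have c0: "c0 \<in> C"
  proof (rule closed[of cs])
    show "integrable M c0" unfolding c0_def using X(1) U_int by auto
    show "AE \<omega> in M. (\<lambda>n. cs n \<omega>) \<longlonglongrightarrow> c0 \<omega>"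
      using lim_u
    proof eventually_elim
      case (elim \<omega>)
      then have "(\<lambda>n. X \<omega> - u n \<omega>) \<longlonglongrightarrow> X \<omega> - U \<omega>" by (intro tendsto_intros)
      then show ?case by (simp add: u_def c0_def)
    qed
  qed (rule cs)
  define D where "D x = x /\<^sub>R N x" for x
  have contD: "continuous_on UNIV D"
    unfolding D_def by (intro continuous_intros contN) (metis N1 not_one_le_zero)
  have [measurable]: "D \<in> borel_measurable borel"
    by (rule borel_measurable_continuous_onI[OF contD])
  have D1: "norm (D x) \<le> 1" for x
    using N_ge[of x] N1[of x] by (simp add: D_def field_simps)
  have Dc: "\<bar>D x \<bullet> c\<bar> \<le> norm c" for x c
    using Cauchy_Schwarz_ineq2[of "D x" c] mult_right_mono[OF D1[of x], of "norm c"] by simp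
  have D_int: "integrable M (\<lambda>\<omega>. D (V \<omega>) \<bullet> c \<omega>)"
    if "integrable M c" "V \<in> borel_measurable M" for V c
  proof (rule Bochner_Integration.integrable_bound[where f = "\<lambda>\<omega>. norm (c \<omega>)"])
    show "integrable M (\<lambda>\<omega>. norm (c \<omega>))" using that by auto
    show "(\<lambda>\<omega>. D (V \<omega>) \<bullet> c \<omega>) \<in> borel_measurable M" using that by measurable
  qed (use Dc in auto)
  \<comment> \<open>First-order condition at the minimiser, in any direction whose steps 1/(n+1)
    stay in \<open>C\<close>. The tangent inequality is taken at the perturbed point, so minimality
    gives a sign for each n, and dominated convergence lets the step shrink.\<close>
  have foc: "(\<integral>\<omega>. D (U \<omega>) \<bullet> c \<omega> \<partial>M) \<le> 0"
    if c: "integrable M c" and dir: "\<And>n. (\<lambda>\<omega>. c0 \<omega> + (1 / Suc n) *\<^sub>R c \<omega>) \<in> C" for c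
  proof -
    define r where "r n = 1 / real (Suc n)" for n
    have [measurable]: "c \<in> borel_measurable M" using c by auto
    have neg: "(\<integral>\<omega>. D (U \<omega> - r n *\<^sub>R c \<omega>) \<bullet> c \<omega> \<partial>M) \<le> 0" for n
    proof -
      have r: "r n > 0" by (simp add: r_def)
      have Xu: "X \<omega> - (c0 \<omega> + r n *\<^sub>R c \<omega>) = U \<omega> - r n *\<^sub>R c \<omega>" for \<omega> by (simp add: c0_def)
      have int': "integrable M (\<lambda>\<omega>. U \<omega> - r n *\<^sub>R c \<omega>)" using U_int c by auto
      have "I \<le> (\<integral>\<omega>. N (U \<omega> - r n *\<^sub>R c \<omega>) \<partial>M)"
        using I_le[OF dir[of n]] unfolding J_def r_def[symmetric] Xu .
      moreover have "r n * (\<integral>\<omega>. D (U \<omega> - r n *\<^sub>R c \<omega>) \<bullet> c \<omega> \<partial>M)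
          \<le> (\<integral>\<omega>. N (U \<omega>) - N (U \<omega> - r n *\<^sub>R c \<omega>) \<partial>M)"
      proof -
        have "(\<integral>\<omega>. r n * (D (U \<omega> - r n *\<^sub>R c \<omega>) \<bullet> c \<omega>) \<partial>M)
            \<le> (\<integral>\<omega>. N (U \<omega>) - N (U \<omega> - r n *\<^sub>R c \<omega>) \<partial>M)"
        proof (rule integral_mono)
          fix \<omega>
          show "r n * (D (U \<omega> - r n *\<^sub>R c \<omega>) \<bullet> c \<omega>) \<le> N (U \<omega>) - N (U \<omega> - r n *\<^sub>R c \<omega>)"
            using norm_one_subgradient[of "U \<omega> - r n *\<^sub>R c \<omega>" "U \<omega>"] by (simp add: D_def N_def)
        qed (auto intro!: D_int N_int c U_int int' integrable_mult_right)
        then show ?thesis by simp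
      qed
      ultimately have "r n * (\<integral>\<omega>. D (U \<omega> - r n *\<^sub>R c \<omega>) \<bullet> c \<omega> \<partial>M) \<le> 0"
        using JU by (simp add: N_int U_int int')
      then show ?thesis using r by (simp add: mult_le_0_iff)
    qed
    have "(\<lambda>n. \<integral>\<omega>. D (U \<omega> - r n *\<^sub>R c \<omega>) \<bullet> c \<omega> \<partial>M) \<longlonglongrightarrow> (\<integral>\<omega>. D (U \<omega>) \<bullet> c \<omega> \<partial>M)"
    proof (rule integral_dominated_convergence[where w = "\<lambda>\<omega>. norm (c \<omega>)"])
      show "AE \<omega> in M. (\<lambda>n. D (U \<omega> - r n *\<^sub>R c \<omega>) \<bullet> c \<omega>) \<longlonglongrightarrow> D (U \<omega>) \<bullet> c \<omega>"
      proof (rule AE_I2)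
        fix \<omega>
        have "r \<longlonglongrightarrow> 0" unfolding r_def by (rule lim_1_over_n[THEN LIMSEQ_Suc])
        then have "(\<lambda>n. U \<omega> - r n *\<^sub>R c \<omega>) \<longlonglongrightarrow> U \<omega> - 0 *\<^sub>R c \<omega>" by (intro tendsto_intros)
        then have "(\<lambda>n. D (U \<omega> - r n *\<^sub>R c \<omega>)) \<longlonglongrightarrow> D (U \<omega>)"
          by (intro continuous_on_tendsto_compose[OF contD]) auto
        then show "(\<lambda>n. D (U \<omega> - r n *\<^sub>R c \<omega>) \<bullet> c \<omega>) \<longlonglongrightarrow> D (U \<omega>) \<bullet> c \<omega>"
          by (intro tendsto_intros)
      qed
    qed (use c Dc in auto)
    then show ?thesis using neg by (auto intro: LIMSEQ_le_const2)
  qed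
  define Z where "Z \<omega> = D (U \<omega>)" for \<omega>
  have "(\<integral>\<omega>. Z \<omega> \<bullet> c \<omega> \<partial>M) \<le> 0" if "c \<in> C" for c
    unfolding Z_def using that int by (intro foc add c0 scale) auto
  moreover have "0 < (\<integral>\<omega>. Z \<omega> \<bullet> X \<omega> \<partial>M)"
  proof -
    have c0_int: "integrable M c0" by (rule int[OF c0])
    \<comment> \<open>The cone contains (1 - 1/(n+1)) \<open>c0\<close>, so the direction
      -\<open>c0\<close> is allowed too.\<close>
    have "(\<integral>\<omega>. D (U \<omega>) \<bullet> (- c0 \<omega>) \<partial>M) \<le> 0"
    proof (rule foc)
      fix n
      have "(\<lambda>\<omega>. (1 - 1 / Suc n) *\<^sub>R c0 \<omega>) \<in> C" by (intro scale c0) (simp add: field_simps)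
      then show "(\<lambda>\<omega>. c0 \<omega> + (1 / Suc n) *\<^sub>R - c0 \<omega>) \<in> C" by (simp add: scaleR_diff_left)
    qed (use c0_int in auto)
    then have 1: "(\<integral>\<omega>. Z \<omega> \<bullet> c0 \<omega> \<partial>M) \<ge> 0" by (simp add: Z_def)
    have ZU: "Z \<omega> \<bullet> U \<omega> = (norm (U \<omega>))\<^sup>2 / N (U \<omega>)" for \<omega>
      by (simp add: Z_def D_def power2_norm_eq_inner divide_inverse mult.commute)
    have ZU0: "Z \<omega> \<bullet> U \<omega> \<ge> 0" for \<omega> unfolding ZU using N0 by simp
    have ZU_int: "integrable M (\<lambda>\<omega>. Z \<omega> \<bullet> U \<omega>)" unfolding Z_def by (intro D_int U_int) auto
    have "(\<integral>\<omega>. Z \<omega> \<bullet> U \<omega> \<partial>M) \<noteq> 0"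
    proof
      assume "(\<integral>\<omega>. Z \<omega> \<bullet> U \<omega> \<partial>M) = 0"
      then have "AE \<omega> in M. Z \<omega> \<bullet> U \<omega> = 0"
        using integral_nonneg_eq_0_iff_AE[OF ZU_int] ZU0 by simp
      then have "AE \<omega> in M. c0 \<omega> = X \<omega>"
      proof eventually_elim
        case (elim \<omega>)
        then show ?case using N1[of "U \<omega>"] by (auto simp: ZU c0_def)
      qed
      then have "AE \<omega> in M. (\<lambda>n::nat. c0 \<omega>) \<longlonglongrightarrow> X \<omega>" by eventually_elim auto
      \<comment> \<open>Applied to a constant sequence, \<open>closed\<close> says that
        \<open>C\<close> is stable under almost sure equality.\<close>
      then have "X \<in> C" using closed[of "\<lambda>_. c0" X] c0 X(1) by simp
      with X(2) show False ..
    qed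
    moreover have "(\<integral>\<omega>. Z \<omega> \<bullet> U \<omega> \<partial>M) \<ge> 0" by (intro integral_nonneg_AE) (simp add: ZU0)
    moreover have "(\<integral>\<omega>. Z \<omega> \<bullet> X \<omega> \<partial>M) = (\<integral>\<omega>. Z \<omega> \<bullet> U \<omega> \<partial>M) + (\<integral>\<omega>. Z \<omega> \<bullet> c0 \<omega> \<partial>M)"
    proof -
      have "integrable M (\<lambda>\<omega>. Z \<omega> \<bullet> c0 \<omega>)" unfolding Z_def by (intro D_int c0_int) auto
      then show ?thesis
        using ZU_int by (simp flip: Bochner_Integration.integral_add inner_add_right) (simp add: c0_def)
    qed
    ultimately show ?thesis using 1 by linarith
  qed
  moreover have "Z \<in> borel_measurable M" unfolding Z_def by measurable
  ultimately show ?thesis using D1 by (intro bexI[of _ Z]) (auto simp: Z_def)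
qed


section \<open>Measurable selection\<close>

text \<open>Exhaustion: for each k take a sequence along which the probability of \<open>E k\<close>
  tends to its infimum. \<open>meet\<close> gives one z below all these countably many sequences, so
  z attains every infimum, and an event inside \<open>E k z\<close> then cannot be essentially
  smaller. Applied both to positions and to dual variables.\<close>

lemma (in finite_measure) simultaneous_minimiser:
  fixes E :: "'k \<Rightarrow> 'z \<Rightarrow> 'a \<Rightarrow> bool"
  assumes "S \<noteq> {}" and I: "countable I"
    and meas: "\<And>k z. k \<in> I \<Longrightarrow> z \<in> S \<Longrightarrow> Measurable.pred M (E k z)"
    and meet: "\<And>zs :: nat \<Rightarrow> 'z. (\<And>n. zs n \<in> S) \<Longrightarrow>
        \<exists>z\<in>S. \<forall>n. \<forall>k\<in>I. AE \<omega> in M. E k z \<omega> \<longrightarrow> E k (zs n) \<omega>"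
  shows "\<exists>z\<in>S. \<forall>z'\<in>S. \<forall>k\<in>I. (AE \<omega> in M. E k z' \<omega> \<longrightarrow> E k z \<omega>) \<longrightarrow>
      (AE \<omega> in M. E k z \<omega> \<longrightarrow> E k z' \<omega>)"
proof (cases "I = {}")
  case True
  then show ?thesis using assms(1) by blast
next
  case False
  define p where "p k z = measure M {\<omega> \<in> space M. E k z \<omega>}" for k z
  define m where "m k = (INF z\<in>S. p k z)" for k
  have bdd: "bdd_below (p k ` S)" for k
    by (intro bdd_belowI[where m = 0]) (auto simp: p_def)
  have "\<exists>z\<in>S. p k z < m k + 1 / Suc n" for k n
    using cINF_less_iff[OF assms(1) bdd[of k], of "m k + 1 / Suc n"] by (simp add: m_def)
  then obtain zs where zs: "\<And>k n. zs k n \<in> S" "\<And>k n. p k (zs k n) < m k + 1 / Suc n"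
    by metis
  \<comment> \<open>All minimising sequences are packed into one by a pairing of indices, so that a
    single use of \<open>meet\<close> suffices.\<close>
  define ys where "ys j = (case prod_decode j of (i, n) \<Rightarrow> zs (from_nat_into I i) n)" for j
  have "\<exists>z\<in>S. \<forall>j. \<forall>k\<in>I. AE \<omega> in M. E k z \<omega> \<longrightarrow> E k (ys j) \<omega>"
    by (rule meet) (auto simp: ys_def zs split: prod.split)
  then obtain z where z: "z \<in> S" "\<And>j k. k \<in> I \<Longrightarrow> AE \<omega> in M. E k z \<omega> \<longrightarrow> E k (ys j) \<omega>"
    by blast
  have p_mono: "p k z \<le> p k z'" if "k \<in> I" "z \<in> S" "z' \<in> S" "AE \<omega> in M. E k z \<omega> \<longrightarrow> E k z' \<omega>" for k z z'
    unfolding p_def using meas[OF that(1,3)] that(4) by (intro finite_measure_mono_AE) auto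
  have pz: "p k z \<le> m k" if k: "k \<in> I" for k
  proof -
    have "p k z \<le> m k + 1 / Suc n" for n
    proof -
      obtain i where i: "from_nat_into I i = k" using k I by (metis from_nat_into_surj)
      have "ys (prod_encode (i, n)) = zs k n" by (simp add: ys_def i)
      then have "p k z \<le> p k (zs k n)" using z k zs p_mono by metis
      with zs(2)[of k n] show ?thesis by linarith
    qed
    moreover have "(\<lambda>n. m k + 1 / Suc n) \<longlonglongrightarrow> m k + 0"
      by (intro tendsto_add tendsto_const lim_1_over_n[THEN LIMSEQ_Suc])
    ultimately show ?thesis using LIMSEQ_le_const by fastforce
  qed
  show ?thesis
  proof (intro bexI[of _ z] ballI impI)
    fix z' k assume z': "z' \<in> S" and k: "k \<in> I" and le: "AE \<omega> in M. E k z' \<omega> \<longrightarrow> E k z \<omega>"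
    have [measurable]: "Measurable.pred M (E k z)" "Measurable.pred M (E k z')"
      using meas k z z' by auto
    have "p k z \<le> p k z'" using pz[OF k] cINF_lower[OF bdd z'] by (simp add: m_def order_trans)
    moreover have "measure M {\<omega> \<in> space M. E k z \<omega>} =
        measure M {\<omega> \<in> space M. E k z' \<omega>} + measure M {\<omega> \<in> space M. E k z \<omega> \<and> \<not> E k z' \<omega>}"
    proof -
      have "measure M {\<omega> \<in> space M. E k z \<omega>} =
        measure M ({\<omega> \<in> space M. E k z' \<omega>} \<union> {\<omega> \<in> space M. E k z \<omega> \<and> \<not> E k z' \<omega>})"
        using le by (intro finite_measure_eq_AE) (auto elim!: AE_mp)
      also have "\<dots> = measure M {\<omega> \<in> space M. E k z' \<omega>} + measure M {\<omega> \<in> space M. E k z \<omega> \<and> \<not> E k z' \<omega>}"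
        by (intro finite_measure_Union) auto
      finally show ?thesis .
    qed
    ultimately have "measure M {\<omega> \<in> space M. E k z \<omega> \<and> \<not> E k z' \<omega>} \<le> 0" by (simp add: p_def)
    then have "emeasure M {\<omega> \<in> space M. E k z \<omega> \<and> \<not> E k z' \<omega>} = 0"
      by (simp add: emeasure_eq_measure measure_le_0_iff)
    then show "AE \<omega> in M. E k z \<omega> \<longrightarrow> E k z' \<omega>"
      by (subst AE_iff_measurable[OF _ refl]) auto
  qed (rule z)
qed

text \<open>The index sets \<open>J j \<omega>\<close> below are nested, infinite and depend measurably on \<open>\<omega>\<close>, and
  \<open>f\<close> maps \<open>J (Suc j) \<omega>\<close> into a ball of radius \<open>2\<^sup>-\<^sup>j\<close> with centre in a fixed countable dense set.\<close>
lemma measurable_convergent_subsequence: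
  fixes f :: "nat \<Rightarrow> 'a \<Rightarrow> 'b::euclidean_space"
  assumes [measurable]: "\<And>n. f n \<in> borel_measurable M"
    and bdd: "\<And>\<omega>. \<omega> \<in> space M \<Longrightarrow> \<exists>K::nat. \<exists>\<^sub>\<infinity>n. norm (f n \<omega>) \<le> K"
  obtains \<tau> :: "nat \<Rightarrow> 'a \<Rightarrow> nat" and g :: "'a \<Rightarrow> 'b"
  where "\<And>k. \<tau> k \<in> measurable M (count_space UNIV)" "g \<in> borel_measurable M"
    "\<And>\<omega>. \<omega> \<in> space M \<Longrightarrow> strict_mono (\<lambda>k. \<tau> k \<omega>)"
    "\<And>\<omega>. \<omega> \<in> space M \<Longrightarrow> (\<lambda>k. f (\<tau> k \<omega>) \<omega>) \<longlonglongrightarrow> g \<omega>"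
proof -
  obtain Q :: "'b set" where Q: "countable Q" "\<And>U. open U \<Longrightarrow> U \<noteq> {} \<Longrightarrow> \<exists>d\<in>Q. d \<in> U"
    by (rule countable_dense_setE) blast
  define q where "q = from_nat_into Q"
  have dense: "\<exists>i. dist (q i) x < r" if "r > 0" for x r
  proof -
    obtain d where "d \<in> Q" "d \<in> ball x r"
      using Q(2)[of "ball x r"] \<open>r > 0\<close> by (metis centre_in_ball empty_iff open_ball)
    moreover then obtain i where "q i = d" using Q(1) unfolding q_def by (metis from_nat_into_surj)
    ultimately show ?thesis by (auto simp: dist_commute)
  qed
  \<comment> \<open>"Infinitely often" is spelled out with countable quantifiers, and choices are
    made by \<open>LEAST\<close>, so that everything below is visibly measurable in
    \<omega>.\<close>
  define P where "P = (\<lambda>(J :: nat \<Rightarrow> 'a \<Rightarrow> bool) j i \<omega>.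
      \<forall>m. \<exists>n\<ge>m. J n \<omega> \<and> dist (q i) (f n \<omega>) < (1/2)^j)"
  define J0 where "J0 = (\<lambda>n \<omega>. norm (f n \<omega>) \<le> real (LEAST K. \<forall>m. \<exists>n\<ge>m. norm (f n \<omega>) \<le> real K))"
  define J where "J = rec_nat J0 (\<lambda>j J' n \<omega>. J' n \<omega> \<and>
      dist (q (LEAST i. P J' j i \<omega>)) (f n \<omega>) < (1/2)^j)"
  have J_0: "J 0 = J0" by (simp add: J_def)
  have J_Suc: "J (Suc j) = (\<lambda>n \<omega>. J j n \<omega> \<and>
      dist (q (LEAST i. P (J j) j i \<omega>)) (f n \<omega>) < (1/2)^j)" for j by (simp add: J_def)
  have [measurable]: "Measurable.pred M (J j n)" for j n
  proof (induction j arbitrary: n)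
    case 0
    show ?case unfolding J_0 J0_def by measurable
  next
    case (Suc j)
    note [measurable] = Suc
    have [measurable]: "(\<lambda>\<omega>. q (LEAST i. P (J j) j i \<omega>)) \<in> borel_measurable M"
      unfolding P_def by measurable
    show ?case unfolding J_Suc by measurable
  qed
  have inf: "\<forall>m. \<exists>n\<ge>m. J j n \<omega>" and bddJ: "\<exists>K. \<forall>n. J j n \<omega> \<longrightarrow> norm (f n \<omega>) \<le> K"
    if \<omega>: "\<omega> \<in> space M" for j \<omega>
  proof (induction j)
    case 0
    { case 1
      have "\<exists>K::nat. \<forall>m. \<exists>n\<ge>m. norm (f n \<omega>) \<le> K"
        using bdd[OF \<omega>] by (simp add: INFM_nat_le)
      then show ?case unfolding J_0 J0_def by (rule LeastI_ex)
    next
      case 2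
      show ?case unfolding J_0 J0_def by blast
    }
  next
    case (Suc j)
    { case 1
      have "\<exists>i. P (J j) j i \<omega>"
      proof -
        obtain K where K: "\<And>n. J j n \<omega> \<Longrightarrow> norm (f n \<omega>) \<le> K" using Suc by blast
        have J_inf: "infinite {n. J j n \<omega>}"
          using Suc(1) by (simp add: infinite_nat_iff_unbounded_le)
        have "cball (0::'b) K \<subseteq> (\<Union>i. ball (q i) ((1/2)^j))"
          using dense[of "(1/2)^j"] by fastforce
        then obtain I0 where I0: "finite I0" "cball (0::'b) K \<subseteq> (\<Union>i\<in>I0. ball (q i) ((1/2)^j))"
          using compactE_image[OF compact_cball, of UNIV "\<lambda>i. ball (q i) ((1/2)^j)" 0 K] by auto
        \<comment> \<open>Pigeonhole: finitely many balls cover the bounded set of values, so one of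
          them receives infinitely many indices.\<close>
        have "{n. J j n \<omega>} \<subseteq> (\<Union>i\<in>I0. {n. J j n \<omega> \<and> dist (q i) (f n \<omega>) < (1/2)^j})"
        proof
          fix n assume n: "n \<in> {n. J j n \<omega>}"
          then have "f n \<omega> \<in> cball 0 K" using K by simp
          then have "f n \<omega> \<in> (\<Union>i\<in>I0. ball (q i) ((1/2)^j))" using I0(2) by blast
          then show "n \<in> (\<Union>i\<in>I0. {n. J j n \<omega> \<and> dist (q i) (f n \<omega>) < (1/2)^j})"
            using n by auto
        qed
        then have "\<exists>i\<in>I0. infinite {n. J j n \<omega> \<and> dist (q i) (f n \<omega>) < (1/2)^j}"
          using J_inf I0(1) by (meson finite_UN finite_subset)
        then obtain i where "infinite {n. J j n \<omega> \<and> dist (q i) (f n \<omega>) < (1/2)^j}" by blast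
        then show ?thesis unfolding P_def infinite_nat_iff_unbounded_le by auto
      qed
      then have "P (J j) j (LEAST i. P (J j) j i \<omega>) \<omega>" by (rule LeastI_ex)
      then show ?case unfolding J_Suc by (simp add: P_def)
    next
      case 2
      show ?case unfolding J_Suc using Suc(2) by blast
    }
  qed
  have J_mono: "J l n \<omega>" if "J j n \<omega>" "l \<le> j" for l j n \<omega>
    using that(2,1) by (induction rule: dec_induct) (auto simp: J_Suc)
  \<comment> \<open>Diagonal choice: the k-th index lies in \<open>J k\<close>, so from k = Suc j on
    all values stay in one ball of radius 2^-j.\<close>
  define \<tau> where "\<tau> = rec_nat (\<lambda>\<omega>. LEAST n. J 0 n \<omega>) (\<lambda>k t \<omega>. LEAST n. t \<omega> < n \<and> J (Suc k) n \<omega>)"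
  have \<tau>0: "\<tau> 0 = (\<lambda>\<omega>. LEAST n. J 0 n \<omega>)" by (simp add: \<tau>_def)
  have \<tau>S: "\<tau> (Suc k) = (\<lambda>\<omega>. LEAST n. \<tau> k \<omega> < n \<and> J (Suc k) n \<omega>)" for k by (simp add: \<tau>_def)
  have \<tau>_meas [measurable]: "\<tau> k \<in> measurable M (count_space UNIV)" for k
  proof (induction k)
    case 0
    show ?case unfolding \<tau>0 by measurable
  next
    case (Suc k)
    note [measurable] = Suc
    show ?case unfolding \<tau>S by measurable
  qed
  have \<tau>J: "J k (\<tau> k \<omega>) \<omega>" if \<omega>: "\<omega> \<in> space M" for k \<omega>
  proof (cases k)
    case 0
    have "\<exists>n. J 0 n \<omega>" using inf[OF \<omega>, of 0] by blast
    then show ?thesis unfolding 0 \<tau>0 by (rule LeastI_ex)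
  next
    case (Suc l)
    have "\<exists>n. \<tau> l \<omega> < n \<and> J (Suc l) n \<omega>" using inf[OF \<omega>, of "Suc l"] by (meson Suc_le_eq)
    then show ?thesis unfolding Suc \<tau>S by (rule LeastI2_ex) blast
  qed
  have \<tau>_mono: "strict_mono (\<lambda>k. \<tau> k \<omega>)" if \<omega>: "\<omega> \<in> space M" for \<omega>
  proof (rule strict_monoI_Suc)
    fix k
    have "\<exists>n. \<tau> k \<omega> < n \<and> J (Suc k) n \<omega>" using inf[OF \<omega>, of "Suc k"] by (meson Suc_le_eq)
    then show "\<tau> k \<omega> < \<tau> (Suc k) \<omega>" unfolding \<tau>S by (rule LeastI2_ex) blast
  qed
  have conv: "convergent (\<lambda>k. f (\<tau> k \<omega>) \<omega>)" if \<omega>: "\<omega> \<in> space M" for \<omega>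
  proof (rule Cauchy_convergent, rule metric_CauchyI)
    fix e :: real assume e: "e > 0"
    obtain j where j: "(1/2)^j < e / 2" using real_arch_pow_inv[of "e/2" "1/2"] e by auto
    define x where "x = q (LEAST i. P (J j) j i \<omega>)"
    have near: "dist x (f (\<tau> k \<omega>) \<omega>) < e / 2" if "k \<ge> Suc j" for k
      using J_mono[OF \<tau>J[OF \<omega>, of k] that] j by (auto simp: J_Suc x_def)
    show "\<exists>M. \<forall>m\<ge>M. \<forall>n\<ge>M. dist (f (\<tau> m \<omega>) \<omega>) (f (\<tau> n \<omega>) \<omega>) < e"
      using near by (metis dist_commute dist_triangle_half_r)
  qed
  define g where "g \<omega> = lim (\<lambda>k. f (\<tau> k \<omega>) \<omega>)" for \<omega>
  have [measurable]: "(\<lambda>\<omega>. f (\<tau> k \<omega>) \<omega>) \<in> borel_measurable M" for k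
    by (rule measurable_compose_countable) measurable
  have "g \<in> borel_measurable M" unfolding g_def by measurable
  then show thesis
    using that[of \<tau> g] \<tau>_meas \<tau>_mono conv by (simp add: g_def convergent_LIMSEQ_iff)
qed


section \<open>Attainable claims\<close>

lemma nonneg_vec_iff: "nonneg_vec v \<longleftrightarrow> 0 \<le> v"
  by (simp add: nonneg_vec_def less_eq_vec_def)

lemma inner_vec_nonneg:
  fixes x y :: "real^'n"
  assumes "0 \<le> x" "0 \<le> y"
  shows "0 \<le> x \<bullet> y"
  using assms by (auto simp: inner_vec_def less_eq_vec_def intro!: sum_nonneg)

lemma LIMSEQ_le_vec:
  fixes x y :: "nat \<Rightarrow> real^'n"
  assumes "x \<longlonglongrightarrow> a" "y \<longlonglongrightarrow> b" "\<And>n. x n \<le> y n"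
  shows "a \<le> b"
  unfolding less_eq_vec_def
proof
  fix i
  show "a $ i \<le> b $ i"
    by (rule LIMSEQ_le[OF tendsto_vec_nth[OF assms(1)] tendsto_vec_nth[OF assms(2)]])
      (use assms(3) in \<open>auto simp: less_eq_vec_def\<close>)
qed

lemma max_zero_mult_left: "0 \<le> c \<Longrightarrow> max (c * x) 0 = c * max x (0::real)"
  by (metis max_mult_distrib_left mult_zero_right)

locale market = prob_space M
  for M :: "'a measure" and H :: "nat \<Rightarrow> 'a measure" and T :: nat
    and A :: "(real^'d::finite^'d) set" and F :: "nat \<Rightarrow> 'a \<Rightarrow> real^'d^'d \<Rightarrow> real^'d" +
  assumes filt: "is_filtration M H T"
    and cone_A: "closed_convex_cone A"
    and boldF: "boldF M A T F"
    and HcalA: "HcalA M A F T"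
begin

section \<open>The filtration and the cone\<close>

lemma subalg: "t \<le> T \<Longrightarrow> subalgebra M (H t)"
  using filt by (simp add: is_filtration_def)

lemma space_H: "t \<le> T \<Longrightarrow> space (H t) = space M"
  using subalg by (simp add: subalgebra_def)

lemma H_mono: "s \<le> t \<Longrightarrow> t \<le> T \<Longrightarrow> subalgebra (H t) (H s)"
  using filt space_H by (simp add: is_filtration_def subalgebra_def)

lemma H_measurable_M: "t \<le> T \<Longrightarrow> f \<in> measurable (H t) N \<Longrightarrow> f \<in> measurable M N"
  by (rule measurable_from_subalg[OF subalg])

lemma H_measurable_mono: "s \<le> t \<Longrightarrow> t \<le> T \<Longrightarrow> f \<in> measurable (H s) N \<Longrightarrow> f \<in> measurable (H t) N"
  by (rule measurable_from_subalg[OF H_mono])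

lemma zero_A: "0 \<in> A"
  using cone_A cone_contains_0 unfolding closed_convex_cone_def by blast

lemma scale_A: "a \<in> A \<Longrightarrow> 0 \<le> c \<Longrightarrow> c *\<^sub>R a \<in> A"
  using cone_A unfolding closed_convex_cone_def cone_def by blast

lemma add_A: "a \<in> A \<Longrightarrow> b \<in> A \<Longrightarrow> a + b \<in> A"
  using cone_A convex_cone unfolding closed_convex_cone_def by blast

lemma lim_A: "(\<And>n. a n \<in> A) \<Longrightarrow> a \<longlonglongrightarrow> l \<Longrightarrow> l \<in> A"
  using cone_A closed_sequentially unfolding closed_convex_cone_def by blast

text \<open>The piecewise linear version of \<open>F\<close> given by HA is jointly measurable by construction.\<close>
definition G :: "nat \<Rightarrow> 'a \<Rightarrow> real^'d^'d \<Rightarrow> real^'d" where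
  "G t \<omega> a = (\<Sum>i\<in>UNIV. \<Sum>j\<in>UNIV. max (a $ i $ j) 0 *\<^sub>R F t \<omega> (emat i j) +
      max (- (a $ i $ j)) 0 *\<^sub>R F t \<omega> (- emat i j))"

lemma G_scale: "0 \<le> c \<Longrightarrow> G t \<omega> (c *\<^sub>R a) = c *\<^sub>R G t \<omega> a"
  using max_zero_mult_left[of c "- _"]
  by (simp add: G_def max_zero_mult_left scaleR_sum_right scaleR_add_right)

lemma G_zero [simp]: "G t \<omega> 0 = 0"
  using G_scale[of 0] by simp

lemma continuous_G: "continuous_on UNIV (G t \<omega>)"
  unfolding G_def by (intro continuous_intros)

lemma F_measurable: "t \<le> T \<Longrightarrow> (\<lambda>\<omega>. F t \<omega> a) \<in> borel_measurable M"
  using boldF by (simp add: boldF_def)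

lemma G_measurable:
  assumes "t \<le> T" and [measurable]: "\<eta> \<in> borel_measurable M"
  shows "(\<lambda>\<omega>. G t \<omega> (\<eta> \<omega>)) \<in> borel_measurable M"
proof -
  note [measurable] = F_measurable[OF assms(1)]
  have [measurable]: "(\<lambda>\<omega>. \<eta> \<omega> $ i $ j) \<in> borel_measurable M" for i j
    using measurable_compose[OF assms(2), of "\<lambda>a. a $ i $ j" borel]
    by (simp add: borel_measurable_continuous_onI continuous_intros)
  show ?thesis unfolding G_def by measurable
qed

text \<open>HA yields the identity at each fixed argument, up to a null set depending on it. On a
  countable dense set one null set suffices, and continuity of both sides extends the identity to
  all arguments.\<close>

lemma F_eq_G: "t \<le> T \<Longrightarrow> AE \<omega> in M. \<forall>a. F t \<omega> a = G t \<omega> a"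
proof -
  assume t: "t \<le> T"
  obtain D :: "(real^'d^'d) set" where D: "countable D" "\<And>U. open U \<Longrightarrow> U \<noteq> {} \<Longrightarrow> \<exists>d\<in>D. d \<in> U"
    by (rule countable_dense_setE) blast
  have "AE \<omega> in M. F t \<omega> a = G t \<omega> a" for a
    using HcalA t unfolding HcalA_def G_def by (auto dest!: bspec[where x = "\<lambda>_. a"])
  then have "AE \<omega> in M. \<forall>a\<in>D. F t \<omega> a = G t \<omega> a"
    using D(1) by (simp add: AE_ball_countable)
  moreover have "AE \<omega> in M. frakF A (F t \<omega>)" using boldF t by (simp add: boldF_def)
  ultimately show ?thesis
  proof eventually_elim
    case (elim \<omega>)
    show ?case
    proof (rule allI, rule ccontr)
      fix a assume neq: "F t \<omega> a \<noteq> G t \<omega> a"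
      have "open {x. F t \<omega> x \<noteq> G t \<omega> x}"
        using elim(2) unfolding frakF_def by (intro open_Collect_neq continuous_G) blast
      with neq D(2)[of "{x. F t \<omega> x \<noteq> G t \<omega> x}"] elim(1) show False by auto
    qed
  qed
qed

lemma F_comp_eq_G: "t \<le> T \<Longrightarrow> AE \<omega> in M. F t \<omega> (\<eta> \<omega>) = G t \<omega> (\<eta> \<omega>)"
  using F_eq_G by (rule AE_mp) auto

lemma G_superadditive:
  "t \<le> T \<Longrightarrow> AE \<omega> in M. \<forall>a\<in>A. \<forall>b\<in>A. G t \<omega> a + G t \<omega> b \<le> G t \<omega> (a + b)"
proof -
  assume t: "t \<le> T"
  have "AE \<omega> in M. frakF A (F t \<omega>)" using boldF t by (simp add: boldF_def)
  with F_eq_G[OF t] show ?thesis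
  proof eventually_elim
    case (elim \<omega>)
    show ?case
    proof (intro ballI)
      fix a b assume "a \<in> A" "b \<in> A"
      moreover have "\<forall>c \<beta>. \<forall>a\<in>A. \<forall>a'\<in>A. c \<ge> 0 \<longrightarrow> \<beta> \<ge> 0 \<longrightarrow>
        nonneg_vec (F t \<omega> (c *\<^sub>R a + \<beta> *\<^sub>R a') - (c *\<^sub>R F t \<omega> a + \<beta> *\<^sub>R F t \<omega> a'))"
        using elim(2) by (simp add: frakF_def)
      ultimately have "nonneg_vec (F t \<omega> (1 *\<^sub>R a + 1 *\<^sub>R b) - (1 *\<^sub>R F t \<omega> a + 1 *\<^sub>R F t \<omega> b))"
        using zero_le_one by blast
      then show "G t \<omega> a + G t \<omega> b \<le> G t \<omega> (a + b)"
        using elim(1) by (simp add: nonneg_vec_def less_eq_vec_def)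
    qed
  qed
qed

section \<open>Admissible positions and attainable claims\<close>

abbreviation "adm t \<eta> \<equiv> L0A M H A t \<eta>"

lemma adm_measurable: "adm t \<eta> \<Longrightarrow> \<eta> \<in> borel_measurable (H t)"
  and adm_AE: "adm t \<eta> \<Longrightarrow> AE \<omega> in M. \<eta> \<omega> \<in> A"
  by (simp_all add: L0A_def)

lemma adm_measurable_M: "t \<le> T \<Longrightarrow> adm t \<eta> \<Longrightarrow> \<eta> \<in> borel_measurable M"
  by (rule H_measurable_M[OF _ adm_measurable])

lemma adm_zero: "adm t (\<lambda>_. 0)"
  by (simp add: L0A_def zero_A)

lemma adm_const: "a \<in> A \<Longrightarrow> adm t (\<lambda>_. a)"
  by (simp add: L0A_def)

lemma adm_add: "adm t \<eta> \<Longrightarrow> adm t \<zeta> \<Longrightarrow> adm t (\<lambda>\<omega>. \<eta> \<omega> + \<zeta> \<omega>)"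
  unfolding L0A_def by (auto intro: add_A elim!: eventually_elim2)

lemma adm_scale:
  assumes "r \<le> t" "t \<le> T" "f \<in> borel_measurable (H r)" "\<And>\<omega>. 0 \<le> f \<omega>" "adm t \<eta>"
  shows "adm t (\<lambda>\<omega>. f \<omega> *\<^sub>R \<eta> \<omega>)"
  using H_measurable_mono[OF assms(1,2,3)] assms(4,5)
  unfolding L0A_def by (auto intro: scale_A elim!: eventually_mono)

lemma adm_glue:
  fixes N :: "'a \<Rightarrow> nat"
  assumes "r \<le> t" "t \<le> T" "N \<in> measurable (H r) (count_space UNIV)" "\<And>n. adm t (\<eta> n)"
  shows "adm t (\<lambda>\<omega>. \<eta> (N \<omega>) \<omega>)"
  unfolding L0A_def
proof
  have "\<And>n. \<eta> n \<in> borel_measurable (H t)" using assms(4) by (simp add: L0A_def)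
  then show "(\<lambda>\<omega>. \<eta> (N \<omega>) \<omega>) \<in> borel_measurable (H t)"
    using H_measurable_mono[OF assms(1,2,3)] by (rule measurable_compose_countable)
  have "AE \<omega> in M. \<forall>n. \<eta> n \<omega> \<in> A" using assms(4) by (simp add: L0A_def AE_all_countable)
  then show "AE \<omega> in M. \<eta> (N \<omega>) \<omega> \<in> A" by (rule eventually_mono) auto
qed

text \<open>The analogue of A_T(F) with trading restricted to the dates t, ..., T; free disposal is
  absorbed into the inequality. For t = Suc T the sum is empty and only nonpositive claims remain,
  which starts the backward induction.\<close>

definition attainable :: "nat \<Rightarrow> ('a \<Rightarrow> real^'d) \<Rightarrow> bool" where
  "attainable t X \<longleftrightarrow> X \<in> borel_measurable M \<and> (\<exists>\<eta>. (\<forall>s. t \<le> s \<longrightarrow> s \<le> T \<longrightarrow> adm s (\<eta> s)) \<and>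
     (AE \<omega> in M. X \<omega> \<le> (\<Sum>s=t..T. G s \<omega> (\<eta> s \<omega>))))"

lemma attainable_measurable: "attainable t X \<Longrightarrow> X \<in> borel_measurable M"
  by (simp add: attainable_def)

lemma attainable_mono:
  assumes "attainable t Y" "X \<in> borel_measurable M" "AE \<omega> in M. X \<omega> \<le> Y \<omega>"
  shows "attainable t X"
proof -
  obtain \<eta> where \<eta>: "\<And>s. t \<le> s \<Longrightarrow> s \<le> T \<Longrightarrow> adm s (\<eta> s)"
    and le: "AE \<omega> in M. Y \<omega> \<le> (\<Sum>s=t..T. G s \<omega> (\<eta> s \<omega>))"
    using assms(1) unfolding attainable_def by blast
  have "AE \<omega> in M. X \<omega> \<le> (\<Sum>s=t..T. G s \<omega> (\<eta> s \<omega>))"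
    using assms(3) le by eventually_elim (rule order_trans)
  with \<eta> assms(2) show ?thesis unfolding attainable_def by blast
qed

lemma attainable_strategy:
  assumes "\<And>s. t \<le> s \<Longrightarrow> s \<le> T \<Longrightarrow> adm s (\<eta> s)"
  shows "attainable t (\<lambda>\<omega>. \<Sum>s=t..T. G s \<omega> (\<eta> s \<omega>))"
  unfolding attainable_def
proof (intro conjI exI[of _ \<eta>])
  show "(\<lambda>\<omega>. \<Sum>s=t..T. G s \<omega> (\<eta> s \<omega>)) \<in> borel_measurable M"
    using assms by (intro borel_measurable_sum G_measurable adm_measurable_M) auto
qed (use assms in auto)

lemma attainable_zero: "attainable t (\<lambda>_. 0)"
  using attainable_strategy[of t "\<lambda>_ _. 0"] by (simp add: adm_zero)

lemma attainable_add:
  assumes "attainable t X" "attainable t Y"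
  shows "attainable t (\<lambda>\<omega>. X \<omega> + Y \<omega>)"
proof -
  obtain \<eta> \<zeta> where \<eta>: "\<And>s. t \<le> s \<Longrightarrow> s \<le> T \<Longrightarrow> adm s (\<eta> s)"
    and \<zeta>: "\<And>s. t \<le> s \<Longrightarrow> s \<le> T \<Longrightarrow> adm s (\<zeta> s)"
    and le: "AE \<omega> in M. X \<omega> \<le> (\<Sum>s=t..T. G s \<omega> (\<eta> s \<omega>))"
      "AE \<omega> in M. Y \<omega> \<le> (\<Sum>s=t..T. G s \<omega> (\<zeta> s \<omega>))"
    using assms unfolding attainable_def by blast
  have "AE \<omega> in M. \<forall>s\<in>{t..T}. G s \<omega> (\<eta> s \<omega>) + G s \<omega> (\<zeta> s \<omega>) \<le> G s \<omega> (\<eta> s \<omega> + \<zeta> s \<omega>)"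
  proof (rule AE_finite_allI)
    fix s assume s: "s \<in> {t..T}"
    then have "AE \<omega> in M. \<forall>a\<in>A. \<forall>b\<in>A. G s \<omega> a + G s \<omega> b \<le> G s \<omega> (a + b)"
      by (intro G_superadditive) simp
    moreover have "AE \<omega> in M. \<eta> s \<omega> \<in> A" "AE \<omega> in M. \<zeta> s \<omega> \<in> A"
      using \<eta> \<zeta> s by (auto intro: adm_AE)
    ultimately show "AE \<omega> in M. G s \<omega> (\<eta> s \<omega>) + G s \<omega> (\<zeta> s \<omega>) \<le> G s \<omega> (\<eta> s \<omega> + \<zeta> s \<omega>)"
      by eventually_elim simp
  qed simp
  with le have "AE \<omega> in M. X \<omega> + Y \<omega> \<le> (\<Sum>s=t..T. G s \<omega> (\<eta> s \<omega> + \<zeta> s \<omega>))"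
  proof eventually_elim
    case (elim \<omega>)
    have "X \<omega> + Y \<omega> \<le> (\<Sum>s=t..T. G s \<omega> (\<eta> s \<omega>)) + (\<Sum>s=t..T. G s \<omega> (\<zeta> s \<omega>))"
      using elim by (intro add_mono)
    also have "\<dots> \<le> (\<Sum>s=t..T. G s \<omega> (\<eta> s \<omega> + \<zeta> s \<omega>))"
      unfolding sum.distrib[symmetric] using elim by (intro sum_mono) auto
    finally show ?case .
  qed
  moreover have "\<And>s. t \<le> s \<Longrightarrow> s \<le> T \<Longrightarrow> adm s (\<lambda>\<omega>. \<eta> s \<omega> + \<zeta> s \<omega>)"
    using \<eta> \<zeta> by (intro adm_add)
  ultimately show ?thesis
    using assms unfolding attainable_def
    by (intro conjI exI[of _ "\<lambda>s \<omega>. \<eta> s \<omega> + \<zeta> s \<omega>"]) auto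
qed

text \<open>A factor known at date r \<le> t is known at every trading date from t on, so it can
  multiply all positions at once, and homogeneity carries it into the value. No bound on the factor
  is imposed, so this serves both to localise and to undo a normalisation.\<close>

lemma attainable_scale:
  assumes r: "r \<le> T" "r \<le> t" and f: "f \<in> borel_measurable (H r)" "\<And>\<omega>. 0 \<le> f \<omega>"
    and X: "attainable t X"
  shows "attainable t (\<lambda>\<omega>. f \<omega> *\<^sub>R X \<omega>)"
proof -
  obtain \<eta> where \<eta>: "\<And>s. t \<le> s \<Longrightarrow> s \<le> T \<Longrightarrow> adm s (\<eta> s)"
    and le: "AE \<omega> in M. X \<omega> \<le> (\<Sum>s=t..T. G s \<omega> (\<eta> s \<omega>))"
    using X unfolding attainable_def by blast
  have "AE \<omega> in M. f \<omega> *\<^sub>R X \<omega> \<le> (\<Sum>s=t..T. G s \<omega> (f \<omega> *\<^sub>R \<eta> s \<omega>))"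
    using le
  proof eventually_elim
    case (elim \<omega>)
    then show ?case
      using f(2)[of \<omega>] by (simp add: G_scale flip: scaleR_sum_right) (rule scaleR_left_mono)
  qed
  moreover have "\<And>s. t \<le> s \<Longrightarrow> s \<le> T \<Longrightarrow> adm s (\<lambda>\<omega>. f \<omega> *\<^sub>R \<eta> s \<omega>)"
    using \<eta> r f by (intro adm_scale[where r = r]) auto
  ultimately show ?thesis
    using attainable_measurable[OF X] H_measurable_M[OF r(1) f(1)] unfolding attainable_def
    by (intro conjI exI[of _ "\<lambda>s \<omega>. f \<omega> *\<^sub>R \<eta> s \<omega>"]) auto
qed

text \<open>An index known at date r selects among countably many strategies at every later date.
  This is what makes passing to random subsequences harmless.\<close>

lemma attainable_glue:
  fixes N :: "'a \<Rightarrow> nat"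
  assumes r: "r \<le> T" "r \<le> t" and N: "N \<in> measurable (H r) (count_space UNIV)"
    and X: "\<And>n. attainable t (X n)"
  shows "attainable t (\<lambda>\<omega>. X (N \<omega>) \<omega>)"
proof -
  have "\<exists>\<eta>. (\<forall>s. t \<le> s \<longrightarrow> s \<le> T \<longrightarrow> adm s (\<eta> s)) \<and>
     (AE \<omega> in M. X n \<omega> \<le> (\<Sum>s=t..T. G s \<omega> (\<eta> s \<omega>)))" for n
    using X unfolding attainable_def by blast
  then obtain \<eta> where "\<forall>n. (\<forall>s. t \<le> s \<longrightarrow> s \<le> T \<longrightarrow> adm s (\<eta> n s)) \<and>
     (AE \<omega> in M. X n \<omega> \<le> (\<Sum>s=t..T. G s \<omega> (\<eta> n s \<omega>)))"
    using choice[where Q = "\<lambda>n \<eta>. (\<forall>s. t \<le> s \<longrightarrow> s \<le> T \<longrightarrow> adm s (\<eta> s)) \<and>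
     (AE \<omega> in M. X n \<omega> \<le> (\<Sum>s=t..T. G s \<omega> (\<eta> s \<omega>)))"] by blast
  then have \<eta>: "\<And>n s. t \<le> s \<Longrightarrow> s \<le> T \<Longrightarrow> adm s (\<eta> n s)"
    and le: "\<And>n. AE \<omega> in M. X n \<omega> \<le> (\<Sum>s=t..T. G s \<omega> (\<eta> n s \<omega>))"
    by auto
  have "AE \<omega> in M. \<forall>n. X n \<omega> \<le> (\<Sum>s=t..T. G s \<omega> (\<eta> n s \<omega>))"
    using le by (simp add: AE_all_countable)
  then have "AE \<omega> in M. X (N \<omega>) \<omega> \<le> (\<Sum>s=t..T. G s \<omega> (\<eta> (N \<omega>) s \<omega>))"
    by (rule eventually_mono) auto
  moreover have "adm s (\<lambda>\<omega>. \<eta> (N \<omega>) s \<omega>)" if "t \<le> s" "s \<le> T" for s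
    using adm_glue[of r s N "\<lambda>n. \<eta> n s"] \<eta> that r N by auto
  moreover have "(\<lambda>\<omega>. X (N \<omega>) \<omega>) \<in> borel_measurable M"
    using attainable_measurable[OF X] H_measurable_M[OF r(1) N] by (rule measurable_compose_countable)
  ultimately show ?thesis
    unfolding attainable_def by (intro conjI exI[of _ "\<lambda>s \<omega>. \<eta> (N \<omega>) s \<omega>"]) auto
qed

text \<open>Dynamic programming: the position at date t is split off, and the rest has to be
  attained from the next date on.\<close>

lemma attainable_Suc_iff:
  assumes t: "t \<le> T" and X: "X \<in> borel_measurable M"
  shows "attainable t X \<longleftrightarrow> (\<exists>\<eta>. adm t \<eta> \<and> attainable (Suc t) (\<lambda>\<omega>. X \<omega> - G t \<omega> (\<eta> \<omega>)))"
proof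
  assume "attainable t X"
  then obtain \<eta> where \<eta>: "\<And>s. t \<le> s \<Longrightarrow> s \<le> T \<Longrightarrow> adm s (\<eta> s)"
    and le: "AE \<omega> in M. X \<omega> \<le> (\<Sum>s=t..T. G s \<omega> (\<eta> s \<omega>))"
    unfolding attainable_def by blast
  have "AE \<omega> in M. X \<omega> - G t \<omega> (\<eta> t \<omega>) \<le> (\<Sum>s=Suc t..T. G s \<omega> (\<eta> s \<omega>))"
    using le by eventually_elim (simp add: sum.atLeast_Suc_atMost[OF t] diff_le_eq add.commute)
  moreover have "(\<lambda>\<omega>. X \<omega> - G t \<omega> (\<eta> t \<omega>)) \<in> borel_measurable M"
    using X t \<eta>[OF order_refl t] by (intro borel_measurable_diff G_measurable adm_measurable_M) auto
  ultimately have "attainable (Suc t) (\<lambda>\<omega>. X \<omega> - G t \<omega> (\<eta> t \<omega>))"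
    using \<eta> unfolding attainable_def by (intro conjI exI[of _ \<eta>]) auto
  then show "\<exists>\<eta>. adm t \<eta> \<and> attainable (Suc t) (\<lambda>\<omega>. X \<omega> - G t \<omega> (\<eta> \<omega>))"
    using \<eta> t by blast
next
  assume "\<exists>\<eta>. adm t \<eta> \<and> attainable (Suc t) (\<lambda>\<omega>. X \<omega> - G t \<omega> (\<eta> \<omega>))"
  then obtain \<eta> \<zeta> where \<eta>: "adm t \<eta>" and \<zeta>: "\<And>s. Suc t \<le> s \<Longrightarrow> s \<le> T \<Longrightarrow> adm s (\<zeta> s)"
    and le: "AE \<omega> in M. X \<omega> - G t \<omega> (\<eta> \<omega>) \<le> (\<Sum>s=Suc t..T. G s \<omega> (\<zeta> s \<omega>))"
    unfolding attainable_def by blast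
  define \<xi> where "\<xi> = \<zeta>(t := \<eta>)"
  have "AE \<omega> in M. X \<omega> \<le> (\<Sum>s=t..T. G s \<omega> (\<xi> s \<omega>))"
    using le
  proof eventually_elim
    case (elim \<omega>)
    have "(\<Sum>s=Suc t..T. G s \<omega> (\<xi> s \<omega>)) = (\<Sum>s=Suc t..T. G s \<omega> (\<zeta> s \<omega>))"
      by (intro sum.cong) (auto simp: \<xi>_def)
    with elim show ?case
      by (simp add: sum.atLeast_Suc_atMost[OF t] diff_le_eq add.commute) (simp add: \<xi>_def add.commute)
  qed
  moreover have "\<And>s. t \<le> s \<Longrightarrow> s \<le> T \<Longrightarrow> adm s (\<xi> s)"
    using \<eta> \<zeta> by (auto simp: \<xi>_def)
  ultimately show "attainable t X" using X unfolding attainable_def by blast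
qed

section \<open>Translation between values in N_t(F), the set A_T(F) and strategies for
  \<open>G\<close>\<close>

lemma inN_G: "t \<le> T \<Longrightarrow> adm t \<eta> \<Longrightarrow> inN M H A F t (\<lambda>\<omega>. G t \<omega> (\<eta> \<omega>))"
  using F_comp_eq_G[of t \<eta>] unfolding inN_def by (auto intro!: exI[of _ \<eta>] elim!: eventually_mono)

lemma inN_strategy: "t \<le> T \<Longrightarrow> inN M H A F t X \<Longrightarrow> \<exists>\<eta>. adm t \<eta> \<and> (AE \<omega> in M. X \<omega> = G t \<omega> (\<eta> \<omega>))"
proof -
  assume t: "t \<le> T" and "inN M H A F t X"
  then obtain \<eta> where "adm t \<eta>" "AE \<omega> in M. X \<omega> = F t \<omega> (\<eta> \<omega>)" unfolding inN_def by blast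
  moreover note F_comp_eq_G[OF t, of \<eta>]
  ultimately show ?thesis by (intro exI[of _ \<eta>]) (auto elim: eventually_elim2)
qed

lemma inN_cong: "AE \<omega> in M. X \<omega> = Y \<omega> \<Longrightarrow> inN M H A F t X \<Longrightarrow> inN M H A F t Y"
  unfolding inN_def by (auto elim: eventually_elim2)

lemma inN0_cong: "AE \<omega> in M. X \<omega> = Y \<omega> \<Longrightarrow> inN0 M H A F t X \<Longrightarrow> inN0 M H A F t Y"
  unfolding inN0_def
  using inN_cong[of X Y t] inN_cong[of "\<lambda>\<omega>. - X \<omega>" "\<lambda>\<omega>. - Y \<omega>" t] by (auto elim: eventually_mono)

lemma Vsum_G: "Vsum (\<lambda>s \<omega>. G s \<omega> (\<eta> s \<omega>)) T \<omega> = (\<Sum>s=0..T. G s \<omega> (\<eta> s \<omega>))"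
  by (simp add: Vsum_def atMost_atLeast0)

lemma attainable_inAT:
  assumes "attainable 0 X"
  shows "inAT M H A F T X"
proof -
  obtain \<eta> where \<eta>: "\<And>s. s \<le> T \<Longrightarrow> adm s (\<eta> s)"
    and le: "AE \<omega> in M. X \<omega> \<le> (\<Sum>s=0..T. G s \<omega> (\<eta> s \<omega>))"
    using assms unfolding attainable_def by auto
  define \<xi> where "\<xi> = (\<lambda>s \<omega>. G s \<omega> (\<eta> s \<omega>))"
  define r where "r = (\<lambda>\<omega>. Vsum \<xi> T \<omega> - X \<omega>)"
  have "procN M H A F T \<xi>" unfolding procN_def \<xi>_def using \<eta> by (auto intro: inN_G)
  moreover have "r \<in> borel_measurable M"
    unfolding r_def \<xi>_def Vsum_G using attainable_measurable[OF assms] \<eta>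
    by (intro borel_measurable_diff borel_measurable_sum G_measurable adm_measurable_M) auto
  moreover have "AE \<omega> in M. nonneg_vec (r \<omega>)"
    using le by eventually_elim (simp add: nonneg_vec_iff r_def \<xi>_def Vsum_G)
  moreover have "X \<omega> = Vsum \<xi> T \<omega> - r \<omega>" for \<omega> by (simp add: r_def)
  ultimately show ?thesis unfolding inAT_def by blast
qed

lemma inAT_attainable:
  assumes "inAT M H A F T X" "X \<in> borel_measurable M"
  shows "attainable 0 X"
proof -
  obtain \<xi> r where \<xi>: "\<And>s. s \<le> T \<Longrightarrow> inN M H A F s (\<xi> s)"
    and r: "AE \<omega> in M. nonneg_vec (r \<omega>)" and eq: "AE \<omega> in M. X \<omega> = Vsum \<xi> T \<omega> - r \<omega>"
    using assms(1) unfolding inAT_def procN_def by blast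
  have "\<forall>s. \<exists>\<eta>. s \<le> T \<longrightarrow> adm s \<eta> \<and> (AE \<omega> in M. \<xi> s \<omega> = G s \<omega> (\<eta> \<omega>))"
    using \<xi> inN_strategy by blast
  then obtain \<eta> where \<eta>: "\<And>s. s \<le> T \<Longrightarrow> adm s (\<eta> s)"
      "\<And>s. s \<le> T \<Longrightarrow> AE \<omega> in M. \<xi> s \<omega> = G s \<omega> (\<eta> s \<omega>)" by metis
  have "AE \<omega> in M. \<forall>s\<in>{..T}. \<xi> s \<omega> = G s \<omega> (\<eta> s \<omega>)"
    using \<eta>(2) by (intro AE_finite_allI) auto
  with r eq have "AE \<omega> in M. X \<omega> \<le> (\<Sum>s=0..T. G s \<omega> (\<eta> s \<omega>))"
    by eventually_elim (simp add: Vsum_def atMost_atLeast0 nonneg_vec_iff)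
  with \<eta>(1) assms(2) show ?thesis unfolding attainable_def by blast
qed

end


section \<open>Closedness of the set of attainable claims\<close>

context market
begin

text \<open>KP speaks about values and HN0 about positions; combined, they show that a strategy
  which can be offset consists of reversible positions, along which \<open>G\<close> is odd. Every
  use of KP and HN0 goes through this lemma.\<close>

lemma offsetting_strategies:
  assumes HN0: "HN0 M H A F T" and KP: "KP M H A F T"
    and \<eta>: "\<And>s. s \<le> T \<Longrightarrow> adm s (\<eta> s)" and \<zeta>: "\<And>s. s \<le> T \<Longrightarrow> adm s (\<zeta> s)"
    and pos: "AE \<omega> in M. 0 \<le> (\<Sum>s=0..T. G s \<omega> (\<eta> s \<omega>)) + (\<Sum>s=0..T. G s \<omega> (\<zeta> s \<omega>))"
  shows "AE \<omega> in M. (\<Sum>s=0..T. G s \<omega> (\<eta> s \<omega>)) + (\<Sum>s=0..T. G s \<omega> (\<zeta> s \<omega>)) = 0"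
    and "s \<le> T \<Longrightarrow> inN0 M H A F s (\<lambda>\<omega>. G s \<omega> (\<eta> s \<omega>))"
    and "s \<le> T \<Longrightarrow> adm s (\<lambda>\<omega>. - \<eta> s \<omega>)"
    and "s \<le> T \<Longrightarrow> AE \<omega> in M. G s \<omega> (- \<eta> s \<omega>) = - G s \<omega> (\<eta> s \<omega>)"
proof -
  define \<xi> where "\<xi> = (\<lambda>s \<omega>. G s \<omega> (\<eta> s \<omega>))"
  define \<xi>' where "\<xi>' = (\<lambda>s \<omega>. G s \<omega> (\<zeta> s \<omega>))"
  have sum: "Vsum \<xi> T \<omega> + Vsum \<xi>' T \<omega>
      = (\<Sum>s=0..T. G s \<omega> (\<eta> s \<omega>)) + (\<Sum>s=0..T. G s \<omega> (\<zeta> s \<omega>))" for \<omega>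
    unfolding \<xi>_def \<xi>'_def Vsum_G ..
  have "procN M H A F T \<xi>" unfolding procN_def \<xi>_def using \<eta> by (auto intro: inN_G)
  moreover have "procN M H A F T \<xi>'"
    unfolding procN_def \<xi>'_def using \<zeta> by (auto intro: inN_G)
  moreover have "AE \<omega> in M. nonneg_vec (Vsum \<xi> T \<omega> + Vsum \<xi>' T \<omega>)"
    using pos by (simp add: sum nonneg_vec_iff)
  ultimately have "procN0 M H A F T \<xi> \<and> (AE \<omega> in M. Vsum \<xi> T \<omega> + Vsum \<xi>' T \<omega> = 0)"
    using KP unfolding KP_def by blast
  then have N0: "\<And>s. s \<le> T \<Longrightarrow> inN0 M H A F s (\<lambda>\<omega>. G s \<omega> (\<eta> s \<omega>))"
    and 0: "AE \<omega> in M. Vsum \<xi> T \<omega> + Vsum \<xi>' T \<omega> = 0"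
    by (simp_all add: procN0_def \<xi>_def)
  show "AE \<omega> in M. (\<Sum>s=0..T. G s \<omega> (\<eta> s \<omega>)) + (\<Sum>s=0..T. G s \<omega> (\<zeta> s \<omega>)) = 0"
    using 0 unfolding sum .
  show "inN0 M H A F s (\<lambda>\<omega>. G s \<omega> (\<eta> s \<omega>))" if "s \<le> T" by (rule N0[OF that])
  have HN: "(AE \<omega> in M. F s \<omega> (- \<eta> s \<omega>) = - F s \<omega> (\<eta> s \<omega>)) \<and> adm s (\<lambda>\<omega>. - \<eta> s \<omega>)"
    if s: "s \<le> T"
  proof -
    have "AE \<omega> in M. G s \<omega> (\<eta> s \<omega>) = F s \<omega> (\<eta> s \<omega>)"
      using F_eq_G[OF s] by eventually_elim simp
    from inN0_cong[OF this N0[OF s]] show ?thesis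
      using HN0 s \<eta>[OF s] unfolding HN0_def by blast
  qed
  show "adm s (\<lambda>\<omega>. - \<eta> s \<omega>)" if "s \<le> T" using HN[OF that] by blast
  show "AE \<omega> in M. G s \<omega> (- \<eta> s \<omega>) = - G s \<omega> (\<eta> s \<omega>)" if "s \<le> T"
  proof -
    have "AE \<omega> in M. F s \<omega> (- \<eta> s \<omega>) = - F s \<omega> (\<eta> s \<omega>)" using HN[OF that] by blast
    with F_eq_G[OF that] show ?thesis by eventually_elim simp
  qed
qed

text \<open>Minimality refers to the integer part of the norm, so that minimisers exist without any
  closedness of the set of admissible positions.\<close>
lemma minimal_position:
  assumes t: "t \<le> T" and X: "attainable t X"
  shows "\<exists>\<eta>. (adm t \<eta> \<and> attainable (Suc t) (\<lambda>\<omega>. X \<omega> - G t \<omega> (\<eta> \<omega>))) \<and>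
    (\<forall>\<eta>'. adm t \<eta>' \<and> attainable (Suc t) (\<lambda>\<omega>. X \<omega> - G t \<omega> (\<eta>' \<omega>)) \<longrightarrow>
      (\<forall>k::nat. (AE \<omega> in M. real k \<le> norm (\<eta>' \<omega>) \<longrightarrow> real k \<le> norm (\<eta> \<omega>)) \<longrightarrow>
        (AE \<omega> in M. real k \<le> norm (\<eta> \<omega>) \<longrightarrow> real k \<le> norm (\<eta>' \<omega>))))"
proof -
  define S where "S = {\<eta>. adm t \<eta> \<and> attainable (Suc t) (\<lambda>\<omega>. X \<omega> - G t \<omega> (\<eta> \<omega>))}"
  have "\<exists>\<eta>\<in>S. \<forall>\<eta>'\<in>S. \<forall>k\<in>(UNIV :: nat set).
      (AE \<omega> in M. real k \<le> norm (\<eta>' \<omega>) \<longrightarrow> real k \<le> norm (\<eta> \<omega>)) \<longrightarrow>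
        (AE \<omega> in M. real k \<le> norm (\<eta> \<omega>) \<longrightarrow> real k \<le> norm (\<eta>' \<omega>))"
  proof (rule simultaneous_minimiser[where E = "\<lambda>k \<eta> \<omega>. real k \<le> norm (\<eta> \<omega>)"])
    show "S \<noteq> {}"
      using X attainable_Suc_iff[OF t attainable_measurable[OF X]] by (auto simp: S_def)
    show "countable (UNIV :: nat set)" by simp
    show "Measurable.pred M (\<lambda>\<omega>. real k \<le> norm (\<eta> \<omega>))" if "\<eta> \<in> S" for k \<eta>
    proof -
      have [measurable]: "\<eta> \<in> borel_measurable M"
        using that by (auto simp: S_def intro: adm_measurable_M[OF t])
      show ?thesis by measurable
    qed
    show "\<exists>z\<in>S. \<forall>n. \<forall>k\<in>UNIV. AE \<omega> in M. real k \<le> norm (z \<omega>) \<longrightarrow> real k \<le> norm (zs n \<omega>)"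
      if zs: "\<And>n. zs n \<in> S" for zs :: "nat \<Rightarrow> 'a \<Rightarrow> real^'d^'d"
    proof -
      define fl where "fl n \<omega> = nat \<lfloor>norm (zs n \<omega>)\<rfloor>" for n \<omega>
      have fl: "real k \<le> norm (zs n \<omega>) \<longleftrightarrow> k \<le> fl n \<omega>" for k n \<omega>
        unfolding fl_def by (simp add: le_nat_iff le_floor_iff)
      \<comment> \<open>The first member with least integer part of the norm. The choice is
        \<open>H t\<close>-measurable, so the glued position is again a competitor, and it is below
        the whole sequence for every threshold k.\<close>
      define N where "N \<omega> = (LEAST n. \<forall>m. fl n \<omega> \<le> fl m \<omega>)" for \<omega>
      have ex: "\<exists>n. \<forall>m. fl n \<omega> \<le> fl m \<omega>" for \<omega>
        using ex_has_least_nat[of "\<lambda>_. True" 0 "\<lambda>n. fl n \<omega>"] by auto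
      have N: "fl (N \<omega>) \<omega> \<le> fl m \<omega>" for m \<omega>
        unfolding N_def using LeastI_ex[OF ex[of \<omega>]] by blast
      have [measurable]: "zs n \<in> borel_measurable (H t)" for n
        using zs by (auto simp: S_def intro: adm_measurable)
      have [measurable]: "fl n \<in> measurable (H t) (count_space UNIV)" for n
        unfolding fl_def
        by (rule measurable_compose[where g = nat, OF measurable_compose[OF _ measurable_real_floor]]) auto
      have [measurable]: "(\<lambda>\<omega>. real (fl n \<omega>)) \<in> borel_measurable (H t)" for n
        by measurable
      have [measurable]: "Measurable.pred (H t) (\<lambda>\<omega>. fl n \<omega> \<le> fl m \<omega>)" for n m
        by (subst of_nat_le_iff[where 'a = real, symmetric]) measurable
      have N_meas: "N \<in> measurable (H t) (count_space UNIV)" unfolding N_def by measurable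
      have "(\<lambda>\<omega>. zs (N \<omega>) \<omega>) \<in> S"
        using adm_glue[OF order_refl t N_meas, of zs] zs
          attainable_glue[OF t _ N_meas, of "Suc t" "\<lambda>n \<omega>. X \<omega> - G t \<omega> (zs n \<omega>)"]
        by (auto simp: S_def)
      moreover have "real k \<le> norm (zs (N \<omega>) \<omega>) \<longrightarrow> real k \<le> norm (zs n \<omega>)" for n k \<omega>
        unfolding fl using N[of \<omega> n] by auto
      ultimately show ?thesis by (intro bexI[where x = "\<lambda>\<omega>. zs (N \<omega>) \<omega>"]) auto
    qed
  qed
  then show ?thesis unfolding S_def by auto
qed

text \<open>It suffices to show that the minimal positions have a finite lower limit almost surely
  (\<open>AE_B\<close>). They then converge along an \<open>H t\<close>-measurable random
  subsequence, and the induction hypothesis applies to what remains to be attained.\<close>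

lemma attainable_closed_step:
  assumes HN0: "HN0 M H A F T" and KP: "KP M H A F T" and t: "t \<le> T"
    and IH: "\<And>X Y. (\<And>n::nat. attainable (Suc t) (X n)) \<Longrightarrow> Y \<in> borel_measurable M \<Longrightarrow>
       (AE \<omega> in M. (\<lambda>n. X n \<omega>) \<longlonglongrightarrow> Y \<omega>) \<Longrightarrow> attainable (Suc t) Y"
    and X: "\<And>n::nat. attainable t (X n)" and Y: "Y \<in> borel_measurable M"
    and lim: "AE \<omega> in M. (\<lambda>n. X n \<omega>) \<longlonglongrightarrow> Y \<omega>"
  shows "attainable t Y"
proof -
  have tS: "t \<le> Suc t" by simp
  define P where "P n \<eta> \<longleftrightarrow> adm t \<eta> \<and> attainable (Suc t) (\<lambda>\<omega>. X n \<omega> - G t \<omega> (\<eta> \<omega>))" for n \<eta>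
  define Q where "Q n \<eta> \<longleftrightarrow> P n \<eta> \<and> (\<forall>\<eta>'. P n \<eta>' \<longrightarrow> (\<forall>k::nat.
      (AE \<omega> in M. real k \<le> norm (\<eta>' \<omega>) \<longrightarrow> real k \<le> norm (\<eta> \<omega>)) \<longrightarrow>
      (AE \<omega> in M. real k \<le> norm (\<eta> \<omega>) \<longrightarrow> real k \<le> norm (\<eta>' \<omega>))))" for n \<eta>
  have "\<forall>n. \<exists>\<eta>. Q n \<eta>"
    unfolding Q_def P_def by (intro allI minimal_position[OF t X])
  from choice[OF this] obtain e where e_all: "\<forall>n. Q n (e n)" by blast
  then have e: "\<And>n. adm t (e n)" "\<And>n. attainable (Suc t) (\<lambda>\<omega>. X n \<omega> - G t \<omega> (e n \<omega>))"
    unfolding P_def Q_def by blast+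
  have e_min: "\<And>n \<eta> k. adm t \<eta> \<Longrightarrow> attainable (Suc t) (\<lambda>\<omega>. X n \<omega> - G t \<omega> (\<eta> \<omega>)) \<Longrightarrow>
      (AE \<omega> in M. real k \<le> norm (\<eta> \<omega>) \<longrightarrow> real k \<le> norm (e n \<omega>)) \<Longrightarrow>
      (AE \<omega> in M. real k \<le> norm (e n \<omega>) \<longrightarrow> real k \<le> norm (\<eta> \<omega>))"
    using e_all unfolding P_def Q_def by blast
  have e_meas [measurable]: "e n \<in> borel_measurable (H t)" for n using e(1) by (rule adm_measurable)
  \<comment> \<open>The event liminf norm (e n) < \<infinity>; with integer bounds it is visibly in
    \<open>H t\<close>.\<close>
  define B where "B \<omega> \<longleftrightarrow> (\<exists>K::nat. \<forall>m. \<exists>n\<ge>m. norm (e n \<omega>) \<le> real K)" for \<omega>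
  have [measurable]: "Measurable.pred (H t) B" unfolding B_def by measurable
  have B_iff: "B \<omega> \<longleftrightarrow> (\<exists>K::nat. \<exists>\<^sub>\<infinity>n. norm (e n \<omega>) \<le> K)" for \<omega>
    by (simp add: B_def INFM_nat_le)
  have not_B: "\<exists>m. \<forall>n\<ge>m. norm (e n \<omega>) > K" if "\<not> B \<omega>" for \<omega> and K :: real
  proof -
    obtain K' :: nat where "K \<le> real K'" using real_arch_simple by blast
    with that show ?thesis unfolding B_def by (meson le_less_trans not_le)
  qed
  have AE_B: "AE \<omega> in M. B \<omega>"
  proof -
    \<comment> \<open>Normalisation takes place only where the positions explode, so the limit
      direction vanishes on \<open>B\<close>. The \<open>max 1\<close> guards against division by
      zero, and outside \<open>B\<close> the factor tends to 0.\<close>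
    define f where "f n \<omega> = (if B \<omega> then 0 else 1 / max 1 (norm (e n \<omega>)))" for n \<omega>
    have [measurable]: "f n \<in> borel_measurable (H t)" for n unfolding f_def by measurable
    have f0: "0 \<le> f n \<omega>" for n \<omega> by (simp add: f_def le_max_iff_disj)
    have fe1: "norm (f n \<omega> *\<^sub>R e n \<omega>) \<le> 1" for n \<omega> by (simp add: f_def max_def divide_simps)
    have "\<exists>K::nat. \<exists>\<^sub>\<infinity>n. norm (f n \<omega> *\<^sub>R e n \<omega>) \<le> K" for \<omega>
      using fe1[of _ \<omega>] by (intro exI[of _ 1]) (simp add: INFM_nat_le)
    moreover have "(\<lambda>\<omega>. f n \<omega> *\<^sub>R e n \<omega>) \<in> borel_measurable (H t)" for n by measurable
    ultimately obtain \<tau> g where \<tau> [measurable]: "\<And>k. \<tau> k \<in> measurable (H t) (count_space UNIV)"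
      and g [measurable]: "g \<in> borel_measurable (H t)"
      and mono: "\<And>\<omega>. \<omega> \<in> space (H t) \<Longrightarrow> strict_mono (\<lambda>k. \<tau> k \<omega>)"
      and conv: "\<And>\<omega>. \<omega> \<in> space (H t) \<Longrightarrow> (\<lambda>k. f (\<tau> k \<omega>) \<omega> *\<^sub>R e (\<tau> k \<omega>) \<omega>) \<longlonglongrightarrow> g \<omega>"
      using measurable_convergent_subsequence[where M = "H t" and f = "\<lambda>n \<omega>. f n \<omega> *\<^sub>R e n \<omega>"]
      by blast
    have sp: "space (H t) = space M" by (rule space_H[OF t])
    have adm_fe: "adm t (\<lambda>\<omega>. f n \<omega> *\<^sub>R e n \<omega>)" for n
      by (rule adm_scale[OF order_refl t _ f0 e(1)]) measurable
    have "AE \<omega> in M. \<forall>n. f n \<omega> *\<^sub>R e n \<omega> \<in> A"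
      using adm_AE[OF adm_fe] by (simp add: AE_all_countable)
    then have "AE \<omega> in M. g \<omega> \<in> A"
      using AE_space
    proof eventually_elim
      case (elim \<omega>)
      then show ?case using conv[of \<omega>] lim_A[of "\<lambda>k. f (\<tau> k \<omega>) \<omega> *\<^sub>R e (\<tau> k \<omega>) \<omega>"] by (simp add: sp)
    qed
    then have adm_g: "adm t g" using g by (simp add: L0A_def)
    have g_M: "g \<in> borel_measurable M" by (rule adm_measurable_M[OF t adm_g])
    \<comment> \<open>After normalisation the convergent claims \<open>X n\<close> disappear in the
      limit, and only the value of the direction g is left to be hedged.\<close>
    have "attainable (Suc t) (\<lambda>\<omega>. - G t \<omega> (g \<omega>))"
    proof (rule IH)
      show "attainable (Suc t) (\<lambda>\<omega>. f (\<tau> k \<omega>) \<omega> *\<^sub>R (X (\<tau> k \<omega>) \<omega> - G t \<omega> (e (\<tau> k \<omega>) \<omega>)))" for k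
        by (rule attainable_glue[OF t tS \<tau>, where X = "\<lambda>n \<omega>. f n \<omega> *\<^sub>R (X n \<omega> - G t \<omega> (e n \<omega>))"],
            rule attainable_scale[OF t tS _ f0 e(2)]) measurable
      show "(\<lambda>\<omega>. - G t \<omega> (g \<omega>)) \<in> borel_measurable M"
        by (intro borel_measurable_uminus G_measurable t g_M)
      show "AE \<omega> in M. (\<lambda>k. f (\<tau> k \<omega>) \<omega> *\<^sub>R (X (\<tau> k \<omega>) \<omega> - G t \<omega> (e (\<tau> k \<omega>) \<omega>)))
          \<longlonglongrightarrow> - G t \<omega> (g \<omega>)"
        using lim AE_space
      proof eventually_elim
        case (elim \<omega>)
        have sub: "filterlim (\<lambda>k. \<tau> k \<omega>) sequentially sequentially"
          using mono elim(2) by (simp add: sp filterlim_subseq)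
        have "(\<lambda>n. f n \<omega>) \<longlonglongrightarrow> 0"
        proof (cases "B \<omega>")
          case True
          then show ?thesis by (simp add: f_def)
        next
          case False
          show ?thesis
          proof (rule LIMSEQ_I)
            fix r :: real assume r: "r > 0"
            obtain m where m: "\<And>n. n \<ge> m \<Longrightarrow> norm (e n \<omega>) > max 1 (1 / r)"
              using not_B[OF False] by blast
            have "norm (f n \<omega> - 0) < r" if "n \<ge> m" for n
            proof -
              have gt: "norm (e n \<omega>) > 1" "norm (e n \<omega>) > 1 / r" using m[OF that] by simp_all
              then have "1 / norm (e n \<omega>) < r" using r by (simp add: divide_simps mult.commute)
              then show ?thesis using gt(1) False by (simp add: f_def max_def)
            qed
            then show "\<exists>no. \<forall>n\<ge>no. norm (f n \<omega> - 0) < r" by blast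
          qed
        qed
        then have "(\<lambda>n. f n \<omega> *\<^sub>R X n \<omega>) \<longlonglongrightarrow> 0 *\<^sub>R Y \<omega>" using elim(1) by (intro tendsto_intros)
        then have 1: "(\<lambda>k. f (\<tau> k \<omega>) \<omega> *\<^sub>R X (\<tau> k \<omega>) \<omega>) \<longlonglongrightarrow> 0"
          using filterlim_compose[OF _ sub] by simp
        have "(\<lambda>k. G t \<omega> (f (\<tau> k \<omega>) \<omega> *\<^sub>R e (\<tau> k \<omega>) \<omega>)) \<longlonglongrightarrow> G t \<omega> (g \<omega>)"
          using conv elim(2) by (intro continuous_on_tendsto_compose[OF continuous_G]) (auto simp: sp)
        then have "(\<lambda>k. f (\<tau> k \<omega>) \<omega> *\<^sub>R X (\<tau> k \<omega>) \<omega> - G t \<omega> (f (\<tau> k \<omega>) \<omega> *\<^sub>R e (\<tau> k \<omega>) \<omega>))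
            \<longlonglongrightarrow> 0 - G t \<omega> (g \<omega>)" by (intro tendsto_diff 1)
        then show ?case by (simp add: G_scale f0 scaleR_diff_right)
      qed
    qed
    then obtain \<eta> where \<eta>: "\<And>s. Suc t \<le> s \<Longrightarrow> s \<le> T \<Longrightarrow> adm s (\<eta> s)"
      and le: "AE \<omega> in M. - G t \<omega> (g \<omega>) \<le> (\<Sum>s=Suc t..T. G s \<omega> (\<eta> s \<omega>))"
      unfolding attainable_def by blast
    \<comment> \<open>No trade before t, then g, then the hedge of -G(g): a full strategy with
      nonnegative total, to which KP applies with the zero strategy as its partner.\<close>
    define \<theta> where "\<theta> s = (if s < t then (\<lambda>_. 0) else if s = t then g else \<eta> s)" for s
    have \<theta>: "adm s (\<theta> s)" if "s \<le> T" for s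
      using \<eta>[of s] that adm_g by (auto simp: \<theta>_def adm_zero)
    have \<theta>_sum: "(\<Sum>s=0..T. G s \<omega> (\<theta> s \<omega>)) = G t \<omega> (g \<omega>) + (\<Sum>s=Suc t..T. G s \<omega> (\<theta> s \<omega>))" for \<omega>
    proof -
      have "(\<Sum>s=0..T. G s \<omega> (\<theta> s \<omega>)) = (\<Sum>s=t..T. G s \<omega> (\<theta> s \<omega>))"
        by (rule sum.mono_neutral_right) (auto simp: \<theta>_def)
      then show ?thesis using t by (simp add: sum.atLeast_Suc_atMost) (simp add: \<theta>_def)
    qed
    have pos: "AE \<omega> in M. 0 \<le> (\<Sum>s=0..T. G s \<omega> (\<theta> s \<omega>))"
      using le
    proof eventually_elim
      case (elim \<omega>)
      have "(\<Sum>s=Suc t..T. G s \<omega> (\<theta> s \<omega>)) = (\<Sum>s=Suc t..T. G s \<omega> (\<eta> s \<omega>))"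
        by (intro sum.cong) (auto simp: \<theta>_def)
      with elim show ?case
        unfolding \<theta>_sum by (metis add.commute diff_ge_0_iff_ge diff_minus_eq_add)
    qed
    have zs: "AE \<omega> in M. (\<Sum>s=0..T. G s \<omega> (\<theta> s \<omega>)) = 0"
      "\<And>s. s \<le> T \<Longrightarrow> adm s (\<lambda>\<omega>. - \<theta> s \<omega>)"
      "\<And>s. s \<le> T \<Longrightarrow> AE \<omega> in M. G s \<omega> (- \<theta> s \<omega>) = - G s \<omega> (\<theta> s \<omega>)"
      using offsetting_strategies[OF HN0 KP, of \<theta> "\<lambda>_ _. 0"] \<theta> pos by (simp_all add: adm_zero)
    have neg_g: "adm t (\<lambda>\<omega>. - g \<omega>)" "AE \<omega> in M. G t \<omega> (- g \<omega>) = - G t \<omega> (g \<omega>)"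
      using zs(2)[OF t] zs(3)[OF t] by (simp_all add: \<theta>_def)
    \<comment> \<open>The total is zero and each position is reversible, so the part of \<theta>
      after date t, traded with opposite sign, pays exactly G(g).\<close>
    have att_g: "attainable (Suc t) (\<lambda>\<omega>. G t \<omega> (g \<omega>))"
    proof (rule attainable_mono)
      show "attainable (Suc t) (\<lambda>\<omega>. \<Sum>s=Suc t..T. G s \<omega> (- \<theta> s \<omega>))"
        using zs(2) by (intro attainable_strategy) auto
      have "AE \<omega> in M. \<forall>s\<in>{Suc t..T}. G s \<omega> (- \<theta> s \<omega>) = - G s \<omega> (\<theta> s \<omega>)"
        using zs(3) by (intro AE_finite_allI) auto
      with zs(1) show "AE \<omega> in M. G t \<omega> (g \<omega>) \<le> (\<Sum>s=Suc t..T. G s \<omega> (- \<theta> s \<omega>))"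
      proof eventually_elim
        case (elim \<omega>)
        have "(\<Sum>s=Suc t..T. G s \<omega> (- \<theta> s \<omega>)) = - (\<Sum>s=Suc t..T. G s \<omega> (\<theta> s \<omega>))"
          unfolding sum_negf[symmetric] using elim(2) by (intro sum.cong) auto
        then show ?case using elim(1) unfolding \<theta>_sum
          by (metis eq_neg_iff_add_eq_0 order_refl)
      qed
    qed (intro G_measurable t g_M)
    \<comment> \<open>Where the normalised position is within 1/4 of g, subtracting norm (e n) times
      g leaves at most a quarter of the norm. With the threshold 4 the norm falls by at least 3, so
      its integer part must drop.\<close>
    define L where "L n \<omega> \<longleftrightarrow> \<not> B \<omega> \<and> 4 \<le> norm (e n \<omega>) \<and> norm (f n \<omega> *\<^sub>R e n \<omega> - g \<omega>) \<le> 1/4" for n \<omega>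
    have not_L: "AE \<omega> in M. \<not> L n \<omega>" for n
    proof -
      define \<beta> where "\<beta> \<omega> = (if L n \<omega> then norm (e n \<omega>) else 0)" for \<omega>
      have [measurable]: "\<beta> \<in> borel_measurable (H t)" unfolding \<beta>_def L_def by measurable
      have \<beta>0: "0 \<le> \<beta> \<omega>" for \<omega> by (simp add: \<beta>_def)
      \<comment> \<open>By superadditivity and G(-g) = -G(g), the new position loses at most \<beta>
        G(g), and \<open>att_g\<close> recovers this at later dates. So e' leads to the same
        claim.\<close>
      define e' where "e' \<omega> = e n \<omega> + \<beta> \<omega> *\<^sub>R - g \<omega>" for \<omega>
      have adm_b: "adm t (\<lambda>\<omega>. \<beta> \<omega> *\<^sub>R - g \<omega>)"
        by (rule adm_scale[OF order_refl t _ \<beta>0 neg_g(1)]) measurable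
      have adm_e': "adm t e'" unfolding e'_def by (intro adm_add e adm_b)
      have att_e': "attainable (Suc t) (\<lambda>\<omega>. X n \<omega> - G t \<omega> (e' \<omega>))"
      proof (rule attainable_mono)
        show "attainable (Suc t) (\<lambda>\<omega>. (X n \<omega> - G t \<omega> (e n \<omega>)) + \<beta> \<omega> *\<^sub>R G t \<omega> (g \<omega>))"
          by (rule attainable_add[OF e(2)], rule attainable_scale[OF t tS _ \<beta>0 att_g]) measurable
        show "(\<lambda>\<omega>. X n \<omega> - G t \<omega> (e' \<omega>)) \<in> borel_measurable M"
          by (intro borel_measurable_diff attainable_measurable[OF X] G_measurable t
              adm_measurable_M[OF t adm_e'])
        show "AE \<omega> in M. X n \<omega> - G t \<omega> (e' \<omega>) \<le> (X n \<omega> - G t \<omega> (e n \<omega>)) + \<beta> \<omega> *\<^sub>R G t \<omega> (g \<omega>)"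
          using G_superadditive[OF t] adm_AE[OF e(1)[of n]] adm_AE[OF adm_b] neg_g(2)
        proof eventually_elim
          case (elim \<omega>)
          have "G t \<omega> (e n \<omega>) + G t \<omega> (\<beta> \<omega> *\<^sub>R - g \<omega>) \<le> G t \<omega> (e' \<omega>)"
            using elim unfolding e'_def by blast
          moreover have "G t \<omega> (\<beta> \<omega> *\<^sub>R - g \<omega>) = - (\<beta> \<omega> *\<^sub>R G t \<omega> (g \<omega>))"
            using elim(4) G_scale[OF \<beta>0[of \<omega>], of t \<omega> "- g \<omega>"] by simp
          ultimately show ?case by (simp add: less_eq_vec_def algebra_simps)
        qed
      qed
      have small: "norm (e' \<omega>) \<le> norm (e n \<omega>) - 3" if "L n \<omega>" for \<omega>
      proof -
        have big: "4 \<le> norm (e n \<omega>)" using that by (simp add: L_def)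
        then have "e n \<omega> \<noteq> 0" by auto
        with big have fe: "norm (e n \<omega>) * f n \<omega> = 1" using that by (simp add: L_def f_def)
        have "e' \<omega> = norm (e n \<omega>) *\<^sub>R (f n \<omega> *\<^sub>R e n \<omega> - g \<omega>)"
          using fe that by (simp add: e'_def \<beta>_def scaleR_diff_right)
        then have "norm (e' \<omega>) = norm (e n \<omega>) * norm (f n \<omega> *\<^sub>R e n \<omega> - g \<omega>)" by simp
        also have "\<dots> \<le> norm (e n \<omega>) * (1/4)"
          using that by (intro mult_left_mono) (auto simp: L_def)
        finally show ?thesis using big by simp
      qed
      \<comment> \<open>As e' is nowhere longer than \<open>e n\<close>, minimality forces the
        reverse implication for every k: the two norms have the same integer part almost
        surely.\<close>
      have "AE \<omega> in M. real k \<le> norm (e n \<omega>) \<longrightarrow> real k \<le> norm (e' \<omega>)" for k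
      proof (rule e_min[OF adm_e' att_e'], rule AE_I2, rule impI)
        fix \<omega> assume "real k \<le> norm (e' \<omega>)"
        moreover have "norm (e' \<omega>) \<le> norm (e n \<omega>)"
          by (cases "L n \<omega>") (use small[of \<omega>] in \<open>auto simp: e'_def \<beta>_def\<close>)
        ultimately show "real k \<le> norm (e n \<omega>)" by simp
      qed
      then have "AE \<omega> in M. \<forall>k. real k \<le> norm (e n \<omega>) \<longrightarrow> real k \<le> norm (e' \<omega>)"
        by (simp add: AE_all_countable)
      then show ?thesis
      proof eventually_elim
        case (elim \<omega>)
        define k where "k = nat \<lfloor>norm (e n \<omega>)\<rfloor>"
        have "real k = of_int \<lfloor>norm (e n \<omega>)\<rfloor>" by (simp add: k_def)
        then have k: "real k \<le> norm (e n \<omega>)" "norm (e n \<omega>) < real k + 1" by linarith+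
        then have "real k \<le> norm (e' \<omega>)" using elim by blast
        with k small[of \<omega>] show ?case by linarith
      qed
    qed
    then have "AE \<omega> in M. \<forall>n. \<not> L n \<omega>" by (simp add: AE_all_countable)
    then show ?thesis
      using AE_space
    proof eventually_elim
      case (elim \<omega>)
      show ?case
      proof (rule ccontr)
        assume nB: "\<not> B \<omega>"
        obtain m where m: "\<And>n. n \<ge> m \<Longrightarrow> norm (e n \<omega>) > 4" using not_B[OF nB] by blast
        have "\<forall>\<^sub>F k in sequentially. dist (f (\<tau> k \<omega>) \<omega> *\<^sub>R e (\<tau> k \<omega>) \<omega>) (g \<omega>) < 1/4"
          using conv[of \<omega>] elim(2) by (intro tendstoD) (auto simp: sp)
        then obtain k0 where k0: "\<And>k. k \<ge> k0 \<Longrightarrow> dist (f (\<tau> k \<omega>) \<omega> *\<^sub>R e (\<tau> k \<omega>) \<omega>) (g \<omega>) < 1/4"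
          by (auto simp: eventually_sequentially)
        define k where "k = max k0 m"
        have "\<tau> k \<omega> \<ge> k" using mono[of \<omega>] elim(2) seq_suble[of "\<lambda>k. \<tau> k \<omega>"] by (simp add: sp)
        then have "L (\<tau> k \<omega>) \<omega>"
          using nB m[of "\<tau> k \<omega>"] k0[of k] by (simp add: L_def k_def dist_norm)
        with elim(1) show False by blast
      qed
    qed
  qed
  \<comment> \<open>The subsequence lemma asks for boundedness at every point, hence the value 0 on
    the null set outside \<open>B\<close>.\<close>
  define e1 where "e1 n \<omega> = (if B \<omega> then e n \<omega> else 0)" for n \<omega>
  have "\<exists>K::nat. \<exists>\<^sub>\<infinity>n. norm (e1 n \<omega>) \<le> K" for \<omega>
  proof (cases "B \<omega>")
    case True
    then show ?thesis using B_iff[of \<omega>] by (simp add: e1_def)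
  next
    case False
    then show ?thesis by (auto simp: e1_def INFM_nat_le)
  qed
  moreover have "e1 n \<in> borel_measurable (H t)" for n unfolding e1_def by measurable
  ultimately obtain \<tau> g where \<tau> [measurable]: "\<And>k. \<tau> k \<in> measurable (H t) (count_space UNIV)"
    and g [measurable]: "g \<in> borel_measurable (H t)"
    and mono: "\<And>\<omega>. \<omega> \<in> space (H t) \<Longrightarrow> strict_mono (\<lambda>k. \<tau> k \<omega>)"
    and conv: "\<And>\<omega>. \<omega> \<in> space (H t) \<Longrightarrow> (\<lambda>k. e1 (\<tau> k \<omega>) \<omega>) \<longlonglongrightarrow> g \<omega>"
    using measurable_convergent_subsequence[where M = "H t" and f = e1] by blast
  have sp: "space (H t) = space M" by (rule space_H[OF t])
  have lim_e: "AE \<omega> in M. (\<lambda>k. e (\<tau> k \<omega>) \<omega>) \<longlonglongrightarrow> g \<omega>"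
    using AE_B AE_space
  proof eventually_elim
    case (elim \<omega>)
    then show ?case using conv[of \<omega>] by (simp add: sp e1_def)
  qed
  have "AE \<omega> in M. \<forall>n. e n \<omega> \<in> A"
    using adm_AE[OF e(1)] by (simp add: AE_all_countable)
  with lim_e have "AE \<omega> in M. g \<omega> \<in> A"
  proof eventually_elim
    case (elim \<omega>)
    then show ?case using lim_A[of "\<lambda>k. e (\<tau> k \<omega>) \<omega>"] by simp
  qed
  then have adm_g: "adm t g" using g by (simp add: L0A_def)
  have "attainable (Suc t) (\<lambda>\<omega>. Y \<omega> - G t \<omega> (g \<omega>))"
  proof (rule IH)
    show "attainable (Suc t) (\<lambda>\<omega>. X (\<tau> k \<omega>) \<omega> - G t \<omega> (e (\<tau> k \<omega>) \<omega>))" for k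
      by (rule attainable_glue[OF t tS \<tau>, where X = "\<lambda>n \<omega>. X n \<omega> - G t \<omega> (e n \<omega>)"], rule e(2))
    show "(\<lambda>\<omega>. Y \<omega> - G t \<omega> (g \<omega>)) \<in> borel_measurable M"
      by (intro borel_measurable_diff Y G_measurable t adm_measurable_M[OF t adm_g])
    show "AE \<omega> in M. (\<lambda>k. X (\<tau> k \<omega>) \<omega> - G t \<omega> (e (\<tau> k \<omega>) \<omega>)) \<longlonglongrightarrow> Y \<omega> - G t \<omega> (g \<omega>)"
      using lim lim_e AE_space
    proof eventually_elim
      case (elim \<omega>)
      have sub: "filterlim (\<lambda>k. \<tau> k \<omega>) sequentially sequentially"
        using mono elim(3) by (simp add: sp filterlim_subseq)
      show ?case
        using filterlim_compose[OF elim(1) sub] elim(2)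
        by (intro tendsto_diff continuous_on_tendsto_compose[OF continuous_G]) auto
    qed
  qed
  with adm_g show ?thesis using attainable_Suc_iff[OF t Y] by blast
qed

theorem attainable_closed:
  assumes HN0: "HN0 M H A F T" and KP: "KP M H A F T" and "t \<le> Suc T"
    and "\<And>n::nat. attainable t (X n)" "Y \<in> borel_measurable M"
    and "AE \<omega> in M. (\<lambda>n. X n \<omega>) \<longlonglongrightarrow> Y \<omega>"
  shows "attainable t Y"
  using assms(3-)
proof (induction arbitrary: X Y rule: inc_induct)
  case base
  have "AE \<omega> in M. \<forall>n. X n \<omega> \<le> 0"
    using base(1) by (simp add: attainable_def AE_all_countable)
  with base(3) have "AE \<omega> in M. Y \<omega> \<le> 0"
    by eventually_elim (rule LIMSEQ_le_vec[OF _ tendsto_const], auto)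
  with base(2) show ?case by (simp add: attainable_def)
next
  case (step t)
  show ?case
    by (rule attainable_closed_step[OF HN0 KP _ _ step.prems]) (use step in auto)
qed

end


section \<open>Dual variables\<close>

lemma integrable_scaleR_bounded:
  fixes X :: "'a \<Rightarrow> 'b::{banach, second_countable_topology}"
  assumes "integrable M X" "f \<in> borel_measurable M" "\<And>\<omega>. \<bar>f \<omega>\<bar> \<le> K"
  shows "integrable M (\<lambda>\<omega>. f \<omega> *\<^sub>R X \<omega>)"
proof (rule Bochner_Integration.integrable_bound[where f = "\<lambda>\<omega>. K *\<^sub>R norm (X \<omega>)"])
  show "AE \<omega> in M. norm (f \<omega> *\<^sub>R X \<omega>) \<le> norm (K *\<^sub>R norm (X \<omega>))"
  proof (rule AE_I2)
    fix \<omega>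
    have "\<bar>f \<omega>\<bar> * norm (X \<omega>) \<le> \<bar>K\<bar> * norm (X \<omega>)"
      using assms(3)[of \<omega>] by (intro mult_right_mono) auto
    then show "norm (f \<omega> *\<^sub>R X \<omega>) \<le> norm (K *\<^sub>R norm (X \<omega>))" by (simp add: abs_mult)
  qed
qed (use assms in auto)

lemma integrable_inner_bounded:
  fixes X Z :: "'a \<Rightarrow> 'b::euclidean_space"
  assumes "integrable M X" "Z \<in> borel_measurable M" "AE \<omega> in M. norm (Z \<omega>) \<le> K"
  shows "integrable M (\<lambda>\<omega>. Z \<omega> \<bullet> X \<omega>)"
proof (rule Bochner_Integration.integrable_bound[where f = "\<lambda>\<omega>. K *\<^sub>R norm (X \<omega>)"])
  show "AE \<omega> in M. norm (Z \<omega> \<bullet> X \<omega>) \<le> norm (K *\<^sub>R norm (X \<omega>))"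
    using assms(3)
  proof eventually_elim
    case (elim \<omega>)
    have "\<bar>Z \<omega> \<bullet> X \<omega>\<bar> \<le> norm (Z \<omega>) * norm (X \<omega>)" by (rule Cauchy_Schwarz_ineq2)
    also have "\<dots> \<le> K * norm (X \<omega>)" using elim by (intro mult_right_mono) auto
    finally show ?case using abs_ge_self[of "K * norm (X \<omega>)"] by simp
  qed
qed (use assms in auto)

locale integrable_market = market M H T A F
  for M :: "'a measure" and H T and A :: "(real^'d::finite^'d) set" and F +
  assumes condI: "condI M F T"
begin

definition bounded_rv :: "('a \<Rightarrow> real^'d) \<Rightarrow> bool" where
  "bounded_rv Z \<longleftrightarrow> Z \<in> borel_measurable M \<and> (\<exists>C. AE \<omega> in M. norm (Z \<omega>) \<le> C)"

lemma bounded_rv_inner_integrable: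
  "bounded_rv Z \<Longrightarrow> integrable M X \<Longrightarrow> integrable M (\<lambda>\<omega>. Z \<omega> \<bullet> X \<omega>)"
  unfolding bounded_rv_def by (auto intro: integrable_inner_bounded)

lemma F_integrable:
  "t \<le> T \<Longrightarrow> integrable M (\<lambda>\<omega>. F t \<omega> (emat i j))"
  "t \<le> T \<Longrightarrow> integrable M (\<lambda>\<omega>. F t \<omega> (- emat i j))"
  using condI by (simp_all add: condI_def)

text \<open>The conditional functional at a deterministic position. One choice of versions of the
  conditional expectations serves all a, and the result is continuous in a, so null sets can be made
  independent of the position.\<close>

definition R :: "nat \<Rightarrow> ('a \<Rightarrow> real^'d) \<Rightarrow> 'a \<Rightarrow> real^'d^'d \<Rightarrow> real" where
  "R t Z \<omega> a = barF M H F t (\<lambda>_. a) Z \<omega>"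

lemma barF_eq_R: "barF M H F t \<eta> Z \<omega> = R t Z \<omega> (\<eta> \<omega>)"
  by (simp add: R_def barF_def)

lemma R_scale: "0 \<le> c \<Longrightarrow> R t Z \<omega> (c *\<^sub>R a) = c * R t Z \<omega> a"
  using max_zero_mult_left[of c "- _"]
  by (simp add: R_def barF_def max_zero_mult_left sum_distrib_left distrib_left mult.assoc)

lemma R_zero [simp]: "R t Z \<omega> 0 = 0"
  using R_scale[of 0] by simp

lemma continuous_R: "continuous_on UNIV (R t Z \<omega>)"
  unfolding R_def barF_def by (intro continuous_intros)

lemma component_measurable:
  "\<eta> \<in> borel_measurable N \<Longrightarrow> (\<lambda>\<omega>. \<eta> \<omega> $ i $ j) \<in> borel_measurable N" for \<eta> :: "_ \<Rightarrow> real^'m^'n"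
  by (rule measurable_compose[of \<eta> N borel "\<lambda>a. a $ i $ j"])
    (auto intro!: borel_measurable_continuous_onI continuous_intros)

lemma R_measurable:
  assumes "t \<le> T" "\<eta> \<in> borel_measurable (H t)"
  shows "(\<lambda>\<omega>. R t Z \<omega> (\<eta> \<omega>)) \<in> borel_measurable (H t)"
proof -
  note [measurable] = component_measurable[OF assms(2)]
  show ?thesis unfolding R_def barF_def by measurable
qed

lemma sigma_finite_sub: "t \<le> T \<Longrightarrow> sigma_finite_subalgebra M (H t)"
  by (intro finite_measure_subalgebra_is_sigma_finite finite_measure_subalgebra.intro
      finite_measure_subalgebra_axioms.intro subalg) unfold_locales

lemma component_bound: "\<bar>max (a $ i $ j) 0\<bar> \<le> norm a" "\<bar>max (- (a $ i $ j)) 0\<bar> \<le> norm a"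
  for a :: "real^'m^'n"
proof -
  have "\<bar>a $ i $ j\<bar> \<le> norm a"
    using component_le_norm_cart[of "a $ i" j] Finite_Cartesian_Product.norm_nth_le[of a i] by linarith
  then show "\<bar>max (a $ i $ j) 0\<bar> \<le> norm a" "\<bar>max (- (a $ i $ j)) 0\<bar> \<le> norm a" by auto
qed

lemma G_integrable:
  assumes t: "t \<le> T" and \<eta>: "\<eta> \<in> borel_measurable M" and K: "\<And>\<omega>. norm (\<eta> \<omega>) \<le> K"
  shows "integrable M (\<lambda>\<omega>. G t \<omega> (\<eta> \<omega>))"
proof -
  note [measurable] = component_measurable[OF \<eta>]
  show ?thesis
    unfolding G_def
    by (intro Bochner_Integration.integrable_sum Bochner_Integration.integrable_add
        integrable_scaleR_bounded[where K = K] F_integrable t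
        order_trans[OF component_bound(1) K] order_trans[OF component_bound(2) K]) measurable
qed

text \<open>The coefficients of a bounded \<open>H t\<close>-measurable position are bounded and
  known at date t, so each of them can be pulled out of its conditional expectation.\<close>

lemma expectation_inner_G:
  assumes t: "t \<le> T" and Z: "bounded_rv Z"
    and \<eta>: "\<eta> \<in> borel_measurable (H t)" and K: "\<And>\<omega>. norm (\<eta> \<omega>) \<le> K"
  shows "integrable M (\<lambda>\<omega>. R t Z \<omega> (\<eta> \<omega>))"
    and "(\<integral>\<omega>. Z \<omega> \<bullet> G t \<omega> (\<eta> \<omega>) \<partial>M) = (\<integral>\<omega>. R t Z \<omega> (\<eta> \<omega>) \<partial>M)"
proof -
  interpret sigma_finite_subalgebra M "H t" by (rule sigma_finite_sub[OF t])
  note [measurable] = component_measurable[OF \<eta>]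
  have ZF: "integrable M (\<lambda>\<omega>. Z \<omega> \<bullet> X \<omega>)" if "integrable M X" for X
    using Z that by (rule bounded_rv_inner_integrable)
  have fZF: "integrable M (\<lambda>\<omega>. f \<omega> * (Z \<omega> \<bullet> X \<omega>))"
    if "integrable M X" "f \<in> borel_measurable (H t)" "\<And>\<omega>. \<bar>f \<omega>\<bar> \<le> K" for X f
    using integrable_scaleR_bounded[OF ZF[OF that(1)] H_measurable_M[OF t that(2)] that(3)] by simp
  define p where "p i j \<omega> = max (\<eta> \<omega> $ i $ j) 0" for i j \<omega>
  define q where "q i j \<omega> = max (- (\<eta> \<omega> $ i $ j)) 0" for i j \<omega>
  have [measurable]: "p i j \<in> borel_measurable (H t)" "q i j \<in> borel_measurable (H t)" for i j
    unfolding p_def q_def by measurable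
  have pq: "\<bar>p i j \<omega>\<bar> \<le> K" "\<bar>q i j \<omega>\<bar> \<le> K" for i j \<omega>
    unfolding p_def q_def
    by (rule order_trans[OF component_bound(1) K], rule order_trans[OF component_bound(2) K])
  have int1: "integrable M (\<lambda>\<omega>. p i j \<omega> * (Z \<omega> \<bullet> F t \<omega> (emat i j)))"
    "integrable M (\<lambda>\<omega>. q i j \<omega> * (Z \<omega> \<bullet> F t \<omega> (- emat i j)))" for i j
    by (rule fZF, rule F_integrable[OF t], measurable, rule pq)+
  have [measurable]: "(\<lambda>\<omega>. Z \<omega> \<bullet> F t \<omega> (emat i j)) \<in> borel_measurable M"
    "(\<lambda>\<omega>. Z \<omega> \<bullet> F t \<omega> (- emat i j)) \<in> borel_measurable M" for i j
    using ZF[OF F_integrable(1)[OF t]] ZF[OF F_integrable(2)[OF t]] by auto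
  note int2 = real_cond_exp_intg(1)[OF int1(1)] real_cond_exp_intg(1)[OF int1(2)]
  note eq = real_cond_exp_intg(2)[OF int1(1)] real_cond_exp_intg(2)[OF int1(2)]
  show "integrable M (\<lambda>\<omega>. R t Z \<omega> (\<eta> \<omega>))"
    unfolding R_def barF_def p_def[symmetric] q_def[symmetric]
    by (intro Bochner_Integration.integrable_sum Bochner_Integration.integrable_add int2) measurable
  have "(\<integral>\<omega>. Z \<omega> \<bullet> G t \<omega> (\<eta> \<omega>) \<partial>M) = (\<Sum>i\<in>UNIV. \<Sum>j\<in>UNIV.
      (\<integral>\<omega>. p i j \<omega> * (Z \<omega> \<bullet> F t \<omega> (emat i j)) \<partial>M) + (\<integral>\<omega>. q i j \<omega> * (Z \<omega> \<bullet> F t \<omega> (- emat i j)) \<partial>M))"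
    unfolding G_def p_def[symmetric] q_def[symmetric]
    by (simp add: inner_sum_right inner_add_right Bochner_Integration.integral_sum int1)
  also have "\<dots> = (\<integral>\<omega>. R t Z \<omega> (\<eta> \<omega>) \<partial>M)"
    unfolding R_def barF_def p_def[symmetric] q_def[symmetric]
    by (simp add: Bochner_Integration.integral_sum int2 eq)
  finally show "(\<integral>\<omega>. Z \<omega> \<bullet> G t \<omega> (\<eta> \<omega>) \<partial>M) = (\<integral>\<omega>. R t Z \<omega> (\<eta> \<omega>) \<partial>M)" .
qed

text \<open>Only finitely many conditional expectations enter, so one null set suffices for all a.
  The form p Z + W is the one needed to compare a combination of dual variables with one of its
  summands.\<close>

lemma R_linear:
  assumes t: "t \<le> T" and Z: "bounded_rv Z" "bounded_rv W"
  shows "AE \<omega> in M. \<forall>a. R t (\<lambda>\<omega>. p *\<^sub>R Z \<omega> + W \<omega>) \<omega> a = p * R t Z \<omega> a + R t W \<omega> a"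
proof -
  interpret sigma_finite_subalgebra M "H t" by (rule sigma_finite_sub[OF t])
  have lin: "AE \<omega> in M. real_cond_exp M (H t) (\<lambda>\<omega>. (p *\<^sub>R Z \<omega> + W \<omega>) \<bullet> X \<omega>) \<omega> =
      p * real_cond_exp M (H t) (\<lambda>\<omega>. Z \<omega> \<bullet> X \<omega>) \<omega> + real_cond_exp M (H t) (\<lambda>\<omega>. W \<omega> \<bullet> X \<omega>) \<omega>"
    if X: "integrable M X" for X
  proof -
    have i: "integrable M (\<lambda>\<omega>. Z \<omega> \<bullet> X \<omega>)" "integrable M (\<lambda>\<omega>. W \<omega> \<bullet> X \<omega>)"
      using Z X by (auto intro: bounded_rv_inner_integrable)
    have "AE \<omega> in M. real_cond_exp M (H t) (\<lambda>\<omega>. p * (Z \<omega> \<bullet> X \<omega>) + W \<omega> \<bullet> X \<omega>) \<omega> =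
        real_cond_exp M (H t) (\<lambda>\<omega>. p * (Z \<omega> \<bullet> X \<omega>)) \<omega> + real_cond_exp M (H t) (\<lambda>\<omega>. W \<omega> \<bullet> X \<omega>) \<omega>"
      by (intro real_cond_exp_add integrable_mult_right i)
    with real_cond_exp_cmult[OF i(1), of p] show ?thesis
      by eventually_elim (simp add: inner_add_left)
  qed
  have "AE \<omega> in M. \<forall>i\<in>UNIV. \<forall>j\<in>UNIV.
      real_cond_exp M (H t) (\<lambda>\<omega>'. (p *\<^sub>R Z \<omega>' + W \<omega>') \<bullet> F t \<omega>' (emat i j)) \<omega> =
      p * real_cond_exp M (H t) (\<lambda>\<omega>'. Z \<omega>' \<bullet> F t \<omega>' (emat i j)) \<omega>
        + real_cond_exp M (H t) (\<lambda>\<omega>'. W \<omega>' \<bullet> F t \<omega>' (emat i j)) \<omega>"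
    by (intro AE_finite_allI lin F_integrable t) auto
  moreover have "AE \<omega> in M. \<forall>i\<in>UNIV. \<forall>j\<in>UNIV.
      real_cond_exp M (H t) (\<lambda>\<omega>'. (p *\<^sub>R Z \<omega>' + W \<omega>') \<bullet> F t \<omega>' (- emat i j)) \<omega> =
      p * real_cond_exp M (H t) (\<lambda>\<omega>'. Z \<omega>' \<bullet> F t \<omega>' (- emat i j)) \<omega>
        + real_cond_exp M (H t) (\<lambda>\<omega>'. W \<omega>' \<bullet> F t \<omega>' (- emat i j)) \<omega>"
    by (intro AE_finite_allI lin F_integrable t) auto
  ultimately show ?thesis
  proof eventually_elim
    case (elim \<omega>)
    then show ?case
      by (simp add: R_def barF_def sum_distrib_left sum.distrib[symmetric] algebra_simps)
  qed
qed

lemma attainable_single: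
  assumes t: "t \<le> T" and \<eta>: "adm t \<eta>"
  shows "attainable 0 (\<lambda>\<omega>. G t \<omega> (\<eta> \<omega>))"
proof -
  define \<theta> where "\<theta> s = (if s = t then \<eta> else (\<lambda>_. 0))" for s
  have "attainable 0 (\<lambda>\<omega>. \<Sum>s=0..T. G s \<omega> (\<theta> s \<omega>))"
    using \<eta> by (intro attainable_strategy) (simp add: \<theta>_def adm_zero)
  also have "(\<lambda>\<omega>. \<Sum>s=0..T. G s \<omega> (\<theta> s \<omega>)) = (\<lambda>\<omega>. G t \<omega> (\<eta> \<omega>))"
  proof
    fix \<omega>
    have "(\<Sum>s=0..T. G s \<omega> (\<theta> s \<omega>)) = (\<Sum>s=0..T. if s = t then G t \<omega> (\<eta> \<omega>) else 0)"
      by (intro sum.cong) (auto simp: \<theta>_def)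
    then show "(\<Sum>s=0..T. G s \<omega> (\<theta> s \<omega>)) = G t \<omega> (\<eta> \<omega>)" using t by (simp add: sum.delta')
  qed
  finally show ?thesis .
qed

text \<open>The polar of the integrable attainable claims, cut to the unit ball. Strict positivity
  is left out on purpose: it will come from extremality and NA^w, and the set stays closed under
  countable combinations of total weight at most 1.\<close>

definition dual :: "('a \<Rightarrow> real^'d) \<Rightarrow> bool" where
  "dual Z \<longleftrightarrow> Z \<in> borel_measurable M \<and> (\<forall>\<omega>. norm (Z \<omega>) \<le> 1) \<and>
     (\<forall>X. attainable 0 X \<longrightarrow> integrable M X \<longrightarrow> (\<integral>\<omega>. Z \<omega> \<bullet> X \<omega> \<partial>M) \<le> 0)"

lemma dual_measurable: "dual Z \<Longrightarrow> Z \<in> borel_measurable M"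
  and dual_norm: "dual Z \<Longrightarrow> norm (Z \<omega>) \<le> 1"
  and dual_le: "dual Z \<Longrightarrow> attainable 0 X \<Longrightarrow> integrable M X \<Longrightarrow> (\<integral>\<omega>. Z \<omega> \<bullet> X \<omega> \<partial>M) \<le> 0"
  by (simp_all add: dual_def)

lemma dual_bounded_rv: "dual Z \<Longrightarrow> bounded_rv Z"
  unfolding dual_def bounded_rv_def by auto

lemma dual_inner_integrable: "dual Z \<Longrightarrow> integrable M X \<Longrightarrow> integrable M (\<lambda>\<omega>. Z \<omega> \<bullet> X \<omega>)"
  by (rule bounded_rv_inner_integrable[OF dual_bounded_rv])

lemma vec_nth_measurable:
  "X \<in> borel_measurable N \<Longrightarrow> (\<lambda>\<omega>. X \<omega> $ i) \<in> borel_measurable N" for X :: "_ \<Rightarrow> real^'n"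
  by (rule measurable_compose[of X N borel "\<lambda>a. a $ i"])
    (auto intro!: borel_measurable_continuous_onI continuous_intros)

text \<open>By free disposal, minus the i-th unit vector on the event {Z $ i < 0} is attainable; its
  pairing with Z is the negative part of Z $ i.\<close>

lemma dual_nonneg:
  assumes Z: "dual Z"
  shows "AE \<omega> in M. 0 \<le> Z \<omega>"
proof -
  note [measurable] = vec_nth_measurable[OF dual_measurable[OF Z]]
  have "AE \<omega> in M. 0 \<le> Z \<omega> $ i" for i
  proof -
    define X where "X \<omega> = - (if Z \<omega> $ i < 0 then axis i 1 else 0 :: real^'d)" for \<omega>
    have [measurable]: "X \<in> borel_measurable M" unfolding X_def by measurable
    have X_le: "X \<omega> \<le> 0" for \<omega> by (auto simp: X_def less_eq_vec_def axis_def)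
    have "attainable 0 X" by (rule attainable_mono[OF attainable_zero]) (auto simp: X_le)
    moreover have X_int: "integrable M X"
      by (rule integrable_const_bound[where B = 1]) (auto simp: X_def norm_axis_1)
    ultimately have "(\<integral>\<omega>. Z \<omega> \<bullet> X \<omega> \<partial>M) \<le> 0" using Z dual_le by blast
    moreover have ZX: "Z \<omega> \<bullet> X \<omega> = max (- (Z \<omega> $ i)) 0" for \<omega>
      by (auto simp: X_def inner_axis)
    have "0 \<le> (\<integral>\<omega>. Z \<omega> \<bullet> X \<omega> \<partial>M)" by (intro integral_nonneg_AE) (simp add: ZX)
    ultimately have "(\<integral>\<omega>. Z \<omega> \<bullet> X \<omega> \<partial>M) = 0" by linarith
    then have "AE \<omega> in M. Z \<omega> \<bullet> X \<omega> = 0"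
      using integral_nonneg_eq_0_iff_AE[OF dual_inner_integrable[OF Z X_int]] by (simp add: ZX)
    then show ?thesis by eventually_elim (auto simp: ZX max_def split: if_splits)
  qed
  then have "AE \<omega> in M. \<forall>i\<in>UNIV. 0 \<le> Z \<omega> $ i" by (intro AE_finite_allI) auto
  then show ?thesis by eventually_elim (simp add: less_eq_vec_def)
qed

text \<open>For fixed a, trade a only on the \<open>H t\<close>-event where the functional is
  positive: polarity makes this positive part vanish. A countable dense subset of \<open>A\<close>
  and continuity then give all a outside one null set.\<close>

lemma dual_R_nonpos:
  assumes Z: "dual Z" and t: "t \<le> T"
  shows "AE \<omega> in M. \<forall>a\<in>A. R t Z \<omega> a \<le> 0"
proof -
  have single: "AE \<omega> in M. R t Z \<omega> a \<le> 0" if a: "a \<in> A" for a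
  proof -
    have [measurable]: "(\<lambda>\<omega>. R t Z \<omega> a) \<in> borel_measurable (H t)" by (rule R_measurable[OF t]) simp
    define f where "f \<omega> = (if 0 < R t Z \<omega> a then 1 else 0 :: real)" for \<omega>
    have [measurable]: "f \<in> borel_measurable (H t)" unfolding f_def by measurable
    have adm: "adm t (\<lambda>\<omega>. f \<omega> *\<^sub>R a)"
      by (rule adm_scale[OF order_refl t _ _ adm_const[OF a]]) (auto simp: f_def)
    have bd: "norm (f \<omega> *\<^sub>R a) \<le> norm a" for \<omega> by (simp add: f_def)
    have "(\<integral>\<omega>. Z \<omega> \<bullet> G t \<omega> (f \<omega> *\<^sub>R a) \<partial>M) \<le> 0"
      by (intro dual_le Z attainable_single t adm G_integrable[OF t adm_measurable_M[OF t adm] bd])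
    then have le: "(\<integral>\<omega>. R t Z \<omega> (f \<omega> *\<^sub>R a) \<partial>M) \<le> 0"
      using expectation_inner_G(2)[OF t dual_bounded_rv[OF Z] adm_measurable[OF adm] bd] by simp
    have Rf: "R t Z \<omega> (f \<omega> *\<^sub>R a) = max (R t Z \<omega> a) 0" for \<omega> by (auto simp: f_def)
    have "0 \<le> (\<integral>\<omega>. R t Z \<omega> (f \<omega> *\<^sub>R a) \<partial>M)" by (intro integral_nonneg_AE) (simp add: Rf)
    with le have "(\<integral>\<omega>. R t Z \<omega> (f \<omega> *\<^sub>R a) \<partial>M) = 0" by linarith
    then have "AE \<omega> in M. R t Z \<omega> (f \<omega> *\<^sub>R a) = 0"
      using integral_nonneg_eq_0_iff_AE[OF expectation_inner_G(1)[OF t dual_bounded_rv[OF Z]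
            adm_measurable[OF adm] bd]] by (simp add: Rf)
    then show ?thesis by eventually_elim (auto simp: Rf max_def split: if_splits)
  qed
  obtain D where D: "countable D" "D \<subseteq> A" "A \<subseteq> closure D" by (rule separable)
  have "AE \<omega> in M. \<forall>a\<in>D. R t Z \<omega> a \<le> 0"
    using D single by (subst AE_ball_countable) auto
  then show ?thesis
  proof eventually_elim
    case (elim \<omega>)
    have "closed {a. R t Z \<omega> a \<le> 0}" by (intro closed_Collect_le continuous_R continuous_intros)
    with elim have "closure D \<subseteq> {a. R t Z \<omega> a \<le> 0}" by (intro closure_minimal) auto
    with D(3) show ?case by auto
  qed
qed

text \<open>The partial sums stay in the unit ball, so their pairings with an integrable claim X are
  dominated by the norm of X and the polar inequality passes to the limit.\<close>

lemma dual_series: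
  assumes Zs: "\<And>n. dual (Zs n)" and c: "\<And>n. 0 \<le> c n" "summable c" "suminf c \<le> 1"
  shows "dual (\<lambda>\<omega>. \<Sum>n. c n *\<^sub>R Zs n \<omega>)" and "summable (\<lambda>n. c n *\<^sub>R Zs n \<omega>)"
proof -
  have bd: "norm (c n *\<^sub>R Zs n \<omega>) \<le> c n" for n \<omega>
    using mult_left_mono[OF dual_norm[OF Zs, of n \<omega>] c(1)[of n]] c(1)[of n] by simp
  have sm: "summable (\<lambda>n. c n *\<^sub>R Zs n \<omega>)" for \<omega>
    by (rule summable_comparison_test'[OF c(2)]) (rule bd)
  then show "summable (\<lambda>n. c n *\<^sub>R Zs n \<omega>)" .
  note [measurable] = dual_measurable[OF Zs]
  define S where "S N \<omega> = (\<Sum>n<N. c n *\<^sub>R Zs n \<omega>)" for N \<omega>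
  define Z where "Z \<omega> = (\<Sum>n. c n *\<^sub>R Zs n \<omega>)" for \<omega>
  have S_Z: "(\<lambda>N. S N \<omega>) \<longlonglongrightarrow> Z \<omega>" for \<omega>
    unfolding S_def Z_def using sm by (rule summable_LIMSEQ)
  have [measurable]: "S N \<in> borel_measurable M" for N unfolding S_def by measurable
  have S1: "norm (S N \<omega>) \<le> 1" for N \<omega>
  proof -
    have "norm (S N \<omega>) \<le> (\<Sum>n<N. c n)" unfolding S_def using bd by (rule sum_norm_le)
    also have "\<dots> \<le> suminf c" using c by (intro sum_le_suminf) auto
    finally show ?thesis using c(3) by simp
  qed
  have Z_meas [measurable]: "Z \<in> borel_measurable M"
    by (rule borel_measurable_LIMSEQ_metric[OF _ S_Z]) measurable
  have Z1: "norm (Z \<omega>) \<le> 1" for \<omega>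
    by (rule LIMSEQ_le_const2[OF tendsto_norm[OF S_Z]]) (use S1 in auto)
  have "(\<integral>\<omega>. Z \<omega> \<bullet> X \<omega> \<partial>M) \<le> 0" if X: "attainable 0 X" "integrable M X" for X
  proof -
    have "(\<lambda>N. \<integral>\<omega>. S N \<omega> \<bullet> X \<omega> \<partial>M) \<longlonglongrightarrow> (\<integral>\<omega>. Z \<omega> \<bullet> X \<omega> \<partial>M)"
    proof (rule integral_dominated_convergence[where w = "\<lambda>\<omega>. norm (X \<omega>)"])
      show "AE \<omega> in M. (\<lambda>N. S N \<omega> \<bullet> X \<omega>) \<longlonglongrightarrow> Z \<omega> \<bullet> X \<omega>"
        by (intro AE_I2 tendsto_inner S_Z tendsto_const)
      show "AE \<omega> in M. norm (S N \<omega> \<bullet> X \<omega>) \<le> norm (X \<omega>)" for N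
      proof (rule AE_I2)
        fix \<omega>
        show "norm (S N \<omega> \<bullet> X \<omega>) \<le> norm (X \<omega>)"
          using Cauchy_Schwarz_ineq2[of "S N \<omega>" "X \<omega>"] mult_right_mono[OF S1[of N \<omega>], of "norm (X \<omega>)"]
          by simp
      qed
      have [measurable]: "X \<in> borel_measurable M" using X(2) by auto
      show "(\<lambda>\<omega>. S N \<omega> \<bullet> X \<omega>) \<in> borel_measurable M" "(\<lambda>\<omega>. Z \<omega> \<bullet> X \<omega>) \<in> borel_measurable M" for N
        by measurable
    qed (use X in auto)
    moreover have "(\<integral>\<omega>. S N \<omega> \<bullet> X \<omega> \<partial>M) \<le> 0" for N
    proof -
      have "(\<integral>\<omega>. S N \<omega> \<bullet> X \<omega> \<partial>M) = (\<Sum>n<N. c n * (\<integral>\<omega>. Zs n \<omega> \<bullet> X \<omega> \<partial>M))"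
        unfolding S_def inner_sum_left inner_scaleR_left
        by (subst Bochner_Integration.integral_sum) (auto intro: dual_inner_integrable Zs X)
      also have "\<dots> \<le> 0"
        by (intro sum_nonpos mult_nonneg_nonpos c dual_le[OF Zs] X)
      finally show ?thesis .
    qed
    ultimately show ?thesis by (intro LIMSEQ_le_const2) auto
  qed
  with Z1 Z_meas show "dual (\<lambda>\<omega>. \<Sum>n. c n *\<^sub>R Zs n \<omega>)"
    unfolding dual_def Z_def by auto
qed

lemma dual_zero: "dual (\<lambda>_. 0)"
  by (simp add: dual_def)

lemma dual_half:
  assumes "dual Z"
  shows "dual (\<lambda>\<omega>. (1/2) *\<^sub>R Z \<omega>)"
  unfolding dual_def
proof (intro conjI allI impI)
  show "norm ((1/2) *\<^sub>R Z \<omega>) \<le> 1" for \<omega> using dual_norm[OF assms, of \<omega>] by simp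
qed (use assms dual_measurable dual_le in auto)

lemma dual_midpoint:
  assumes "dual Z" "dual W"
  shows "dual (\<lambda>\<omega>. (1/2) *\<^sub>R Z \<omega> + (1/2) *\<^sub>R W \<omega>)"
  unfolding dual_def
proof (intro conjI allI impI)
  show "(\<lambda>\<omega>. (1/2) *\<^sub>R Z \<omega> + (1/2) *\<^sub>R W \<omega>) \<in> borel_measurable M"
    using assms[THEN dual_measurable] by measurable
  show "norm ((1/2) *\<^sub>R Z \<omega> + (1/2) *\<^sub>R W \<omega>) \<le> 1" for \<omega>
    using norm_triangle_ineq[of "(1/2) *\<^sub>R Z \<omega>" "(1/2) *\<^sub>R W \<omega>"]
      dual_norm[OF assms(1), of \<omega>] dual_norm[OF assms(2), of \<omega>] by simp
  fix X assume X: "attainable 0 X" "integrable M X"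
  show "(\<integral>\<omega>. ((1/2) *\<^sub>R Z \<omega> + (1/2) *\<^sub>R W \<omega>) \<bullet> X \<omega> \<partial>M) \<le> 0"
    using dual_le[OF assms(1) X] dual_le[OF assms(2) X] dual_inner_integrable[OF assms(1) X(2)]
      dual_inner_integrable[OF assms(2) X(2)]
    by (simp add: inner_add_left)
qed

text \<open>The remainder W is required to be dual again, because its sign on \<open>A\<close> is
  what makes the zero events of Z smaller than those of each summand.\<close>

lemma dual_countable_combination:
  assumes Zs: "\<And>n::nat. dual (Zs n)"
  obtains Z where "dual Z" "\<And>n. \<exists>p>0. \<exists>W. dual W \<and> Z = (\<lambda>\<omega>. p *\<^sub>R Zs n \<omega> + W \<omega>)"
proof
  define c where "c n = (1/2::real)^Suc n" for n
  have c_sums: "c sums 1" unfolding c_def by (rule power_half_series)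
  have c: "\<And>n. 0 \<le> c n" "summable c" "suminf c \<le> 1"
    using c_sums by (auto simp: c_def sums_iff)
  define Z where "Z \<omega> = (\<Sum>n. c n *\<^sub>R Zs n \<omega>)" for \<omega>
  show "dual Z" unfolding Z_def by (rule dual_series(1)[OF Zs c])
  show "\<exists>p>0. \<exists>W. dual W \<and> Z = (\<lambda>\<omega>. p *\<^sub>R Zs n \<omega> + W \<omega>)" for n
  proof (intro exI conjI)
    show "0 < c n" by (simp add: c_def)
    \<comment> \<open>Dropping the n-th weight keeps the total at most 1, so the rest of the series
      is itself dual.\<close>
    define c' where "c' m = (if m = n then 0 else c m)" for m
    have c': "\<And>m. 0 \<le> c' m" "summable c'" "suminf c' \<le> 1"
    proof -
      show "\<And>m. 0 \<le> c' m" using c by (simp add: c'_def)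
      show 1: "summable c'"
        by (rule summable_comparison_test'[OF c(2)]) (use c in \<open>simp add: c'_def\<close>)
      have "suminf c' \<le> suminf c" by (rule suminf_le[OF _ 1 c(2)]) (use c in \<open>simp add: c'_def\<close>)
      then show "suminf c' \<le> 1" using c by simp
    qed
    show "dual (\<lambda>\<omega>. \<Sum>m. c' m *\<^sub>R Zs m \<omega>)" by (rule dual_series(1)[OF Zs c'])
    show "Z = (\<lambda>\<omega>. c n *\<^sub>R Zs n \<omega> + (\<Sum>m. c' m *\<^sub>R Zs m \<omega>))"
    proof
      fix \<omega>
      have "(\<lambda>m. if m = n then c n *\<^sub>R Zs n \<omega> else 0) sums (c n *\<^sub>R Zs n \<omega>)"
        by (rule sums_single)
      moreover have "(\<lambda>m. c' m *\<^sub>R Zs m \<omega>) sums (\<Sum>m. c' m *\<^sub>R Zs m \<omega>)"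
        using dual_series(2)[OF Zs c'] by (rule summable_sums)
      ultimately have "(\<lambda>m. (if m = n then c n *\<^sub>R Zs n \<omega> else 0) + c' m *\<^sub>R Zs m \<omega>) sums
          (c n *\<^sub>R Zs n \<omega> + (\<Sum>m. c' m *\<^sub>R Zs m \<omega>))" by (rule sums_add)
      also have "(\<lambda>m. (if m = n then c n *\<^sub>R Zs n \<omega> else 0) + c' m *\<^sub>R Zs m \<omega>) = (\<lambda>m. c m *\<^sub>R Zs m \<omega>)"
        by (auto simp: c'_def)
      finally show "Z \<omega> = c n *\<^sub>R Zs n \<omega> + (\<Sum>m. c' m *\<^sub>R Zs m \<omega>)"
        unfolding Z_def by (rule sums_unique[symmetric])
    qed
  qed
qed

end


section \<open>Existence of an extremal dual variable\<close>

context integrable_market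
begin

lemma dual_separation:
  assumes "HN0 M H A F T" "KP M H A F T"
    and X: "integrable M X" "\<not> attainable 0 X"
  shows "\<exists>Z. dual Z \<and> 0 < (\<integral>\<omega>. Z \<omega> \<bullet> X \<omega> \<partial>M)"
proof -
  define C where "C = {X. attainable 0 X \<and> integrable M X}"
  have "\<exists>Z \<in> borel_measurable M. (\<forall>\<omega>. norm (Z \<omega>) \<le> 1) \<and>
      (\<forall>c\<in>C. (\<integral>\<omega>. Z \<omega> \<bullet> c \<omega> \<partial>M) \<le> 0) \<and> 0 < (\<integral>\<omega>. Z \<omega> \<bullet> X \<omega> \<partial>M)"
  proof (rule bounded_separation_of_closed_cone)
    show "(\<lambda>\<omega>. c \<omega> + c' \<omega>) \<in> C" if "c \<in> C" "c' \<in> C" for c c'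
      using that by (auto simp: C_def intro: attainable_add)
    show "(\<lambda>\<omega>. r *\<^sub>R c \<omega>) \<in> C" if "c \<in> C" "0 \<le> r" for c r
      using that attainable_scale[of 0 0 "\<lambda>_. r" c] by (auto simp: C_def)
    show "c \<in> C" if "\<And>n::nat. cs n \<in> C" "integrable M c" "AE \<omega> in M. (\<lambda>n. cs n \<omega>) \<longlonglongrightarrow> c \<omega>" for cs c
      using that attainable_closed[OF assms(1,2), of 0 cs c] by (auto simp: C_def)
  qed (use X attainable_zero in \<open>auto simp: C_def\<close>)
  then obtain Z where "Z \<in> borel_measurable M" "\<And>\<omega>. norm (Z \<omega>) \<le> 1"
    "\<And>c. c \<in> C \<Longrightarrow> (\<integral>\<omega>. Z \<omega> \<bullet> c \<omega> \<partial>M) \<le> 0" "0 < (\<integral>\<omega>. Z \<omega> \<bullet> X \<omega> \<partial>M)" by blast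
  then show ?thesis by (intro exI[of _ Z]) (auto simp: dual_def C_def)
qed

text \<open>The zero set of a continuous nonpositive function on \<open>A\<close> is determined by the countably many
  events that its supremum over a small ball vanishes. Minimising the probabilities of these events
  over all dual variables therefore minimises the zero set, although there may be uncountably many
  strategies to be separated.\<close>
definition near_zero :: "(real^'d^'d) set \<Rightarrow> nat \<Rightarrow> real^'d^'d \<Rightarrow> nat \<Rightarrow> ('a \<Rightarrow> real^'d) \<Rightarrow> 'a \<Rightarrow> bool" where
  "near_zero D t c m Z \<omega> \<longleftrightarrow> (\<forall>l::nat. \<exists>a\<in>D. dist a c < 1 / Suc m \<and> - 1 / Suc l < R t Z \<omega> a)"

lemma near_zero_measurable:
  assumes "t \<le> T" and "countable D"
  shows "Measurable.pred M (near_zero D t c m Z)"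
proof -
  have [measurable]: "(\<lambda>\<omega>. R t Z \<omega> a) \<in> borel_measurable M" for a
    using R_measurable[OF assms(1), of "\<lambda>_. a" Z] by (intro H_measurable_M[OF assms(1)]) simp
  have [measurable]: "Measurable.pred M (\<lambda>\<omega>. \<exists>a\<in>D. dist a c < 1 / Suc m \<and> - 1 / Suc l < R t Z \<omega> a)"
    for l :: nat
    unfolding pred_def by (rule sets.sets_Collect_countable_Ex'[OF _ assms(2)]) measurable
  show ?thesis unfolding near_zero_def by measurable
qed

text \<open>On \<open>A\<close> the functional of W is nonpositive, so that of p Z + W is at most p
  times that of Z. Almost vanishing therefore passes from the combination to the summand, with the
  tolerance adjusted by the factor p.\<close>

lemma near_zero_anti:
  assumes t: "t \<le> T" and D: "D \<subseteq> A" and Z: "dual Z" and W: "dual W" and p: "0 < p"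
  shows "AE \<omega> in M. near_zero D t c m (\<lambda>\<omega>. p *\<^sub>R Z \<omega> + W \<omega>) \<omega> \<longrightarrow> near_zero D t c m Z \<omega>"
  using R_linear[OF t dual_bounded_rv[OF Z] dual_bounded_rv[OF W], of p] dual_R_nonpos[OF W t]
proof eventually_elim
  case (elim \<omega>)
  show ?case
    unfolding near_zero_def
  proof (intro impI allI)
    fix l :: nat
    assume near: "\<forall>l::nat. \<exists>a\<in>D. dist a c < 1 / Suc m
        \<and> - 1 / Suc l < R t (\<lambda>\<omega>. p *\<^sub>R Z \<omega> + W \<omega>) \<omega> a"
    obtain l' where l': "1 / real (Suc l') < p / real (Suc l)"
      using p nat_approx_posE[of "p / real (Suc l)"] by auto
    obtain a where a: "a \<in> D" "dist a c < 1 / Suc m"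
      "- 1 / real (Suc l') < R t (\<lambda>\<omega>. p *\<^sub>R Z \<omega> + W \<omega>) \<omega> a" using near by blast
    have "R t (\<lambda>\<omega>. p *\<^sub>R Z \<omega> + W \<omega>) \<omega> a \<le> p * R t Z \<omega> a"
      using elim a(1) D by auto
    with a(3) l' have "p * (- 1 / real (Suc l)) < p * R t Z \<omega> a" by simp
    then have "- 1 / real (Suc l) < R t Z \<omega> a" using p by (simp only: mult_less_cancel_left_pos)
    with a show "\<exists>a\<in>D. dist a c < 1 / Suc m \<and> - 1 / Suc l < R t Z \<omega> a" by blast
  qed
qed

lemma near_zero_if_zero:
  assumes D: "A \<subseteq> closure D" and a: "a \<in> A" "R t Z \<omega> a = 0" "dist a c < 1 / Suc m"
  shows "near_zero D t c m Z \<omega>"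
  unfolding near_zero_def
proof
  fix l :: nat
  define U where "U = {x. dist x c < 1 / Suc m} \<inter> {x. - 1 / Suc l < R t Z \<omega> x}"
  have "open U" unfolding U_def
    by (intro open_Int open_Collect_less continuous_intros continuous_R)
  moreover have "a \<in> U" using a by (simp add: U_def)
  ultimately have "U \<inter> D \<noteq> {}"
    using D a(1) open_Int_closure_eq_empty[of U D] by blast
  then show "\<exists>a\<in>D. dist a c < 1 / Suc m \<and> - 1 / Suc l < R t Z \<omega> a" by (auto simp: U_def)
qed

text \<open>If the value at a were -2 e < 0, then by continuity the functional would stay below -e
  on a ball around a. A ball of small radius with centre c in D close to a lies inside it, against
  \<open>near_zero\<close> for c.\<close>

lemma zero_if_near_zero:
  assumes D: "A \<subseteq> closure D" and a: "a \<in> A"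
    and le: "R t Z \<omega> a \<le> 0"
    and near: "\<And>c m. c \<in> D \<Longrightarrow> dist a c < 1 / Suc m \<Longrightarrow> near_zero D t c m Z \<omega>"
  shows "R t Z \<omega> a = 0"
proof (rule ccontr)
  assume "R t Z \<omega> a \<noteq> 0"
  define e where "e = - R t Z \<omega> a / 2"
  have e: "e > 0" using le \<open>R t Z \<omega> a \<noteq> 0\<close> by (simp add: e_def)
  have "isCont (R t Z \<omega>) a" using continuous_R by (simp add: continuous_on_eq_continuous_at)
  then obtain d where d: "d > 0" "\<And>x. dist x a < d \<Longrightarrow> dist (R t Z \<omega> x) (R t Z \<omega> a) < e"
    using e unfolding continuous_at_eps_delta by blast
  obtain m where m: "1 / real (Suc m) < d / 2" using d(1) nat_approx_posE[of "d / 2"] by auto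
  obtain c where c: "c \<in> D" "dist c a < 1 / Suc m"
    using D a unfolding closure_approachable by (metis subsetD closure_approachable of_nat_0_less_iff
        zero_less_Suc zero_less_divide_1_iff)
  obtain l where l: "1 / real (Suc l) < e" using e nat_approx_posE by blast
  obtain x where x: "dist x c < 1 / Suc m" "- 1 / real (Suc l) < R t Z \<omega> x"
    using near[OF c(1), of m] c(2) unfolding near_zero_def by (metis dist_commute)
  have "dist x a < d" using dist_triangle[of x a c] x(1) c(2) m by linarith
  then have "\<bar>R t Z \<omega> x - R t Z \<omega> a\<bar> < e" using d(2) by (simp add: dist_real_def)
  then have "R t Z \<omega> x < - e" by (simp add: e_def abs_less_iff)
  with x(2) l show False by simp
qed

text \<open>The minimiser is compared only with dual variables whose events are smaller. The
  midpoint with an arbitrary W is such a variable, and its events are also contained in those of W;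
  this makes Z extremal against every W.\<close>

lemma exists_extremal_dual:
  obtains Z where "dual Z"
    "\<And>W i. dual W \<Longrightarrow> AE \<omega> in M. Z \<omega> $ i \<le> 0 \<longrightarrow> W \<omega> $ i \<le> 0"
    "\<And>W t. dual W \<Longrightarrow> t \<le> T \<Longrightarrow> AE \<omega> in M. \<forall>a\<in>A. R t Z \<omega> a = 0 \<longrightarrow> R t W \<omega> a = 0"
proof -
  obtain D where D: "countable D" "D \<subseteq> A" "A \<subseteq> closure D" by (rule separable)
  define E where "E = (\<lambda>k (Z :: 'a \<Rightarrow> real^'d) \<omega>.
      case k of Inl i \<Rightarrow> Z \<omega> $ i \<le> 0 | Inr (t, c, m) \<Rightarrow> near_zero D t c m Z \<omega>)"
  \<comment> \<open>Coordinates account for strict positivity; triples of a date, a centre from a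
    countable dense subset of \<open>A\<close> and a radius account for the zero sets.\<close>
  define I where "I = range (Inl :: 'd \<Rightarrow> _) \<union> Inr ` ({..T} \<times> D \<times> (UNIV :: nat set))"
  have I: "countable I"
    unfolding I_def using D(1)
    by (intro countable_Un countable_image[of _ Inr] countable_SIGMA countable_finite[of "range Inl"]) auto
  have E_anti: "AE \<omega> in M. E k (\<lambda>\<omega>. p *\<^sub>R Z \<omega> + W \<omega>) \<omega> \<longrightarrow> E k Z \<omega>"
    if "k \<in> I" "dual Z" "dual W" "0 < p" for k Z W p
  proof (cases k)
    case (Inl i)
    show ?thesis
      using dual_nonneg[OF that(3)]
    proof eventually_elim
      case (elim \<omega>)
      have "p * Z \<omega> $ i \<le> 0" if "p * Z \<omega> $ i + W \<omega> $ i \<le> 0"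
        using elim that by (auto simp: less_eq_vec_def intro: order_trans[rotated])
      then show ?case using that(4) by (auto simp: E_def Inl mult_le_0_iff)
    qed
  next
    case (Inr x)
    then obtain t c m where "x = (t, c, m)" "t \<le> T"
      using \<open>k \<in> I\<close> Inr by (auto simp: I_def)
    then show ?thesis
      using near_zero_anti[OF _ D(2) that(2,3,4), of t c m] by (simp add: E_def Inr)
  qed
  have "\<exists>z\<in>{Z. dual Z}. \<forall>z'\<in>{Z. dual Z}. \<forall>k\<in>I.
      (AE \<omega> in M. E k z' \<omega> \<longrightarrow> E k z \<omega>) \<longrightarrow> (AE \<omega> in M. E k z \<omega> \<longrightarrow> E k z' \<omega>)"
  proof (rule simultaneous_minimiser)
    show "{Z. dual Z} \<noteq> {}" using dual_zero by blast
    show "countable I" by (rule I)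
    show "Measurable.pred M (E k Z)" if "k \<in> I" "Z \<in> {Z. dual Z}" for k Z
    proof (cases k)
      case (Inl i)
      have [measurable]: "(\<lambda>\<omega>. Z \<omega> $ i) \<in> borel_measurable M"
        using that by (auto intro: vec_nth_measurable dual_measurable)
      show ?thesis by (simp add: E_def Inl)
    next
      case (Inr x)
      then obtain t c m where "x = (t, c, m)" "t \<le> T"
      using \<open>k \<in> I\<close> Inr by (auto simp: I_def)
      then show ?thesis using near_zero_measurable[OF _ D(1)] by (simp add: E_def Inr)
    qed
    show "\<exists>z\<in>{Z. dual Z}. \<forall>n. \<forall>k\<in>I. AE \<omega> in M. E k z \<omega> \<longrightarrow> E k (Zs n) \<omega>"
      if Zs: "\<And>n. Zs n \<in> {Z. dual Z}" for Zs :: "nat \<Rightarrow> _"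
    proof -
      have dZs: "dual (Zs n)" for n using Zs by simp
      obtain Z where Z: "dual Z" "\<And>n. \<exists>p>0. \<exists>W. dual W \<and> Z = (\<lambda>\<omega>. p *\<^sub>R Zs n \<omega> + W \<omega>)"
        using dual_countable_combination[of Zs, OF dZs] by blast
      have "AE \<omega> in M. E k Z \<omega> \<longrightarrow> E k (Zs n) \<omega>" if "k \<in> I" for k n
        using Z(2)[of n] E_anti[OF that dZs[of n]] by auto
      with Z(1) show ?thesis by blast
    qed
  qed
  then obtain Z where Z: "dual Z" and
    Z_min: "\<And>W k. dual W \<Longrightarrow> k \<in> I \<Longrightarrow> AE \<omega> in M. E k W \<omega> \<longrightarrow> E k Z \<omega> \<Longrightarrow>
      AE \<omega> in M. E k Z \<omega> \<longrightarrow> E k W \<omega>" by blast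
  have E_le: "AE \<omega> in M. E k Z \<omega> \<longrightarrow> E k W \<omega>" if W: "dual W" and k: "k \<in> I" for W k
  proof -
    define V where "V = (\<lambda>\<omega>. (1/2) *\<^sub>R Z \<omega> + (1/2) *\<^sub>R W \<omega>)"
    have V: "dual V" unfolding V_def using Z W by (rule dual_midpoint)
    have "AE \<omega> in M. E k V \<omega> \<longrightarrow> E k Z \<omega>"
      unfolding V_def by (rule E_anti[OF k Z dual_half[OF W]]) simp
    then have 1: "AE \<omega> in M. E k Z \<omega> \<longrightarrow> E k V \<omega>" by (rule Z_min[OF V k])
    have "V = (\<lambda>\<omega>. (1/2) *\<^sub>R W \<omega> + (1/2) *\<^sub>R Z \<omega>)" by (simp add: V_def add.commute)
    then have "AE \<omega> in M. E k V \<omega> \<longrightarrow> E k W \<omega>"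
      using E_anti[OF k W dual_half[OF Z], of "1/2"] by simp
    with 1 show ?thesis by eventually_elim blast
  qed
  show thesis
  proof (rule that[OF Z])
    show "AE \<omega> in M. Z \<omega> $ i \<le> 0 \<longrightarrow> W \<omega> $ i \<le> 0" if "dual W" for W i
      using E_le[OF that, of "Inl i"] by (simp add: I_def E_def)
    show "AE \<omega> in M. \<forall>a\<in>A. R t Z \<omega> a = 0 \<longrightarrow> R t W \<omega> a = 0" if W: "dual W" and t: "t \<le> T" for W t
    proof -
      have "AE \<omega> in M. near_zero D t c m Z \<omega> \<longrightarrow> near_zero D t c m W \<omega>" if "c \<in> D" for c m
        using E_le[OF W, of "Inr (t, c, m)"] that t by (simp add: I_def E_def)
      then have "AE \<omega> in M. \<forall>c\<in>D. \<forall>m. near_zero D t c m Z \<omega> \<longrightarrow> near_zero D t c m W \<omega>"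
        using D(1) by (simp add: AE_ball_countable AE_all_countable)
      with dual_R_nonpos[OF W t] show ?thesis
      proof eventually_elim
        case (elim \<omega>)
        show ?case
        proof (intro ballI impI)
          fix a assume a: "a \<in> A" "R t Z \<omega> a = 0"
          have le: "R t W \<omega> a \<le> 0" using elim(1) a(1) by blast
          show "R t W \<omega> a = 0"
            by (rule zero_if_near_zero[OF D(3) a(1) le])
              (use elim(2) near_zero_if_zero[OF D(3) a] in blast)
        qed
      qed
    qed
  qed
qed

theorem NAw_imp_inD:
  assumes HN0: "HN0 M H A F T" and KP: "KP M H A F T" and NAw: "NAw M H A F T"
  shows "\<exists>Z. inD M H A F T Z"
proof -
  obtain Z where Z: "dual Z"
    and Z_pos: "\<And>W i. dual W \<Longrightarrow> AE \<omega> in M. Z \<omega> $ i \<le> 0 \<longrightarrow> W \<omega> $ i \<le> 0"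
    and Z_zero: "\<And>W t. dual W \<Longrightarrow> t \<le> T \<Longrightarrow> AE \<omega> in M. \<forall>a\<in>A. R t Z \<omega> a = 0 \<longrightarrow> R t W \<omega> a = 0"
    using exists_extremal_dual by blast
  note [measurable] = vec_nth_measurable[OF dual_measurable[OF Z]]
  have pos: "AE \<omega> in M. 0 < Z \<omega> $ i" for i
  proof -
    \<comment> \<open>If this claim were not attainable, a separating dual variable would charge the
      event {Z $ i \<le> 0}, against extremality. Attainable and nonnegative, it vanishes by
      NA^w.\<close>
    define X where "X \<omega> = (if Z \<omega> $ i \<le> 0 then axis i 1 else 0 :: real^'d)" for \<omega>
    have [measurable]: "X \<in> borel_measurable M" unfolding X_def by measurable
    have X_int: "integrable M X"
      by (rule integrable_const_bound[where B = 1]) (auto simp: X_def norm_axis_1)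
    have X0: "nonneg_vec (X \<omega>)" for \<omega> by (simp add: X_def nonneg_vec_def axis_def)
    have "attainable 0 X"
    proof (rule ccontr)
      assume "\<not> attainable 0 X"
      then obtain W where W: "dual W" "0 < (\<integral>\<omega>. W \<omega> \<bullet> X \<omega> \<partial>M)"
        using dual_separation[OF HN0 KP X_int] by blast
      have "AE \<omega> in M. W \<omega> \<bullet> X \<omega> \<le> 0"
        using Z_pos[OF W(1), of i] by eventually_elim (simp add: X_def inner_axis)
      then have "(\<integral>\<omega>. W \<omega> \<bullet> X \<omega> \<partial>M) \<le> (\<integral>\<omega>. 0 \<partial>M)"
        by (intro integral_mono_AE dual_inner_integrable W X_int) auto
      with W(2) show False by simp
    qed
    then have "AE \<omega> in M. X \<omega> = 0"
      using NAw X0 attainable_inAT unfolding NAw_def by auto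
    then show ?thesis
      by eventually_elim (auto simp: X_def axis_eq_0_iff not_le split: if_splits)
  qed
  have D1: "AE \<omega> in M. barF M H F t \<eta> Z \<omega> \<le> 0" if "t \<le> T" "adm t \<eta>" for t \<eta>
    using dual_R_nonpos[OF Z that(1)] adm_AE[OF that(2)]
    by eventually_elim (simp add: barF_eq_R)
  have D2: "inN0 M H A F t (\<lambda>\<omega>. if barF M H F t \<eta> Z \<omega> = 0 then F t \<omega> (\<eta> \<omega>) else 0)"
    if t: "t \<le> T" and \<eta>: "adm t \<eta>" for t \<eta>
  proof -
    note [measurable] = adm_measurable[OF \<eta>] R_measurable[OF t adm_measurable[OF \<eta>], of Z]
    \<comment> \<open>The zero event lies in \<open>H t\<close>, so the position may be restricted
      to it; division by 1 + norm \<eta> makes its value integrable, as separation requires.\<close>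
    define f where "f \<omega> = (if R t Z \<omega> (\<eta> \<omega>) = 0 then 1 / (1 + norm (\<eta> \<omega>)) else 0)" for \<omega>
    have f_meas [measurable]: "f \<in> borel_measurable (H t)" unfolding f_def by measurable
    have f0: "0 \<le> f \<omega>" for \<omega> by (simp add: f_def)
    define \<theta> where "\<theta> \<omega> = f \<omega> *\<^sub>R \<eta> \<omega>" for \<omega>
    have adm_\<theta>: "adm t \<theta>"
      unfolding \<theta>_def by (rule adm_scale[OF order_refl t f_meas f0 \<eta>])
    have \<theta>1: "norm (\<theta> \<omega>) \<le> 1" for \<omega>
    proof -
      have "norm (\<eta> \<omega>) / (1 + norm (\<eta> \<omega>)) \<le> 1"
        by (subst divide_le_eq_1_pos) (auto intro: add_pos_nonneg)
      then show ?thesis by (simp add: \<theta>_def f_def)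
    qed
    have int: "integrable M (\<lambda>\<omega>. G t \<omega> (\<theta> \<omega>))"
      by (rule G_integrable[OF t adm_measurable_M[OF t adm_\<theta>] \<theta>1])
    \<comment> \<open>By extremality every dual variable has zero mean on this claim, so none
      separates it from the attainable ones.\<close>
    have "attainable 0 (\<lambda>\<omega>. - G t \<omega> (\<theta> \<omega>))"
    proof (rule ccontr)
      assume "\<not> attainable 0 (\<lambda>\<omega>. - G t \<omega> (\<theta> \<omega>))"
      then obtain W where W: "dual W" "0 < (\<integral>\<omega>. W \<omega> \<bullet> - G t \<omega> (\<theta> \<omega>) \<partial>M)"
        using dual_separation[OF HN0 KP, of "\<lambda>\<omega>. - G t \<omega> (\<theta> \<omega>)"] int by auto
      have "AE \<omega> in M. R t W \<omega> (\<theta> \<omega>) = 0"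
        using Z_zero[OF W(1) t] adm_AE[OF \<eta>]
      proof eventually_elim
        case (elim \<omega>)
        then show ?case using R_scale[OF f0[of \<omega>], of t W \<omega> "\<eta> \<omega>"] by (auto simp: \<theta>_def f_def)
      qed
      then have "(\<integral>\<omega>. R t W \<omega> (\<theta> \<omega>) \<partial>M) = 0" by (rule integral_eq_zero_AE)
      then have "(\<integral>\<omega>. W \<omega> \<bullet> G t \<omega> (\<theta> \<omega>) \<partial>M) = 0"
        using expectation_inner_G(2)[OF t dual_bounded_rv[OF W(1)] adm_measurable[OF adm_\<theta>] \<theta>1] by simp
      with W(2) show False by simp
    qed
    then obtain \<zeta> where \<zeta>: "\<And>s. s \<le> T \<Longrightarrow> adm s (\<zeta> s)"
      and le: "AE \<omega> in M. - G t \<omega> (\<theta> \<omega>) \<le> (\<Sum>s=0..T. G s \<omega> (\<zeta> s \<omega>))"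
      unfolding attainable_def by auto
    define \<xi> where "\<xi> s = (if s = t then \<theta> else (\<lambda>_. 0))" for s
    have \<xi>: "adm s (\<xi> s)" for s using adm_\<theta> by (simp add: \<xi>_def adm_zero)
    have \<xi>_sum: "(\<Sum>s=0..T. G s \<omega> (\<xi> s \<omega>)) = G t \<omega> (\<theta> \<omega>)" for \<omega>
    proof -
      have "(\<Sum>s=0..T. G s \<omega> (\<xi> s \<omega>)) = (\<Sum>s=0..T. if s = t then G t \<omega> (\<theta> \<omega>) else 0)"
        by (intro sum.cong) (auto simp: \<xi>_def)
      then show ?thesis using t by (simp add: sum.delta')
    qed
    have sum0: "AE \<omega> in M. 0 \<le> (\<Sum>s=0..T. G s \<omega> (\<xi> s \<omega>)) + (\<Sum>s=0..T. G s \<omega> (\<zeta> s \<omega>))"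
      using le unfolding \<xi>_sum
    proof eventually_elim
      case (elim \<omega>)
      then show ?case using add_left_mono[OF elim, of "G t \<omega> (\<theta> \<omega>)"] by simp
    qed
    have neg: "adm t (\<lambda>\<omega>. - \<theta> \<omega>)" "AE \<omega> in M. G t \<omega> (- \<theta> \<omega>) = - G t \<omega> (\<theta> \<omega>)"
      using offsetting_strategies(3,4)[OF HN0 KP \<xi> \<zeta> sum0, of t] t by (simp_all add: \<xi>_def)
    \<comment> \<open>The normalisation is undone: \<open>h\<close> is \<open>H t\<close>-measurable
      and nonnegative, so \<theta> and its reversal can both be rescaled.\<close>
    define h where "h \<omega> = 1 + norm (\<eta> \<omega>)" for \<omega>
    have h_meas: "h \<in> borel_measurable (H t)" unfolding h_def by measurable
    have h0: "0 \<le> h \<omega>" for \<omega> by (simp add: h_def)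
    have adm_h: "adm t (\<lambda>\<omega>. h \<omega> *\<^sub>R \<theta> \<omega>)" "adm t (\<lambda>\<omega>. h \<omega> *\<^sub>R - \<theta> \<omega>)"
      by (rule adm_scale[OF order_refl t h_meas h0], rule adm_\<theta> neg(1))+
    have h\<theta>: "h \<omega> *\<^sub>R \<theta> \<omega> = (if barF M H F t \<eta> Z \<omega> = 0 then \<eta> \<omega> else 0)" for \<omega>
    proof -
      have "1 + norm (\<eta> \<omega>) \<noteq> 0" using norm_ge_zero[of "\<eta> \<omega>"] by linarith
      then show ?thesis by (simp add: h_def \<theta>_def f_def barF_eq_R)
    qed
    have "AE \<omega> in M. G t \<omega> (h \<omega> *\<^sub>R \<theta> \<omega>) = (if barF M H F t \<eta> Z \<omega> = 0 then F t \<omega> (\<eta> \<omega>) else 0)"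
      using F_eq_G[OF t] by eventually_elim (simp add: h\<theta>)
    moreover have "AE \<omega> in M. G t \<omega> (h \<omega> *\<^sub>R - \<theta> \<omega>)
        = - (if barF M H F t \<eta> Z \<omega> = 0 then F t \<omega> (\<eta> \<omega>) else 0)"
      using calculation neg(2)
    proof eventually_elim
      case (elim \<omega>)
      have "G t \<omega> (h \<omega> *\<^sub>R - \<theta> \<omega>) = - G t \<omega> (h \<omega> *\<^sub>R \<theta> \<omega>)"
        by (simp only: G_scale[OF h0] elim(2)) simp
      then show ?case by (simp only: elim(1))
    qed
    ultimately show ?thesis
      unfolding inN0_def
      using inN_cong[OF _ inN_G[OF t adm_h(1)]] inN_cong[OF _ inN_G[OF t adm_h(2)]] by simp
  qed
  have "\<exists>C. AE \<omega> in M. norm (Z \<omega>) \<le> C" using dual_norm[OF Z] by auto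
  then show ?thesis
    unfolding inD_def using dual_measurable[OF Z] pos D1 D2 by (intro exI[of _ Z]) auto
qed

lemma supermartingale_tail:
  assumes Z: "bounded_rv Z"
    and D1: "\<And>t \<eta>. t \<le> T \<Longrightarrow> adm t \<eta> \<Longrightarrow> AE \<omega> in M. R t Z \<omega> (\<eta> \<omega>) \<le> 0"
    and "t \<le> Suc T" and "integrable M W"
    and "\<And>s. s \<le> T \<Longrightarrow> adm s (\<eta> s)"
    and "AE \<omega> in M. 0 \<le> W \<omega> + (\<Sum>s=t..T. Z \<omega> \<bullet> G s \<omega> (\<eta> s \<omega>))"
  shows "0 \<le> (\<integral>\<omega>. W \<omega> \<partial>M)"
  using assms(3-)
proof (induction arbitrary: W \<eta> rule: inc_induct)
  case base
  then show ?case by (intro integral_nonneg_AE) auto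
next
  case (step t)
  then have t: "t \<le> T" by simp
  note adm_t = step.prems(2)[OF t]
  have [measurable]: "\<eta> t \<in> borel_measurable (H t)" using adm_t by (rule adm_measurable)
  have [measurable]: "\<eta> t \<in> borel_measurable M" using adm_t by (rule adm_measurable_M[OF t])
  have [measurable]: "W \<in> borel_measurable M" using step.prems(1) by auto
  define f where "f n \<omega> = (if norm (\<eta> t \<omega>) \<le> real n then 1 else 0 :: real)" for n \<omega>
  have f_meas: "f n \<in> borel_measurable (H t)" for n unfolding f_def by measurable
  have [measurable]: "f n \<in> borel_measurable M" for n unfolding f_def by measurable
  have f0: "0 \<le> f n \<omega>" for n \<omega> by (simp add: f_def)
  have "0 \<le> (\<integral>\<omega>. f n \<omega> * W \<omega> \<partial>M)" for n
  proof -
    \<comment> \<open>The truncation is known at date t, so it may multiply all later positions as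
      well; by homogeneity the whole inequality is multiplied by \<open>f n\<close>.\<close>
    define \<theta> where "\<theta> s = (if t \<le> s then (\<lambda>\<omega>. f n \<omega> *\<^sub>R \<eta> s \<omega>) else (\<lambda>_. 0))" for s
    have adm_\<theta>: "adm s (\<theta> s)" if "s \<le> T" for s
      using adm_scale[OF _ that f_meas f0 step.prems(2)[OF that]] by (simp add: \<theta>_def adm_zero)
    have bd: "norm (\<theta> t \<omega>) \<le> n" for \<omega> by (simp add: \<theta>_def f_def)
    have fW: "integrable M (\<lambda>\<omega>. f n \<omega> * W \<omega>)"
      using integrable_scaleR_bounded[OF step.prems(1), of "f n" 1] by (simp add: f_def)
    have ZG: "integrable M (\<lambda>\<omega>. Z \<omega> \<bullet> G t \<omega> (\<theta> t \<omega>))"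
      by (intro bounded_rv_inner_integrable[OF Z] G_integrable[OF t adm_measurable_M[OF t adm_\<theta>[OF t]] bd])
    have "0 \<le> (\<integral>\<omega>. f n \<omega> * W \<omega> + Z \<omega> \<bullet> G t \<omega> (\<theta> t \<omega>) \<partial>M)"
    proof (rule step.IH[OF _ adm_\<theta>])
      show "AE \<omega> in M. 0 \<le> f n \<omega> * W \<omega> + Z \<omega> \<bullet> G t \<omega> (\<theta> t \<omega>)
          + (\<Sum>s=Suc t..T. Z \<omega> \<bullet> G s \<omega> (\<theta> s \<omega>))"
        using step.prems(3)
      proof eventually_elim
        case (elim \<omega>)
        have "(\<Sum>s=t..T. Z \<omega> \<bullet> G s \<omega> (\<theta> s \<omega>)) = f n \<omega> * (\<Sum>s=t..T. Z \<omega> \<bullet> G s \<omega> (\<eta> s \<omega>))"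
          by (simp add: \<theta>_def G_scale[OF f0] sum_distrib_left)
        then have "f n \<omega> * W \<omega> + Z \<omega> \<bullet> G t \<omega> (\<theta> t \<omega>) + (\<Sum>s=Suc t..T. Z \<omega> \<bullet> G s \<omega> (\<theta> s \<omega>))
            = f n \<omega> * (W \<omega> + (\<Sum>s=t..T. Z \<omega> \<bullet> G s \<omega> (\<eta> s \<omega>)))"
          using sum.atLeast_Suc_atMost[OF t, of "\<lambda>s. Z \<omega> \<bullet> G s \<omega> (\<theta> s \<omega>)"]
          by (simp add: distrib_left)
        then show ?case using elim f0[of n \<omega>] by simp
      qed
    qed (use fW ZG in auto)
    also have "\<dots> = (\<integral>\<omega>. f n \<omega> * W \<omega> \<partial>M) + (\<integral>\<omega>. R t Z \<omega> (\<theta> t \<omega>) \<partial>M)"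
      using fW ZG expectation_inner_G(2)[OF t Z adm_measurable[OF adm_\<theta>[OF t]] bd] by simp
    also have "(\<integral>\<omega>. R t Z \<omega> (\<theta> t \<omega>) \<partial>M) \<le> (\<integral>\<omega>. 0 \<partial>M)"
      by (intro integral_mono_AE expectation_inner_G(1)[OF t Z adm_measurable[OF adm_\<theta>[OF t]] bd]
          D1[OF t adm_\<theta>[OF t]]) auto
    finally show ?thesis by simp
  qed
  \<comment> \<open>The date t term is gone before n tends to infinity, so dominating
    \<open>W\<close> alone is enough.\<close>
  moreover have "(\<lambda>n. \<integral>\<omega>. f n \<omega> * W \<omega> \<partial>M) \<longlonglongrightarrow> (\<integral>\<omega>. W \<omega> \<partial>M)"
  proof (rule integral_dominated_convergence[where w = "\<lambda>\<omega>. norm (W \<omega>)"])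
    show "AE \<omega> in M. (\<lambda>n. f n \<omega> * W \<omega>) \<longlonglongrightarrow> W \<omega>"
    proof (rule AE_I2)
      fix \<omega>
      obtain m :: nat where "norm (\<eta> t \<omega>) \<le> m" using real_arch_simple by blast
      then have "\<forall>n\<ge>m. f n \<omega> * W \<omega> = W \<omega>" by (auto simp: f_def)
      then show "(\<lambda>n. f n \<omega> * W \<omega>) \<longlonglongrightarrow> W \<omega>"
        by (intro tendsto_eventually) (auto simp: eventually_sequentially)
    qed
    show "AE \<omega> in M. norm (f n \<omega> * W \<omega>) \<le> norm (W \<omega>)" for n by (simp add: f_def)
  qed (use step.prems(1) in auto)
  ultimately show ?case by (intro LIMSEQ_le_const) auto
qed

theorem inD_imp_NAw:
  assumes D: "inD M H A F T Z"
  shows "NAw M H A F T"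
proof -
  have Z: "bounded_rv Z" and Z_pos: "\<And>i. AE \<omega> in M. 0 < Z \<omega> $ i"
    using D unfolding inD_def bounded_rv_def by auto
  have D1: "AE \<omega> in M. R t Z \<omega> (\<eta> \<omega>) \<le> 0" if t: "t \<le> T" and \<eta>: "adm t \<eta>" for t \<eta>
  proof -
    \<comment> \<open>\<open>inD\<close> quantifies over whole processes; a single position is
      padded with zeros.\<close>
    define \<theta> where "\<theta> s = (if s = t then \<eta> else (\<lambda>_. 0))" for s
    have "\<forall>s\<le>T. adm s (\<theta> s)" using \<eta> by (simp add: \<theta>_def adm_zero)
    then have "AE \<omega> in M. barF M H F t (\<theta> t) Z \<omega> \<le> 0" using D t unfolding inD_def by blast
    then show ?thesis by (simp add: barF_eq_R \<theta>_def)
  qed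
  have Zp: "AE \<omega> in M. \<forall>i\<in>UNIV. 0 < Z \<omega> $ i" using Z_pos by (intro AE_finite_allI) auto
  have "AE \<omega> in M. X \<omega> = 0"
    if X: "X \<in> borel_measurable M" and att: "attainable 0 X" and pos: "AE \<omega> in M. nonneg_vec (X \<omega>)" for X
  proof -
    obtain \<eta> where \<eta>: "\<And>s. s \<le> T \<Longrightarrow> adm s (\<eta> s)"
      and le: "AE \<omega> in M. X \<omega> \<le> (\<Sum>s=0..T. G s \<omega> (\<eta> s \<omega>))"
      using att unfolding attainable_def by auto
    have [measurable]: "Z \<in> borel_measurable M" using Z by (simp add: bounded_rv_def)
    note [measurable] = X
    \<comment> \<open>The pairing of Z with X need not be integrable, hence the truncation at 1. The
      truncation at 0 makes W nonnegative everywhere, and W still lies below the pairing almost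
      surely.\<close>
    define W where "W \<omega> = max (min (Z \<omega> \<bullet> X \<omega>) 1) 0" for \<omega>
    have [measurable]: "W \<in> borel_measurable M" unfolding W_def by measurable
    have W_int: "integrable M W"
      by (rule integrable_const_bound[where B = 1]) (auto simp: W_def)
    have ZX: "AE \<omega> in M. 0 \<le> Z \<omega> \<bullet> X \<omega>"
      using Zp pos by eventually_elim
        (auto intro!: inner_vec_nonneg simp: nonneg_vec_iff less_eq_vec_def less_imp_le)
    have "0 \<le> (\<integral>\<omega>. - W \<omega> \<partial>M)"
    proof (rule supermartingale_tail[OF Z D1 _ _ \<eta>, of 0])
      show "AE \<omega> in M. 0 \<le> - W \<omega> + (\<Sum>s=0..T. Z \<omega> \<bullet> G s \<omega> (\<eta> s \<omega>))"
        using le Zp ZX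
      proof eventually_elim
        case (elim \<omega>)
        have "0 \<le> Z \<omega> \<bullet> ((\<Sum>s=0..T. G s \<omega> (\<eta> s \<omega>)) - X \<omega>)"
          using elim by (intro inner_vec_nonneg) (auto simp: less_eq_vec_def less_imp_le)
        then show ?case using elim(3) by (simp add: inner_diff_right inner_sum_right W_def)
      qed
    qed (use W_int in auto)
    moreover have W0: "0 \<le> W \<omega>" for \<omega> by (simp add: W_def)
    then have "0 \<le> (\<integral>\<omega>. W \<omega> \<partial>M)" by (intro integral_nonneg_AE) simp
    ultimately have "(\<integral>\<omega>. W \<omega> \<partial>M) = 0" by simp
    then have "AE \<omega> in M. W \<omega> = 0"
      using integral_nonneg_eq_0_iff_AE[OF W_int] W0 by simp
    with Zp pos show ?thesis
    proof eventually_elim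
      case (elim \<omega>)
      have nn: "0 \<le> Z \<omega> $ i * X \<omega> $ i" for i
        using elim by (simp add: nonneg_vec_def less_imp_le)
      have "Z \<omega> \<bullet> X \<omega> \<le> 0" using elim(3) by (auto simp: W_def max_def min_def split: if_splits)
      then have "(\<Sum>i\<in>UNIV. Z \<omega> $ i * X \<omega> $ i) = 0"
        using sum_nonneg[of UNIV "\<lambda>i. Z \<omega> $ i * X \<omega> $ i"] nn by (simp add: inner_vec_def)
      then have "\<forall>i. Z \<omega> $ i * X \<omega> $ i = 0" using nn by (simp add: sum_nonneg_eq_0_iff)
      then show ?case using elim(1) by (simp add: vec_eq_iff) (metis less_irrefl)
    qed
  qed
  moreover have "inAT M H A F T X \<and> (AE \<omega> in M. nonneg_vec (X \<omega>))"
    if X: "X \<in> borel_measurable M" and X0: "AE \<omega> in M. X \<omega> = 0" for X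
  proof
    have "attainable 0 X"
      by (rule attainable_mono[OF attainable_zero X]) (use X0 in \<open>eventually_elim; simp\<close>)
    then show "inAT M H A F T X" by (rule attainable_inAT)
    show "AE \<omega> in M. nonneg_vec (X \<omega>)" using X0 by eventually_elim (simp add: nonneg_vec_def)
  qed
  ultimately show ?thesis unfolding NAw_def using inAT_attainable by blast
qed

end

theorem mainTheorem2:
  fixes M :: "'a measure" and H :: "nat \<Rightarrow> 'a measure" and T :: nat
    and A :: "(real^'d::finite^'d) set"
    and F :: "nat \<Rightarrow> 'a \<Rightarrow> real^'d^'d \<Rightarrow> real^'d"
  assumes "prob_space M" and "complete_measure M"
    and "is_filtration M H T"
    and "closed_convex_cone A"
    and "boldF M A T F"
    and "HcalA M A F T"
    and "condI M F T"
  shows "((\<exists>Z. inD M H A F T Z) \<longrightarrow> NAw M H A F T) \<and>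
         (HN0 M H A F T \<and> KP M H A F T \<longrightarrow> NAw M H A F T \<longrightarrow> (\<exists>Z. inD M H A F T Z))"
proof -
  interpret integrable_market M H T A F
    by (intro integrable_market.intro market.intro market_axioms.intro
        integrable_market_axioms.intro assms)
  show ?thesis using inD_imp_NAw NAw_imp_inD by blast
qed

end
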